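(* Let $m\ge 2$ be an integer and let $u_{m-1},u_{m-2}$ be given by the iterative construction described in the context. If $J_m(u_0)<\infty$, then there exists a minimizer $\widetilde u_m\in\mathcal K$ of the functional $J_m$ over $\mathcal K$, where $$J_m(u)= \int_{\Omega \cap \mathcal{S}_m(u)}\frac{|u -2u_{m-1} +u_{m-2}|^2}{2 h^2} \,dx + \frac{1}{4} \int_{\Omega} |\nabla u + \nabla u_{m-2}|^2 \,dx .$$
   Context: $\Omega\subset\mathbb R^N$ is a bounded Lipschitz domain, $h>0$ is a time step, $u_0\in H^1(\Omega)$, $v_0\in H^1_0(\Omega)$, and $\mathcal K:=\{u\in H^1(\Omega)\,:\,u=u_0\text{ on }\partial\Omega\}$ (traces). For $m\ge2$, $\mathcal S_m(u):=\{u>0\}\cup\{u_{m-1}>0\}\cup\{u_{m-2}>0\}$, with $\{u>0\}=\{x\in\Omega: u(x)>0\}$. The functions $u_m$ are constructed iteratively: $u_0$ is given, $u_1:=u_0+hv_0$, and for $m\ge 2$, $\widetilde u_m$ denotes a minimizer of $J_m$ in $\mathcal K$ and $u_m:=\max\{\widetilde u_m,0\}$. *)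

theory Defs
  imports "HOL-Analysis.Analysis"
begin

section \<open>Domains\<close>

text \<open>Near each boundary point the domain is, in rotated coordinates, the part of a ball above the
  graph of a Lipschitz function. The unit vector \<open>e\<close> is the vertical direction and
  \<open>y - (e \<bullet> y) *\<^sub>R e\<close> is the horizontal part of \<open>y\<close>.\<close>

definition lipschitz_boundary :: "'a::euclidean_space set \<Rightarrow> bool" where
  "lipschitz_boundary \<Omega> \<longleftrightarrow>
     (\<forall>x\<in>frontier \<Omega>. \<exists>r>0. \<exists>e L. \<exists>\<gamma> :: 'a \<Rightarrow> real.
        norm e = 1 \<and> L-lipschitz_on {z. e \<bullet> z = 0} \<gamma> \<and>
        \<Omega> \<inter> ball x r = {y \<in> ball x r. e \<bullet> y > \<gamma> (y - (e \<bullet> y) *\<^sub>R e)})"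

definition bounded_lipschitz_domain :: "'a::euclidean_space set \<Rightarrow> bool" where
  "bounded_lipschitz_domain \<Omega> \<longleftrightarrow>
     open \<Omega> \<and> connected \<Omega> \<and> \<Omega> \<noteq> {} \<and> bounded \<Omega> \<and> lipschitz_boundary \<Omega>"


section \<open>Smooth functions\<close>

fun Ck :: "nat \<Rightarrow> ('a::euclidean_space \<Rightarrow> real) \<Rightarrow> bool" where
  "Ck 0 f \<longleftrightarrow> continuous_on UNIV f"
| "Ck (Suc k) f \<longleftrightarrow> f differentiable_on UNIV \<and>
     (\<forall>i\<in>Basis. Ck k (\<lambda>x. frechet_derivative f (at x) i))"

definition smooth :: "('a::euclidean_space \<Rightarrow> real) \<Rightarrow> bool" where
  "smooth f \<longleftrightarrow> (\<forall>k. Ck k f)"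

definition test_functions :: "'a::euclidean_space set \<Rightarrow> ('a \<Rightarrow> real) set" where
  "test_functions \<Omega> = {\<phi>. smooth \<phi> \<and> compact (closure {x. \<phi> x \<noteq> 0}) \<and> closure {x. \<phi> x \<noteq> 0} \<subseteq> \<Omega>}"


section \<open>Sobolev spaces\<close>

text \<open>Elements of \<open>L\<^sup>2\<close> and \<open>H\<^sup>1\<close> are represented by functions on the whole space; their values
  outside \<open>\<Omega>\<close> are irrelevant.\<close>

definition L2_norm_sq :: "'a measure \<Rightarrow> ('a \<Rightarrow> 'b::real_normed_vector) \<Rightarrow> ennreal" where
  "L2_norm_sq M f = (\<integral>\<^sup>+x. ennreal ((norm (f x))\<^sup>2) \<partial>M)"

definition L2 :: "'a measure \<Rightarrow> ('a \<Rightarrow> 'b::real_normed_vector) set" where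
  "L2 M = {f \<in> borel_measurable M. L2_norm_sq M f < \<infinity>}"

definition has_weak_gradient ::
    "'a::euclidean_space set \<Rightarrow> ('a \<Rightarrow> real) \<Rightarrow> ('a \<Rightarrow> 'a) \<Rightarrow> bool" where
  "has_weak_gradient \<Omega> u g \<longleftrightarrow>
     (\<forall>\<phi>\<in>test_functions \<Omega>. \<forall>i\<in>Basis.
        (\<integral>x. u x * frechet_derivative \<phi> (at x) i \<partial>lebesgue_on \<Omega>)
          = - (\<integral>x. (g x \<bullet> i) * \<phi> x \<partial>lebesgue_on \<Omega>))"

definition H1 :: "'a::euclidean_space set \<Rightarrow> ('a \<Rightarrow> real) set" where
  "H1 \<Omega> = {u \<in> L2 (lebesgue_on \<Omega>). \<exists>g\<in>L2 (lebesgue_on \<Omega>). has_weak_gradient \<Omega> u g}"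

text \<open>The weak gradient of an \<open>H\<^sup>1\<close> function is unique up to a null set of \<open>\<Omega>\<close>.\<close>

definition weak_gradient :: "'a::euclidean_space set \<Rightarrow> ('a \<Rightarrow> real) \<Rightarrow> 'a \<Rightarrow> 'a" where
  "weak_gradient \<Omega> u = (SOME g. g \<in> L2 (lebesgue_on \<Omega>) \<and> has_weak_gradient \<Omega> u g)"

definition H1_norm_sq :: "'a::euclidean_space set \<Rightarrow> ('a \<Rightarrow> real) \<Rightarrow> ennreal" where
  "H1_norm_sq \<Omega> u =
     L2_norm_sq (lebesgue_on \<Omega>) u + L2_norm_sq (lebesgue_on \<Omega>) (weak_gradient \<Omega> u)"

definition H10 :: "'a::euclidean_space set \<Rightarrow> ('a \<Rightarrow> real) set" where
  "H10 \<Omega> = {v \<in> H1 \<Omega>. \<exists>\<phi>. (\<forall>n. \<phi> n \<in> test_functions \<Omega>) \<and>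
     (\<lambda>n. H1_norm_sq \<Omega> (\<lambda>x. \<phi> n x - v x)) \<longlonglongrightarrow> 0}"


section \<open>Traces\<close>

text \<open>Hausdorff measure of integer dimension \<open>n\<close>, normalised to agree with Lebesgue measure. The
  empty set is treated separately because \<open>0 ^ 0 = 1\<close>, which is the right weight for a singleton
  if \<open>n = 0\<close>. As \<open>hausdorff_outer n\<close> is a metric outer measure, it is countably additive on
  the Borel sets.\<close>

definition hausdorff_pre :: "nat \<Rightarrow> real \<Rightarrow> 'a::euclidean_space set \<Rightarrow> ennreal" where
  "hausdorff_pre n \<delta> A =
     (INF C \<in> {C :: nat \<Rightarrow> 'a set. A \<subseteq> (\<Union>i. C i) \<and> (\<forall>i. bounded (C i) \<and> diameter (C i) \<le> \<delta>)}.
        \<Sum>i. if C i = {} then 0 else ennreal (unit_ball_vol (real n) * (diameter (C i) / 2) ^ n))"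

definition hausdorff_outer :: "nat \<Rightarrow> 'a::euclidean_space set \<Rightarrow> ennreal" where
  "hausdorff_outer n A = (SUP \<delta>\<in>{0<..}. hausdorff_pre n \<delta> A)"

definition hausdorff_measure :: "nat \<Rightarrow> 'a::euclidean_space measure" where
  "hausdorff_measure n = measure_of UNIV (sets borel) (hausdorff_outer n)"

definition boundary_measure :: "'a::euclidean_space set \<Rightarrow> 'a measure" where
  "boundary_measure \<Omega> = restrict_space (hausdorff_measure (DIM('a) - 1)) (frontier \<Omega>)"

text \<open>The trace operator from \<open>H\<^sup>1(\<Omega>)\<close> to \<open>L\<^sup>2(\<partial>\<Omega>)\<close> is the continuous extension of
  the restriction map on functions smooth up to the boundary; \<open>has_trace \<Omega> u \<tau>\<close> says that
  it maps \<open>u\<close> to \<open>\<tau>\<close>.\<close>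

definition has_trace :: "'a::euclidean_space set \<Rightarrow> ('a \<Rightarrow> real) \<Rightarrow> ('a \<Rightarrow> real) \<Rightarrow> bool" where
  "has_trace \<Omega> u \<tau> \<longleftrightarrow> u \<in> H1 \<Omega> \<and> \<tau> \<in> L2 (boundary_measure \<Omega>) \<and>
     (\<exists>\<phi>. (\<forall>n. smooth (\<phi> n)) \<and>
        (\<lambda>n. H1_norm_sq \<Omega> (\<lambda>x. \<phi> n x - u x)) \<longlonglongrightarrow> 0 \<and>
        (\<lambda>n. L2_norm_sq (boundary_measure \<Omega>) (\<lambda>x. \<phi> n x - \<tau> x)) \<longlonglongrightarrow> 0)"

text \<open>As the trace is linear, \<open>u = u0\<close> on the boundary means that \<open>u - u0\<close> has trace zero.\<close>

definition admissible :: "'a::euclidean_space set \<Rightarrow> ('a \<Rightarrow> real) \<Rightarrow> ('a \<Rightarrow> real) set" where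
  "admissible \<Omega> u0 = {u \<in> H1 \<Omega>. has_trace \<Omega> (\<lambda>x. u x - u0 x) (\<lambda>x. 0)}"


section \<open>The functional\<close>

definition positivity_set :: "'a set \<Rightarrow> ('a \<Rightarrow> real) \<Rightarrow> 'a set" where
  "positivity_set \<Omega> u = {x \<in> \<Omega>. u x > 0}"

text \<open>The arguments \<open>u1\<close> and \<open>u2\<close> stand for \<open>u\<^bsub>m-1\<^esub>\<close> and \<open>u\<^bsub>m-2\<^esub>\<close>.\<close>

definition S_set :: "'a set \<Rightarrow> ('a \<Rightarrow> real) \<Rightarrow> ('a \<Rightarrow> real) \<Rightarrow> ('a \<Rightarrow> real) \<Rightarrow> 'a set" where
  "S_set \<Omega> u1 u2 u = positivity_set \<Omega> u \<union> positivity_set \<Omega> u1 \<union> positivity_set \<Omega> u2"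

definition J :: "'a::euclidean_space set \<Rightarrow> real \<Rightarrow> ('a \<Rightarrow> real) \<Rightarrow> ('a \<Rightarrow> real) \<Rightarrow> ('a \<Rightarrow> real) \<Rightarrow> ennreal"
  where
  "J \<Omega> h u1 u2 u =
     (\<integral>\<^sup>+x\<in>\<Omega> \<inter> S_set \<Omega> u1 u2 u. ennreal (\<bar>u x - 2 * u1 x + u2 x\<bar>\<^sup>2 / (2 * h\<^sup>2)) \<partial>lebesgue) +
     ennreal (1 / 4) *
       (\<integral>\<^sup>+x\<in>\<Omega>. ennreal ((norm (weak_gradient \<Omega> u x + weak_gradient \<Omega> u2 x))\<^sup>2) \<partial>lebesgue)"

end

theory Submission
  imports Defs "HOL-Complex_Analysis.Great_Picard"
begin

text \<open>The quadratic integrand over \<open>S_set\<close> is not convex in the competitor, but it is lower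
  semicontinuous under convergence almost everywhere, so the direct method needs compactness for
  that mode of convergence only. Along a minimizing sequence the gradients are bounded in \<open>L\<^sup>2\<close>, and
  the Poincare inequality for functions with trace zero bounds the functions themselves. Translation
  estimates for Sobolev functions then give a subsequence that converges almost everywhere. In place
  of a weak limit of the gradients, one minimizes the (convex) gradient term approximately over
  competitors that stay between the tails of that subsequence: by the parallelogram law these
  converge strongly in \<open>H\<^sup>1\<close>, to the same limit.

  The Poincare inequality is obtained by following each point of the domain in a fixed coordinate
  direction up to the boundary; covering the boundary by small sets shows that the image of Lebesgue
  measure under the exit map is at most a constant times the Hausdorff measure. That the
  earlier iterates \<open>max w 0\<close> are again in \<open>H\<^sup>1\<close> follows from the same translation estimates
  by a Riesz representation argument.\<close>

section \<open>Square-integrable functions\<close>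

text \<open>No single sequence serves both terms of the functional. The minimizing sequence
  \<open>w n\<close> controls their sum, but its gradients are only bounded; the almost minimizers
  \<open>z n\<close> of the gradient term converge strongly, but nothing is known about their
  inertia term. The two are coupled through values alone: \<open>w n\<close> is itself one of the
  competitors at stage n, so its gradient energy is at least the infimum \<open>d n\<close> taken
  there, and its inertia term is at most \<open>i + 1 / Suc n - d n / 4\<close>, where i is the
  infimum of the functional. If \<open>d n\<close> tends to Q, the inertia term of the common limit
  is at most i - Q/4 by lower semicontinuity, its gradient energy is at most Q, and the total is at
  most i. Convergence almost everywhere is also the reason that interior estimates suffice:
  translations are compared only on sets whose shifts stay in the domain, and these sets exhaust
  it.\<close>

lemma L2_measurable [measurable_dest]: "f \<in> L2 M \<Longrightarrow> f \<in> borel_measurable M"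
  by (simp add: L2_def)

lemma L2_norm_sq_cong_AE: "AE x in M. f x = g x \<Longrightarrow> L2_norm_sq M f = L2_norm_sq M g"
  unfolding L2_norm_sq_def by (rule nn_integral_cong_AE) auto

lemma norm_add_sq_le: "(norm (a + b :: 'b::real_normed_vector))\<^sup>2 \<le> 2 * (norm a)\<^sup>2 + 2 * (norm b)\<^sup>2"
proof -
  have "(norm (a + b))\<^sup>2 \<le> (norm a + norm b)\<^sup>2"
    by (intro power_mono norm_triangle_ineq) auto
  also have "\<dots> \<le> 2 * (norm a)\<^sup>2 + 2 * (norm b)\<^sup>2"
    using zero_le_power2[of "norm a - norm b"] by (simp add: power2_eq_square algebra_simps)
  finally show ?thesis .
qed

lemma L2_norm_sq_add_le:
  fixes f g :: "'a \<Rightarrow> 'b::euclidean_space"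
  assumes [measurable]: "f \<in> borel_measurable M" "g \<in> borel_measurable M"
  shows "L2_norm_sq M (\<lambda>x. f x + g x) \<le> 2 * L2_norm_sq M f + 2 * L2_norm_sq M g"
proof -
  have "L2_norm_sq M (\<lambda>x. f x + g x)
      \<le> (\<integral>\<^sup>+x. 2 * ennreal ((norm (f x))\<^sup>2) + 2 * ennreal ((norm (g x))\<^sup>2) \<partial>M)"
    unfolding L2_norm_sq_def
  proof (intro nn_integral_mono)
    fix x
    have "ennreal ((norm (f x + g x))\<^sup>2) \<le> ennreal (2 * (norm (f x))\<^sup>2 + 2 * (norm (g x))\<^sup>2)"
      by (intro ennreal_leI norm_add_sq_le)
    also have "\<dots> = 2 * ennreal ((norm (f x))\<^sup>2) + 2 * ennreal ((norm (g x))\<^sup>2)"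
      by (simp add: ennreal_plus ennreal_mult)
    finally show "ennreal ((norm (f x + g x))\<^sup>2) \<le> 2 * ennreal ((norm (f x))\<^sup>2) + 2 * ennreal ((norm (g x))\<^sup>2)" .
  qed
  also have "\<dots> = 2 * L2_norm_sq M f + 2 * L2_norm_sq M g"
    unfolding L2_norm_sq_def by (simp add: nn_integral_add nn_integral_cmult)
  finally show ?thesis .
qed

lemma L2_norm_sq_scaleR:
  fixes f :: "'a \<Rightarrow> 'b::euclidean_space"
  assumes [measurable]: "f \<in> borel_measurable M"
  shows "L2_norm_sq M (\<lambda>x. c *\<^sub>R f x) = ennreal (c\<^sup>2) * L2_norm_sq M f"
  unfolding L2_norm_sq_def
  by (subst nn_integral_cmult[symmetric]) (auto simp: power_mult_distrib ennreal_mult)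

lemma L2_norm_sq_uminus: "L2_norm_sq M (\<lambda>x. - f x) = L2_norm_sq M f"
  by (simp add: L2_norm_sq_def)

lemma L2_norm_sq_diff_le:
  fixes f g :: "'a \<Rightarrow> 'b::euclidean_space"
  assumes "f \<in> borel_measurable M" "g \<in> borel_measurable M"
  shows "L2_norm_sq M (\<lambda>x. f x - g x) \<le> 2 * L2_norm_sq M f + 2 * L2_norm_sq M g"
  using L2_norm_sq_add_le[of f M "\<lambda>x. - g x"] assms by (simp add: L2_norm_sq_uminus)

lemma L2_norm_sq_diff_triangle:
  fixes f g h :: "'a \<Rightarrow> 'b::euclidean_space"
  assumes "f \<in> borel_measurable M" "g \<in> borel_measurable M" "h \<in> borel_measurable M"
  shows "L2_norm_sq M (\<lambda>x. f x - h x)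
    \<le> 2 * L2_norm_sq M (\<lambda>x. f x - g x) + 2 * L2_norm_sq M (\<lambda>x. g x - h x)"
  using L2_norm_sq_add_le[of "\<lambda>x. f x - g x" M "\<lambda>x. g x - h x"] assms by simp

section \<open>The vector space of square-integrable functions\<close>

lemma L2_add [intro]:
  fixes f g :: "'a \<Rightarrow> 'b::euclidean_space"
  assumes "f \<in> L2 M" "g \<in> L2 M"
  shows "(\<lambda>x. f x + g x) \<in> L2 M"
  using L2_norm_sq_add_le[of f M g] assms
  by (auto simp: L2_def ennreal_mult_less_top elim!: le_less_trans)

lemma L2_scaleR [intro]:
  fixes f :: "'a \<Rightarrow> 'b::euclidean_space"
  assumes "f \<in> L2 M"
  shows "(\<lambda>x. c *\<^sub>R f x) \<in> L2 M"
  using assms L2_norm_sq_scaleR[of f M c]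
  by (auto simp: L2_def ennreal_mult_less_top)

lemma L2_cmult [intro]: "f \<in> L2 M \<Longrightarrow> (\<lambda>x. c * f x :: real) \<in> L2 M"
  using L2_scaleR[of f M c] by simp

lemma L2_diff [intro]:
  fixes f g :: "'a \<Rightarrow> 'b::euclidean_space"
  assumes "f \<in> L2 M" "g \<in> L2 M"
  shows "(\<lambda>x. f x - g x) \<in> L2 M"
  using L2_add[OF assms(1) L2_scaleR[OF assms(2), of "-1"]] by simp

lemma L2_zero [intro, simp]: "(\<lambda>x. 0) \<in> L2 M"
  by (simp add: L2_def L2_norm_sq_def)

lemma L2_norm_sq_zero [simp]: "L2_norm_sq M (\<lambda>x. 0) = 0"
  by (simp add: L2_norm_sq_def)

text \<open>The two functions may take values in different spaces, so that a component can be
  compared with its vector field and a field with its norm.\<close>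

lemma L2_dominated:
  fixes f :: "'a \<Rightarrow> 'b::euclidean_space" and g :: "'a \<Rightarrow> 'c::euclidean_space"
  assumes "f \<in> borel_measurable M" "g \<in> L2 M" "AE x in M. norm (f x) \<le> norm (g x)"
  shows "f \<in> L2 M"
proof -
  have "L2_norm_sq M f \<le> L2_norm_sq M g"
    unfolding L2_norm_sq_def using assms(3)
    by (intro nn_integral_mono_AE) (auto intro!: ennreal_leI power_mono)
  then show ?thesis using assms by (auto simp: L2_def top.not_eq_extremum intro: le_less_trans)
qed

section \<open>Inner products and the Cauchy-Schwarz inequality\<close>

lemma L2_integrable_inner:
  fixes f g :: "'a \<Rightarrow> 'b::euclidean_space"
  assumes "f \<in> L2 M" "g \<in> L2 M"
  shows "integrable M (\<lambda>x. f x \<bullet> g x)"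
proof (rule integrableI_bounded)
  have [measurable]: "f \<in> borel_measurable M" "g \<in> borel_measurable M"
    using assms by (auto simp: L2_def)
  show "(\<lambda>x. f x \<bullet> g x) \<in> borel_measurable M" by measurable
  have "(\<integral>\<^sup>+x. ennreal (norm (f x \<bullet> g x)) \<partial>M)
      \<le> (\<integral>\<^sup>+x. ennreal ((norm (f x))\<^sup>2) + ennreal ((norm (g x))\<^sup>2) \<partial>M)"
  proof (intro nn_integral_mono)
    fix x
    have "norm (f x \<bullet> g x) \<le> norm (f x) * norm (g x)"
      by (simp add: Cauchy_Schwarz_ineq2)
    also have "\<dots> \<le> (norm (f x))\<^sup>2 + (norm (g x))\<^sup>2"
    proof -
      have "2 * (norm (f x) * norm (g x)) \<le> (norm (f x))\<^sup>2 + (norm (g x))\<^sup>2"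
        using sum_squares_bound[of "norm (f x)" "norm (g x)"] by simp
      moreover have "0 \<le> norm (f x) * norm (g x)" by simp
      ultimately show ?thesis by linarith
    qed
    finally have "norm (f x \<bullet> g x) \<le> (norm (f x))\<^sup>2 + (norm (g x))\<^sup>2" .
    then show "ennreal (norm (f x \<bullet> g x)) \<le> ennreal ((norm (f x))\<^sup>2) + ennreal ((norm (g x))\<^sup>2)"
      by (simp add: ennreal_plus[symmetric] ennreal_leI del: ennreal_plus)
  qed
  also have "\<dots> = L2_norm_sq M f + L2_norm_sq M g"
    unfolding L2_norm_sq_def by (simp add: nn_integral_add)
  also have "\<dots> < \<infinity>" using assms by (simp add: L2_def)
  finally show "(\<integral>\<^sup>+x. ennreal (norm (f x \<bullet> g x)) \<partial>M) < \<infinity>" .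
qed

lemma L2_integrable_mult:
  fixes f g :: "'a \<Rightarrow> real"
  shows "f \<in> L2 M \<Longrightarrow> g \<in> L2 M \<Longrightarrow> integrable M (\<lambda>x. f x * g x)"
  using L2_integrable_inner[of f M g] by simp

text \<open>The real-valued form of \<open>L2_norm_sq\<close>, in which differences can be taken. If
  the square is not integrable the Bochner integral defaults to 0, so the two forms are identified
  only for members of \<open>L2\<close>.\<close>

definition sqnorm :: "'a measure \<Rightarrow> ('a \<Rightarrow> 'b::euclidean_space) \<Rightarrow> real" where
  "sqnorm M f = (\<integral>x. (norm (f x))\<^sup>2 \<partial>M)"

lemma sqnorm_nonneg [simp]: "0 \<le> sqnorm M f"
  by (simp add: sqnorm_def)

lemma L2_integrable_sq:
  fixes f :: "'a \<Rightarrow> 'b::euclidean_space"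
  shows "f \<in> L2 M \<Longrightarrow> integrable M (\<lambda>x. (norm (f x))\<^sup>2)"
  using L2_integrable_inner[of f M f] by (simp add: power2_norm_eq_inner)

lemma L2_norm_sq_eq:
  fixes f :: "'a \<Rightarrow> 'b::euclidean_space"
  assumes "f \<in> L2 M"
  shows "L2_norm_sq M f = ennreal (sqnorm M f)"
  unfolding L2_norm_sq_def sqnorm_def
  by (rule nn_integral_eq_integral[OF L2_integrable_sq[OF assms]]) simp

lemma L2_Cauchy_Schwarz:
  fixes f g :: "'a \<Rightarrow> 'b::euclidean_space"
  assumes "f \<in> L2 M" "g \<in> L2 M"
  shows "(\<integral>x. f x \<bullet> g x \<partial>M)\<^sup>2 \<le> sqnorm M f * sqnorm M g"
proof -
  have [measurable]: "f \<in> borel_measurable M" "g \<in> borel_measurable M"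
    using assms by (auto simp: L2_def)
  have int: "integrable M (\<lambda>x. \<bar>f x \<bullet> g x\<bar>)"
    using L2_integrable_inner[OF assms] by simp
  have "\<bar>\<integral>x. f x \<bullet> g x \<partial>M\<bar> \<le> (\<integral>x. \<bar>f x \<bullet> g x\<bar> \<partial>M)" by simp
  then have "(\<integral>x. f x \<bullet> g x \<partial>M)\<^sup>2 \<le> (\<integral>x. \<bar>f x \<bullet> g x\<bar> \<partial>M)\<^sup>2"
    by (metis abs_ge_zero power2_abs power_mono)
  then have "ennreal ((\<integral>x. f x \<bullet> g x \<partial>M)\<^sup>2) \<le> (ennreal (\<integral>x. \<bar>f x \<bullet> g x\<bar> \<partial>M))\<^sup>2"
    by (subst ennreal_power) (auto intro: ennreal_leI)
  also have "\<dots> = (\<integral>\<^sup>+x. ennreal \<bar>f x \<bullet> g x\<bar> \<partial>M)\<^sup>2"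
    using nn_integral_eq_integral[OF int] by simp
  also have "\<dots> \<le> (\<integral>\<^sup>+x. ennreal (norm (f x)) * ennreal (norm (g x)) \<partial>M)\<^sup>2"
    by (intro power_mono nn_integral_mono)
       (auto simp: ennreal_mult[symmetric] Cauchy_Schwarz_ineq2 intro!: ennreal_leI)
  also have "\<dots> \<le> (\<integral>\<^sup>+x. (ennreal (norm (f x)))\<^sup>2 \<partial>M) * (\<integral>\<^sup>+x. (ennreal (norm (g x)))\<^sup>2 \<partial>M)"
    by (intro Cauchy_Schwarz_nn_integral) auto
  also have "\<dots> = L2_norm_sq M f * L2_norm_sq M g"
    unfolding L2_norm_sq_def by (simp add: ennreal_power)
  also have "\<dots> = ennreal (sqnorm M f * sqnorm M g)"
    using assms by (simp add: L2_norm_sq_eq ennreal_mult)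
  finally show ?thesis by (subst (asm) ennreal_le_iff) auto
qed

lemma L2_Cauchy_Schwarz_sqrt:
  fixes f g :: "'a \<Rightarrow> 'b::euclidean_space"
  assumes "f \<in> L2 M" "g \<in> L2 M"
  shows "\<bar>\<integral>x. f x \<bullet> g x \<partial>M\<bar> \<le> sqrt (sqnorm M f) * sqrt (sqnorm M g)"
  using real_sqrt_le_mono[OF L2_Cauchy_Schwarz[OF assms]] by (simp add: real_sqrt_mult)

text \<open>A Riesz-Fischer argument with the exhaustion built in. The k-th increment of the
  subsequence is at most 16^-k in squared norm on \<open>A k\<close>; after weighting by 4^k these
  bounds still sum, so at almost every point the increments decay like 2^-k. A point of
  \<open>A k0\<close> belongs to every later \<open>A k\<close>, so only finitely many of its
  increments escape the bound. A constant exhaustion gives completeness, interior sets give local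
  compactness.\<close>

lemma AE_convergent_subseq:
  fixes f :: "nat \<Rightarrow> 'a \<Rightarrow> 'b::euclidean_space"
  assumes meas [measurable]: "\<And>n. f n \<in> borel_measurable M"
    and A [measurable]: "\<And>k. A k \<in> sets M" and "incseq A"
    and cauchy: "\<And>k e. 0 < e \<Longrightarrow>
      \<exists>N. \<forall>m\<ge>N. \<forall>n\<ge>N. (\<integral>\<^sup>+x\<in>A k. ennreal ((norm (f m x - f n x))\<^sup>2) \<partial>M) \<le> ennreal e"
  shows "\<exists>r l. strict_mono r \<and> l \<in> borel_measurable M \<and>
    (AE x in M. x \<in> (\<Union>k. A k) \<longrightarrow> (\<lambda>n. f (r n) x) \<longlonglongrightarrow> l x)"
proof -
  have "\<exists>N. \<forall>k. \<forall>m\<ge>N k. \<forall>n\<ge>N k.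
      (\<integral>\<^sup>+x\<in>A k. ennreal ((norm (f m x - f n x))\<^sup>2) \<partial>M) \<le> ennreal ((1/16)^k)"
    using cauchy[of "(1/16)^k" for k] by (intro choice) auto
  then obtain N where N: "\<And>k m n. m \<ge> N k \<Longrightarrow> n \<ge> N k \<Longrightarrow>
      (\<integral>\<^sup>+x\<in>A k. ennreal ((norm (f m x - f n x))\<^sup>2) \<partial>M) \<le> ennreal ((1/16)^k)"
    by blast
  \<comment> \<open>The summand k makes \<open>r\<close> strictly increasing; the sum over all j up
    to k makes \<open>r k\<close> at least \<open>N k\<close>.\<close>
  define r where "r k = k + (\<Sum>j\<le>k. N j)" for k
  have r: "strict_mono r"
    by (rule strict_monoI_Suc) (simp add: r_def)
  have rN: "r k \<ge> N k" for k
    unfolding r_def by (rule trans_le_add2) (auto intro: member_le_sum)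
  define d where "d k x = norm (f (r (Suc k)) x - f (r k) x)" for k x
  have [measurable]: "d k \<in> borel_measurable M" for k
    unfolding d_def by measurable
  define g where "g k x = ennreal (4^k) * (ennreal ((d k x)\<^sup>2) * indicator (A k) x)" for k x
  have gm [measurable]: "g k \<in> borel_measurable M" for k
    unfolding g_def by measurable
  have gi: "(\<integral>\<^sup>+x. g k x \<partial>M) \<le> ennreal ((1/4)^k)" for k
  proof -
    have "(\<integral>\<^sup>+x. g k x \<partial>M) = ennreal (4^k) * (\<integral>\<^sup>+x\<in>A k. ennreal ((d k x)\<^sup>2) \<partial>M)"
      unfolding g_def by (rule nn_integral_cmult) measurable
    also have "\<dots> \<le> ennreal (4^k) * ennreal ((1/16)^k)"
      unfolding d_def
      by (intro mult_left_mono N rN) (auto intro!: order_trans[OF rN] strict_mono_leD[OF r])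
    also have "\<dots> = ennreal ((1/4)^k)"
      by (subst ennreal_mult[symmetric]) (auto simp: power_mult_distrib[symmetric])
    finally show ?thesis .
  qed
  have "(\<integral>\<^sup>+x. (\<Sum>k. g k x) \<partial>M) = (\<Sum>k. \<integral>\<^sup>+x. g k x \<partial>M)"
    by (rule nn_integral_suminf) simp
  also have "\<dots> \<le> (\<Sum>k. ennreal ((1/4)^k))"
    by (intro suminf_le gi) auto
  also have "\<dots> = ennreal (\<Sum>k. (1/4)^k)"
    by (intro suminf_ennreal2) auto
  also have "\<dots> < \<infinity>" by simp
  finally have "AE x in M. (\<Sum>k. g k x) \<noteq> \<infinity>"
    by (intro nn_integral_PInf_AE) auto
  then have ae: "AE x in M. x \<in> (\<Union>k. A k) \<longrightarrow> convergent (\<lambda>n. f (r n) x)"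
  proof (eventually_elim, intro impI)
    fix x assume fin: "(\<Sum>k. g k x) \<noteq> \<infinity>" and "x \<in> (\<Union>k. A k)"
    then obtain k0 where k0: "x \<in> A k0" by auto
    obtain C where C: "(\<Sum>k. g k x) = ennreal C" "C \<ge> 0"
      using fin by (cases "\<Sum>k. g k x") auto
    have "norm (f (r (Suc k)) x - f (r k) x) \<le> sqrt C * (1/2)^k" if "k \<ge> k0" for k
    proof -
      have "x \<in> A k" using k0 \<open>incseq A\<close> that by (auto simp: incseq_def)
      then have "ennreal (4^k * (d k x)\<^sup>2) = g k x"
        by (simp add: g_def ennreal_mult)
      also have "\<dots> \<le> (\<Sum>k. g k x)"
        using sum_le_suminf[of "\<lambda>k. g k x" "{k}"] by auto
      finally have "4^k * (d k x)\<^sup>2 \<le> C" using C by (simp add: ennreal_le_iff)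
      then have "sqrt ((2^k * d k x)\<^sup>2) \<le> sqrt C"
        by (intro real_sqrt_le_mono) (simp add: power_mult_distrib power_even_eq[symmetric] power_mult[symmetric] mult.commute[of k] power_mult)
      then have "2^k * d k x \<le> sqrt C" by (simp add: d_def)
      then show ?thesis unfolding d_def by (simp add: field_simps power_divide)
    qed
    moreover have "summable (\<lambda>k. sqrt C * (1/2)^k)"
      by (intro summable_mult summable_geometric) auto
    ultimately have "summable (\<lambda>k. f (r (Suc k)) x - f (r k) x)"
      by (rule summable_comparison_test'[rotated]) auto
    then have "convergent (\<lambda>n. \<Sum>k<n. f (r (Suc k)) x - f (r k) x)"
      by (simp add: summable_iff_convergent)
    then have "convergent (\<lambda>n. f (r n) x - f (r 0) x)"
      by (simp only: sum_lessThan_telescope[of "\<lambda>k. f (r k) x"])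
    then have "convergent (\<lambda>n. (f (r n) x - f (r 0) x) + f (r 0) x)"
      by (intro convergent_add convergent_const)
    then show "convergent (\<lambda>n. f (r n) x)" by simp
  qed
  show ?thesis
  proof (intro exI conjI)
    show "strict_mono r" by fact
    show "(\<lambda>x. lim (\<lambda>n. f (r n) x)) \<in> borel_measurable M" by measurable
    show "AE x in M. x \<in> (\<Union>k. A k) \<longrightarrow> (\<lambda>n. f (r n) x) \<longlonglongrightarrow> lim (\<lambda>n. f (r n) x)"
      using ae by eventually_elim (simp add: convergent_LIMSEQ_iff)
  qed
qed

section \<open>Null sequences in \<open>ennreal\<close> and completeness of the space\<close>

lemma tendsto_0_ennrealI:
  fixes X :: "nat \<Rightarrow> ennreal"
  assumes "\<And>e::real. 0 < e \<Longrightarrow> \<exists>N. \<forall>n\<ge>N. X n \<le> ennreal e"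
  shows "X \<longlonglongrightarrow> 0"
proof (rule tendsto_zero_ennreal)
  fix r :: real assume "0 < r"
  then obtain N where "\<forall>n\<ge>N. X n \<le> ennreal (r/2)" using assms[of "r/2"] by auto
  moreover have "ennreal (r/2) < ennreal r" using \<open>0 < r\<close> by (simp add: ennreal_less_iff)
  ultimately show "\<forall>\<^sub>F n in sequentially. X n < ennreal r"
    unfolding eventually_sequentially by (meson le_less_trans)
qed

lemma tendsto_0_ennrealD:
  fixes X :: "nat \<Rightarrow> ennreal"
  assumes "X \<longlonglongrightarrow> 0" "0 < e"
  shows "\<exists>N. \<forall>n\<ge>N. X n \<le> ennreal e"
  using order_tendstoD(2)[OF assms(1), of "ennreal e"] assms(2)
  by (auto simp: eventually_sequentially intro: less_imp_le)

lemma tendsto_0_ennreal_mono: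
  fixes X Y :: "nat \<Rightarrow> ennreal"
  assumes "Y \<longlonglongrightarrow> 0" "\<And>n. X n \<le> Y n"
  shows "X \<longlonglongrightarrow> 0"
  by (rule tendsto_sandwich[OF _ _ tendsto_const assms(1)]) (auto simp: assms(2))

lemma tendsto_0_ennreal_lincomb:
  fixes X Y :: "nat \<Rightarrow> ennreal"
  assumes "X \<longlonglongrightarrow> 0" "Y \<longlonglongrightarrow> 0"
  shows "(\<lambda>n. ennreal a * X n + ennreal b * Y n) \<longlonglongrightarrow> 0"
proof -
  have "(\<lambda>n. ennreal a * X n + ennreal b * Y n) \<longlonglongrightarrow> ennreal a * 0 + ennreal b * 0"
    by (intro tendsto_add ennreal_tendsto_cmult assms) auto
  then show ?thesis by simp
qed

text \<open>The limit comes from an almost everywhere convergent subsequence; Fatou's lemma with one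
  index fixed turns the Cauchy bound into a bound for the distance to that limit. The subsequence
  stays in the conclusion because limits are later identified pointwise.\<close>

lemma L2_complete:
  fixes f :: "nat \<Rightarrow> 'a \<Rightarrow> 'b::euclidean_space"
  assumes L2: "\<And>n. f n \<in> L2 M"
    and cauchy: "\<And>e. 0 < e \<Longrightarrow>
      \<exists>N. \<forall>m\<ge>N. \<forall>n\<ge>N. L2_norm_sq M (\<lambda>x. f m x - f n x) \<le> ennreal e"
  shows "\<exists>l\<in>L2 M. (\<lambda>n. L2_norm_sq M (\<lambda>x. f n x - l x)) \<longlonglongrightarrow> 0 \<and>
    (\<exists>r. strict_mono r \<and> (AE x in M. (\<lambda>n. f (r n) x) \<longlonglongrightarrow> l x))"
proof -
  have [measurable]: "f n \<in> borel_measurable M" for n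
    using L2 by (auto simp: L2_def)
  have eq: "(\<integral>\<^sup>+x\<in>space M. ennreal ((norm (f m x - f n x))\<^sup>2) \<partial>M) = L2_norm_sq M (\<lambda>x. f m x - f n x)" for m n
    unfolding L2_norm_sq_def by (rule nn_integral_cong) auto
  obtain r l where r: "strict_mono r" and l [measurable]: "l \<in> borel_measurable M"
    and conv: "AE x in M. x \<in> (\<Union>k::nat. space M) \<longrightarrow> (\<lambda>n. f (r n) x) \<longlonglongrightarrow> l x"
    using AE_convergent_subseq[of f M "\<lambda>_. space M"] cauchy unfolding eq by (auto simp: incseq_def)
  have conv: "AE x in M. (\<lambda>n. f (r n) x) \<longlonglongrightarrow> l x"
    using conv AE_space by eventually_elim auto
  have lim: "\<exists>N. \<forall>n\<ge>N. L2_norm_sq M (\<lambda>x. f n x - l x) \<le> ennreal e" if "e > 0" for e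
  proof -
    obtain N where N: "\<And>m n. m \<ge> N \<Longrightarrow> n \<ge> N \<Longrightarrow> L2_norm_sq M (\<lambda>x. f m x - f n x) \<le> ennreal e"
      using cauchy[OF \<open>e > 0\<close>] by blast
    have "L2_norm_sq M (\<lambda>x. f n x - l x) \<le> ennreal e" if "n \<ge> N" for n
    proof -
      have "L2_norm_sq M (\<lambda>x. f n x - l x) \<le> (\<integral>\<^sup>+x. liminf (\<lambda>k. ennreal ((norm (f n x - f (r k) x))\<^sup>2)) \<partial>M)"
        unfolding L2_norm_sq_def
      proof (intro nn_integral_mono_AE, use conv in eventually_elim)
        fix x assume "(\<lambda>n. f (r n) x) \<longlonglongrightarrow> l x"
        then have "(\<lambda>k. ennreal ((norm (f n x - f (r k) x))\<^sup>2)) \<longlonglongrightarrow> ennreal ((norm (f n x - l x))\<^sup>2)"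
          by (intro tendsto_ennrealI tendsto_intros)
        then show "ennreal ((norm (f n x - l x))\<^sup>2) \<le> liminf (\<lambda>k. ennreal ((norm (f n x - f (r k) x))\<^sup>2))"
          using lim_imp_Liminf[OF sequentially_bot] by (metis order_refl)
      qed
      also have "\<dots> \<le> liminf (\<lambda>k. \<integral>\<^sup>+x. ennreal ((norm (f n x - f (r k) x))\<^sup>2) \<partial>M)"
        by (rule nn_integral_liminf) measurable
      also have "\<dots> \<le> ennreal e"
      proof (rule Liminf_le)
        show "\<forall>\<^sub>F k in sequentially. (\<integral>\<^sup>+x. ennreal ((norm (f n x - f (r k) x))\<^sup>2) \<partial>M) \<le> ennreal e"
          using eventually_ge_at_top[of N]
        proof eventually_elim
          fix k assume "N \<le> k"
          then have "N \<le> r k" using seq_suble[OF r, of k] by simp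
          then show "(\<integral>\<^sup>+x. ennreal ((norm (f n x - f (r k) x))\<^sup>2) \<partial>M) \<le> ennreal e"
            using N[OF \<open>n \<ge> N\<close>] by (simp add: L2_norm_sq_def)
        qed
      qed simp
      finally show ?thesis .
    qed
    then show ?thesis by blast
  qed
  have "l \<in> L2 M"
  proof -
    obtain N where "L2_norm_sq M (\<lambda>x. f N x - l x) \<le> ennreal 1" using lim[of 1] by auto
    then have "(\<lambda>x. f N x - l x) \<in> L2 M" by (auto simp: L2_def intro: le_less_trans)
    from L2_diff[OF L2[of N] this] show ?thesis by simp
  qed
  moreover have "(\<lambda>n. L2_norm_sq M (\<lambda>x. f n x - l x)) \<longlonglongrightarrow> 0"
    by (rule tendsto_0_ennrealI) (rule lim)
  ultimately show ?thesis using r conv by blast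
qed

lemma L2_tendsto_integral_inner:
  fixes f :: "nat \<Rightarrow> 'a \<Rightarrow> 'b::euclidean_space"
  assumes f: "\<And>n. f n \<in> L2 M" and l: "l \<in> L2 M" and g: "g \<in> L2 M"
    and lim: "(\<lambda>n. L2_norm_sq M (\<lambda>x. f n x - l x)) \<longlonglongrightarrow> 0"
  shows "(\<lambda>n. \<integral>x. f n x \<bullet> g x \<partial>M) \<longlonglongrightarrow> (\<integral>x. l x \<bullet> g x \<partial>M)"
proof -
  have d: "(\<lambda>x. f n x - l x) \<in> L2 M" for n using f l by auto
  have "(\<lambda>n. ennreal (sqnorm M (\<lambda>x. f n x - l x))) \<longlonglongrightarrow> ennreal 0"
    using lim by (simp add: L2_norm_sq_eq[OF d])
  then have "(\<lambda>n. sqnorm M (\<lambda>x. f n x - l x)) \<longlonglongrightarrow> 0"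
    by (subst (asm) tendsto_ennreal_iff) auto
  then have "(\<lambda>n. sqrt (sqnorm M (\<lambda>x. f n x - l x)) * sqrt (sqnorm M g)) \<longlonglongrightarrow> sqrt 0 * sqrt (sqnorm M g)"
    by (intro tendsto_intros)
  then have "(\<lambda>n. (\<integral>x. (f n x - l x) \<bullet> g x \<partial>M)) \<longlonglongrightarrow> 0"
    by (intro Lim_null_comparison[where f="\<lambda>n. \<integral>x. (f n x - l x) \<bullet> g x \<partial>M"])
       (auto intro!: always_eventually L2_Cauchy_Schwarz_sqrt d g)
  also have "(\<lambda>n. (\<integral>x. (f n x - l x) \<bullet> g x \<partial>M)) = (\<lambda>n. (\<integral>x. f n x \<bullet> g x \<partial>M) - (\<integral>x. l x \<bullet> g x \<partial>M))"
    by (simp add: inner_diff_left Bochner_Integration.integral_diff L2_integrable_inner f l g)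
  finally show ?thesis by (rule LIM_zero_cancel)
qed

section \<open>Riesz representation on a subspace\<close>

lemma sqnorm_add_cmult:
  fixes f g :: "'a \<Rightarrow> real"
  assumes "f \<in> L2 M" "g \<in> L2 M"
  shows "sqnorm M (\<lambda>x. f x + c * g x)
    = sqnorm M f + 2 * c * (\<integral>x. f x * g x \<partial>M) + c\<^sup>2 * sqnorm M g"
proof -
  have "sqnorm M (\<lambda>x. f x + c * g x)
      = (\<integral>x. (norm (f x))\<^sup>2 + (2 * c) * (f x * g x) + c\<^sup>2 * (norm (g x))\<^sup>2 \<partial>M)"
    unfolding sqnorm_def by (intro Bochner_Integration.integral_cong) (auto simp: power2_eq_square algebra_simps)
  also have "\<dots> = (\<integral>x. (norm (f x))\<^sup>2 \<partial>M) + (\<integral>x. (2 * c) * (f x * g x) \<partial>M) + (\<integral>x. c\<^sup>2 * (norm (g x))\<^sup>2 \<partial>M)"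
    using L2_integrable_sq[OF assms(1)] L2_integrable_sq[OF assms(2)] L2_integrable_mult[OF assms]
    by (subst Bochner_Integration.integral_add; (intro Bochner_Integration.integrable_add integrable_mult_right)?; simp?)+
  finally show ?thesis by (simp add: sqnorm_def)
qed

text \<open>\<open>V\<close> need not be closed, so the representing function is the limit of a
  minimizing sequence for the energy \<open>sqnorm M f / 2 - T f\<close> and may lie outside
  \<open>V\<close>. Completing the square bounds the energy below, the parallelogram law makes the
  sequence Cauchy, and the vanishing first variation in every direction of \<open>V\<close> is the
  representation.\<close>

lemma L2_Riesz:
  fixes V :: "('a \<Rightarrow> real) set" and T :: "('a \<Rightarrow> real) \<Rightarrow> real"
  assumes V: "V \<subseteq> L2 M" and zero: "(\<lambda>x. 0) \<in> V"
    and add: "\<And>f g. f \<in> V \<Longrightarrow> g \<in> V \<Longrightarrow> (\<lambda>x. f x + g x) \<in> V"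
    and scale: "\<And>f c. f \<in> V \<Longrightarrow> (\<lambda>x. c * f x) \<in> V"
    and Tadd: "\<And>f g. f \<in> V \<Longrightarrow> g \<in> V \<Longrightarrow> T (\<lambda>x. f x + g x) = T f + T g"
    and Tscale: "\<And>f c. f \<in> V \<Longrightarrow> T (\<lambda>x. c * f x) = c * T f"
    and bound: "\<And>f. f \<in> V \<Longrightarrow> \<bar>T f\<bar> \<le> C * sqrt (sqnorm M f)"
  shows "\<exists>G\<in>L2 M. sqnorm M G \<le> C\<^sup>2 \<and> (\<forall>f\<in>V. T f = (\<integral>x. G x * f x \<partial>M))"
proof -
  define E where "E f = sqnorm M f / 2 - T f" for f
  have E_lower: "- C\<^sup>2 / 2 \<le> E f" if "f \<in> V" for f
  proof -
    have "T f \<le> C * sqrt (sqnorm M f)" using bound[OF that] by simp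
    moreover have "0 \<le> (sqrt (sqnorm M f) - C)\<^sup>2" by simp
    moreover have "(sqrt (sqnorm M f))\<^sup>2 = sqnorm M f" by simp
    ultimately show ?thesis
      unfolding E_def by (simp add: power2_diff algebra_simps)
  qed
  define I where "I = Inf (E ` V)"
  have bdd: "bdd_below (E ` V)" using E_lower by (auto simp: bdd_below_def)
  have I_le: "I \<le> E f" if "f \<in> V" for f
    unfolding I_def using bdd that by (intro cInf_lower) auto
  have E_exp: "E (\<lambda>x. f x + c * g x) = E f + c * ((\<integral>x. f x * g x \<partial>M) - T g) + c\<^sup>2 * sqnorm M g / 2"
    if "f \<in> V" "g \<in> V" for f g c
  proof -
    have "f \<in> L2 M" "g \<in> L2 M" using that V by auto
    from sqnorm_add_cmult[OF this, of c] show ?thesis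
      unfolding E_def using that by (simp add: Tadd Tscale scale algebra_simps)
  qed
  have "\<exists>f\<in>V. E f < I + 1 / Suc n" for n
  proof -
    have "\<exists>y\<in>E ` V. y < I + 1 / Suc n"
      unfolding I_def by (rule cInf_lessD) (use zero in auto)
    then show ?thesis by auto
  qed
  then obtain \<psi> where \<psi>V: "\<And>n. \<psi> n \<in> V" and \<psi>E: "\<And>n. E (\<psi> n) < I + 1 / Suc n"
    by metis
  have \<psi>L: "\<psi> n \<in> L2 M" for n using \<psi>V V by auto
  have dist: "sqnorm M (\<lambda>x. \<psi> m x - \<psi> n x) \<le> 4 / Suc m + 4 / Suc n" for m n
  proof -
    let ?a = "\<psi> m" and ?b = "\<psi> n"
    have "(\<lambda>x. (1/2) * ?a x + (1/2) * ?b x) \<in> V" by (intro add scale \<psi>V)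
    then have le: "I \<le> E (\<lambda>x. (1/2) * ?a x + (1/2) * ?b x)" by (rule I_le)
    have "E (\<lambda>x. (1/2) * ?a x + (1/2) * ?b x)
       = E (\<lambda>x. (1/2) * ?a x) + (1/2) * ((\<integral>x. (1/2) * ?a x * ?b x \<partial>M) - T ?b) + (1/2)\<^sup>2 * sqnorm M ?b / 2"
      by (intro E_exp scale \<psi>V)
    also have "E (\<lambda>x. (1/2) * ?a x) = (1/4) * sqnorm M ?a / 2 - (1/2) * T ?a"
      unfolding E_def by (simp add: Tscale \<psi>V[of m] del: times_divide_eq_left) (simp add: sqnorm_def power_mult_distrib power_divide)
    also have "(\<integral>x. (1/2) * ?a x * ?b x \<partial>M) = (1/2) * (\<integral>x. ?a x * ?b x \<partial>M)"
      by (simp add: mult.assoc)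
    finally have mid: "E (\<lambda>x. (1/2) * ?a x + (1/2) * ?b x) = (sqnorm M ?a + sqnorm M ?b + 2 * (\<integral>x. ?a x * ?b x \<partial>M)) / 8
        - T ?a / 2 - T ?b / 2"
      by (simp add: power2_eq_square algebra_simps)
    \<comment> \<open>The parallelogram law in terms of energies: the linear parts cancel, and the
      midpoint, again in \<open>V\<close>, has energy at least \<open>I\<close>.\<close>
    have "sqnorm M (\<lambda>x. ?a x - ?b x) = sqnorm M ?a - 2 * (\<integral>x. ?a x * ?b x \<partial>M) + sqnorm M ?b"
      using sqnorm_add_cmult[OF \<psi>L \<psi>L, of m "-1" n] by simp
    also have "\<dots> = 4 * E ?a + 4 * E ?b - 8 * E (\<lambda>x. (1/2) * ?a x + (1/2) * ?b x)"
      unfolding mid by (simp add: E_def algebra_simps)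
    also have "\<dots> \<le> 4 * (I + 1 / Suc m) + 4 * (I + 1 / Suc n) - 8 * I"
    proof -
      have "4 * E ?a \<le> 4 * (I + 1 / Suc m)" "4 * E ?b \<le> 4 * (I + 1 / Suc n)"
        using \<psi>E[of m] \<psi>E[of n] by simp_all
      moreover have "8 * I \<le> 8 * E (\<lambda>x. (1/2) * ?a x + (1/2) * ?b x)"
        using le by simp
      ultimately show ?thesis by (intro diff_mono add_mono)
    qed
    finally show ?thesis by simp
  qed
  have "\<exists>N. \<forall>m\<ge>N. \<forall>n\<ge>N. L2_norm_sq M (\<lambda>x. \<psi> m x - \<psi> n x) \<le> ennreal e" if "0 < e" for e
  proof -
    obtain N where N: "8 / e < real N" using reals_Archimedean2 by blast
    have "L2_norm_sq M (\<lambda>x. \<psi> m x - \<psi> n x) \<le> ennreal e" if "m \<ge> N" "n \<ge> N" for m n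
    proof -
      have *: "4 / Suc k \<le> e / 2" if "k \<ge> N" for k
      proof -
        have "8 / e < Suc k" using N that by linarith
        then show ?thesis using \<open>0 < e\<close> by (simp add: field_simps)
      qed
      have "sqnorm M (\<lambda>x. \<psi> m x - \<psi> n x) \<le> e"
        using dist[of m n] *[OF that(1)] *[OF that(2)] by linarith
      then show ?thesis by (subst L2_norm_sq_eq) (auto intro!: ennreal_leI \<psi>L)
    qed
    then show ?thesis by blast
  qed
  from L2_complete[OF \<psi>L this] obtain G where G: "G \<in> L2 M"
    and lim: "(\<lambda>n. L2_norm_sq M (\<lambda>x. \<psi> n x - G x)) \<longlonglongrightarrow> 0" by blast
  have inv0: "(\<lambda>n. 1 / real (Suc n)) \<longlonglongrightarrow> 0" by (rule LIMSEQ_Suc[OF lim_1_over_n])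
  have rep: "T \<eta> = (\<integral>x. G x * \<eta> x \<partial>M)" if \<eta>: "\<eta> \<in> V" for \<eta>
  proof -
    define a where "a = (\<integral>x. G x * \<eta> x \<partial>M) - T \<eta>"
    let ?S = "sqnorm M \<eta>"
    have a_lim: "(\<lambda>n. (\<integral>x. \<psi> n x * \<eta> x \<partial>M) - T \<eta>) \<longlonglongrightarrow> a"
      unfolding a_def
      using L2_tendsto_integral_inner[OF \<psi>L G _ lim, of \<eta>] \<eta> V by (intro tendsto_intros) auto
    have "0 \<le> c * a + c\<^sup>2 * ?S / 2" for c
    proof (rule tendsto_lowerbound)
      show "(\<lambda>n. 1 / real (Suc n) + c * ((\<integral>x. \<psi> n x * \<eta> x \<partial>M) - T \<eta>) + c\<^sup>2 * ?S / 2) \<longlonglongrightarrow> c * a + c\<^sup>2 * ?S / 2"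
        using tendsto_add[OF tendsto_add[OF inv0 tendsto_mult_left[OF a_lim, of c]] tendsto_const] by simp
      have "0 \<le> 1 / real (Suc n) + c * ((\<integral>x. \<psi> n x * \<eta> x \<partial>M) - T \<eta>) + c\<^sup>2 * ?S / 2" for n
        using I_le[OF add[OF \<psi>V scale[OF \<eta>]], of n c] E_exp[OF \<psi>V \<eta>, of n c] \<psi>E[of n] by linarith
      then show "\<forall>\<^sub>F n in sequentially. 0 \<le> 1 / real (Suc n) + c * ((\<integral>x. \<psi> n x * \<eta> x \<partial>M) - T \<eta>) + c\<^sup>2 * ?S / 2"
        by simp
    qed simp
    \<comment> \<open>A quadratic in c without constant term is nonnegative for all c only if its
      linear coefficient \<open>a\<close> vanishes. The 1 in the denominator keeps this choice of c
      meaningful when \<open>\<eta>\<close> has norm zero.\<close>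
    from this[of "- a / (?S + 1)"] have "0 \<le> (- a / (?S + 1)) * a + (- a / (?S + 1))\<^sup>2 * ?S / 2" .
    also have "\<dots> = - a\<^sup>2 * (?S + 2) / (2 * (?S + 1)\<^sup>2)"
    proof -
      have "?S + 1 \<noteq> 0" using sqnorm_nonneg[of M \<eta>] by linarith
      then show ?thesis by (simp add: power2_eq_square divide_simps) (simp add: algebra_simps)
    qed
    finally have le0: "0 \<le> - a\<^sup>2 * (?S + 2) / (2 * (?S + 1)\<^sup>2)" .
    have "0 < 2 * (?S + 1)\<^sup>2" using sqnorm_nonneg[of M \<eta>] by (intro mult_pos_pos zero_less_power) linarith+
    with le0 have "0 \<le> - a\<^sup>2 * (?S + 2)" by (simp only: zero_le_divide_iff) linarith
    moreover have "0 < ?S + 2" using sqnorm_nonneg[of M \<eta>] by linarith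
    ultimately have "0 \<le> - a\<^sup>2" by (simp only: zero_le_mult_iff) linarith
    then show ?thesis by (simp add: a_def)
  qed
  \<comment> \<open>Each \<open>\<psi> n\<close> lies in \<open>V\<close>, so
    \<open>T (\<psi> n)\<close> is its pairing with \<open>G\<close> and at most \<open>C\<close>
    times its norm; in the limit the pairing of \<open>G\<close> with itself appears.\<close>
  have "sqnorm M G \<le> C * sqrt (sqnorm M G)"
  proof -
    have GG: "(\<integral>x. G x * G x \<partial>M) = sqnorm M G" by (simp add: sqnorm_def power2_eq_square)
    have l1: "(\<lambda>n. \<integral>x. G x * \<psi> n x \<partial>M) \<longlonglongrightarrow> sqnorm M G"
      using L2_tendsto_integral_inner[OF \<psi>L G G lim] by (simp add: GG mult.commute)
    have "sqnorm M (\<psi> n) = sqnorm M (\<lambda>x. \<psi> n x - G x) + 2 * (\<integral>x. G x * \<psi> n x \<partial>M) - sqnorm M G" for n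
      using sqnorm_add_cmult[OF \<psi>L G, of n "-1"] by (simp add: mult.commute)
    moreover have "(\<lambda>n. sqnorm M (\<lambda>x. \<psi> n x - G x)) \<longlonglongrightarrow> 0"
    proof -
      have "(\<lambda>n. ennreal (sqnorm M (\<lambda>x. \<psi> n x - G x))) \<longlonglongrightarrow> ennreal 0"
        using lim by (subst (asm) L2_norm_sq_eq) (auto intro: \<psi>L G)
      then show ?thesis by (subst (asm) tendsto_ennreal_iff) auto
    qed
    ultimately have "(\<lambda>n. sqnorm M (\<psi> n)) \<longlonglongrightarrow> 0 + 2 * sqnorm M G - sqnorm M G"
      by (simp only:) (intro tendsto_intros l1)
    then have l2: "(\<lambda>n. C * sqrt (sqnorm M (\<psi> n))) \<longlonglongrightarrow> C * sqrt (sqnorm M G)"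
      by (intro tendsto_intros) simp
    show ?thesis
      by (rule LIMSEQ_le[OF l1 l2]) (metis \<psi>V bound rep abs_le_D1)
  qed
  then have "sqnorm M G \<le> C\<^sup>2"
  proof (cases "sqnorm M G = 0")
    case False
    let ?s = "sqrt (sqnorm M G)"
    have "0 < sqnorm M G" using False sqnorm_nonneg[of M G] by linarith
    then have s: "0 < ?s" by simp
    have "?s * ?s \<le> C * ?s" using \<open>sqnorm M G \<le> C * ?s\<close> by simp
    then have "?s \<le> C" using s by (simp only: mult_le_cancel_right)
    then have "?s\<^sup>2 \<le> C\<^sup>2" using s by (intro power_mono) auto
    then show ?thesis by simp
  qed simp
  with G rep show ?thesis by blast
qed

section \<open>Smooth functions\<close>

lemma frechet_derivative_eqI:
  "(f has_derivative f') (at x) \<Longrightarrow> frechet_derivative f (at x) = f'"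
  by (simp add: frechet_derivative_at[symmetric])

lemma Ck_Suc_has_derivative:
  "Ck (Suc k) f \<Longrightarrow> (f has_derivative frechet_derivative f (at x)) (at x)"
  by (auto simp: differentiable_on_def frechet_derivative_works[symmetric])

lemma Ck_const [simp]: "Ck k (\<lambda>x. c)"
proof (induction k arbitrary: c)
  case (Suc k)
  have "frechet_derivative (\<lambda>x. c) (at x) i = 0" for x i :: 'a
    by (subst frechet_derivative_eqI[OF has_derivative_const]) simp
  then show ?case using Suc by simp
qed simp

lemma Ck_add: "Ck k f \<Longrightarrow> Ck k g \<Longrightarrow> Ck k (\<lambda>x. f x + g x)"
proof (induction k arbitrary: f g)
  case 0
  then show ?case by (simp add: continuous_on_add)
next
  case (Suc k)
  have D: "((\<lambda>x. f x + g x) has_derivative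
      (\<lambda>i. frechet_derivative f (at x) i + frechet_derivative g (at x) i)) (at x)" for x
    using Suc.prems by (intro has_derivative_add Ck_Suc_has_derivative)
  have "(\<lambda>x. f x + g x) differentiable_on UNIV"
    using D by (auto simp: differentiable_on_def differentiable_def)
  moreover have "Ck k (\<lambda>x. frechet_derivative (\<lambda>x. f x + g x) (at x) i)" if "i \<in> Basis" for i
    using Suc that by (subst frechet_derivative_eqI[OF D]) simp
  ultimately show ?case by simp
qed

lemma Ck_cmult: "Ck k f \<Longrightarrow> Ck k (\<lambda>x. c * f x)"
proof (induction k arbitrary: f)
  case 0
  then show ?case by (simp add: continuous_on_mult_left)
next
  case (Suc k)
  have D: "((\<lambda>x. c * f x) has_derivative (\<lambda>i. c * frechet_derivative f (at x) i)) (at x)" for x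
    using Suc.prems by (intro has_derivative_mult_right Ck_Suc_has_derivative)
  have "(\<lambda>x. c * f x) differentiable_on UNIV"
    using D by (auto simp: differentiable_on_def differentiable_def)
  moreover have "Ck k (\<lambda>x. frechet_derivative (\<lambda>x. c * f x) (at x) i)" if "i \<in> Basis" for i
    using Suc that by (subst frechet_derivative_eqI[OF D]) simp
  ultimately show ?case by simp
qed

lemma Ck_translate: "Ck k f \<Longrightarrow> Ck k (\<lambda>x. f (x - a))"
proof (induction k arbitrary: f)
  case 0
  then show ?case by (auto intro!: continuous_intros elim: continuous_on_compose2)
next
  case (Suc k)
  have D: "((\<lambda>x. f (x - a)) has_derivative frechet_derivative f (at (x - a))) (at x)" for x
  proof -
    have "((\<lambda>x. x - a) has_derivative (\<lambda>h. h)) (at x)"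
      by (auto intro!: derivative_eq_intros)
    from has_derivative_compose[OF this Ck_Suc_has_derivative[OF Suc.prems]]
    show ?thesis by simp
  qed
  have "(\<lambda>x. f (x - a)) differentiable_on UNIV"
    using D by (auto simp: differentiable_on_def differentiable_def)
  moreover have "Ck k (\<lambda>x. frechet_derivative (\<lambda>x. f (x - a)) (at x) i)" if "i \<in> Basis" for i
    using Suc.IH[of "\<lambda>x. frechet_derivative f (at x) i"] Suc.prems that
    by (subst frechet_derivative_eqI[OF D]) simp
  ultimately show ?case by simp
qed

lemma smooth_const [simp]: "smooth (\<lambda>x. c)"
  by (simp add: smooth_def)

lemma smooth_add: "smooth f \<Longrightarrow> smooth g \<Longrightarrow> smooth (\<lambda>x. f x + g x)"
  by (simp add: smooth_def Ck_add)

lemma smooth_cmult: "smooth f \<Longrightarrow> smooth (\<lambda>x. c * f x)"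
  by (simp add: smooth_def Ck_cmult)

lemma smooth_translate: "smooth f \<Longrightarrow> smooth (\<lambda>x. f (x - a))"
  by (simp add: smooth_def Ck_translate)

lemma smooth_has_derivative:
  "smooth f \<Longrightarrow> (f has_derivative frechet_derivative f (at x)) (at x)"
  unfolding smooth_def by (rule Ck_Suc_has_derivative) blast

lemma smooth_continuous_on: "smooth f \<Longrightarrow> continuous_on S f"
  using Ck.simps(1)[of f] by (auto simp: smooth_def intro: continuous_on_subset)

lemma frechet_derivative_direction:
  assumes "(f has_derivative f') (at x)"
  shows "f' z = (\<Sum>i\<in>Basis. (z \<bullet> i) * f' i)"
proof -
  interpret linear f' using assms by (rule has_derivative_linear)
  have "f' z = f' (\<Sum>i\<in>Basis. (z \<bullet> i) *\<^sub>R i)" by (simp add: euclidean_representation)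
  then show ?thesis by (simp add: sum scaleR)
qed

text \<open>\<open>Ck\<close> speaks only of derivatives along basis vectors; linearity of the
  derivative carries continuity over to an arbitrary direction.\<close>

lemma smooth_continuous_on_derivative:
  assumes "smooth f"
  shows "continuous_on S (\<lambda>x. frechet_derivative f (at x) z)"
proof -
  have "continuous_on UNIV (\<lambda>x. frechet_derivative f (at x) i)" if "i \<in> Basis" for i
  proof -
    have "Ck (Suc 0) f" using assms unfolding smooth_def by blast
    then show ?thesis using that by simp
  qed
  then have "continuous_on UNIV (\<lambda>x. \<Sum>i\<in>Basis. (z \<bullet> i) * frechet_derivative f (at x) i)"
    by (intro continuous_intros) auto
  then show ?thesis
    using frechet_derivative_direction[OF smooth_has_derivative[OF assms], of _ z]
    by (metis (no_types, lifting) continuous_on_cong continuous_on_subset subset_UNIV)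
qed

lemma smooth_derivative_along:
  assumes "smooth f"
  shows "((\<lambda>s. f (x + s *\<^sub>R z)) has_real_derivative frechet_derivative f (at (x + s *\<^sub>R z)) z) (at s)"
proof -
  have "((\<lambda>s. x + s *\<^sub>R z) has_derivative (\<lambda>t. t *\<^sub>R z)) (at s)"
    by (auto intro!: derivative_eq_intros)
  from has_derivative_compose[OF this smooth_has_derivative[OF assms]]
  have "((\<lambda>s. f (x + s *\<^sub>R z)) has_derivative (\<lambda>t. frechet_derivative f (at (x + s *\<^sub>R z)) (t *\<^sub>R z))) (at s)"
    by simp
  moreover have "(\<lambda>t. frechet_derivative f (at (x + s *\<^sub>R z)) (t *\<^sub>R z))
      = (*) (frechet_derivative f (at (x + s *\<^sub>R z)) z)"
    using linear_cmul[OF has_derivative_linear[OF smooth_has_derivative[OF assms]]] by (auto simp: fun_eq_iff)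
  ultimately show ?thesis by (simp add: has_field_derivative_def)
qed

section \<open>Compactly supported smooth functions\<close>

definition bump :: "nat \<Rightarrow> real \<Rightarrow> real" where
  "bump n t = (if t > 0 then exp (- 1 / t) / t ^ n else 0)"

lemma bump_at_right_0: "(bump n \<longlongrightarrow> 0) (at_right 0)"
proof -
  have "((\<lambda>x::real. x ^ n / exp x) \<longlongrightarrow> 0) at_top" by (rule tendsto_power_div_exp_0)
  then have "((\<lambda>t::real. (inverse t) ^ n / exp (inverse t)) \<longlongrightarrow> 0) (at_right 0)"
    by (rule filterlim_compose[OF _ filterlim_inverse_at_top_right])
  then show ?thesis
    by (rule Lim_transform_eventually)
       (auto simp: eventually_at_right_field bump_def exp_minus field_simps intro!: exI[of _ 1])
qed

text \<open>The powers in the denominator are there for this formula: differentiating exp(-1/t)/t^n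
  only raises the power, so the family is closed under differentiation up to linear
  combinations.\<close>

lemma bump_has_derivative:
  "(bump n has_real_derivative bump (n + 2) t - real n * bump (n + 1) t) (at t)"
proof (cases t "0::real" rule: linorder_cases)
  case less
  have "((\<lambda>t. 0) has_real_derivative 0) (at t)" by simp
  then have "(bump n has_real_derivative 0) (at t)"
    by (rule has_field_derivative_transform_within_open[where S="{..<0}"]) (use less in \<open>auto simp: bump_def\<close>)
  then show ?thesis using less by (simp add: bump_def)
next
  case greater
  have "((\<lambda>t. exp (- 1 / t) / t ^ n) has_real_derivative bump (n + 2) t - real n * bump (n + 1) t) (at t)"
    using greater
  proof -
    have "real n * t ^ (n - 1) = real n * t ^ n / t"
      using greater by (cases n) auto
    then show ?thesis
      using greater by (auto intro!: derivative_eq_intros simp: bump_def power2_eq_square field_simps)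
  qed
  then show ?thesis
    by (rule has_field_derivative_transform_within_open[where S="{0<..}"]) (use greater in \<open>auto simp: bump_def\<close>)
next
  case equal
  \<comment> \<open>To the right of 0 the difference quotient of \<open>bump n\<close> is
    \<open>bump (Suc n)\<close>.\<close>
  have "((\<lambda>y. bump n y / y) \<longlongrightarrow> 0) (at_right 0)"
    using bump_at_right_0[of "Suc n"]
    by (rule Lim_transform_eventually)
       (auto simp: eventually_at_right_field bump_def field_simps intro!: exI[of _ 1])
  moreover have "((\<lambda>y. bump n y / y) \<longlongrightarrow> 0) (at_left 0)"
    by (rule tendsto_eventually) (auto simp: eventually_at_left_field bump_def intro!: exI[of _ "-1"])
  ultimately have "((\<lambda>y. bump n y / y) \<longlongrightarrow> 0) (at 0)"
    by (simp add: filterlim_split_at)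
  then show ?thesis using equal by (simp add: has_field_derivative_iff bump_def)
qed

text \<open>Closed under partial derivatives, hence consisting of smooth functions.\<close>

inductive bump_alg :: "('a::euclidean_space \<Rightarrow> real) \<Rightarrow> bool" where
  const: "bump_alg (\<lambda>x. c)"
| atom: "bump_alg (\<lambda>x. bump n (\<alpha> * (x \<bullet> v) + \<beta>))"
| add: "bump_alg f \<Longrightarrow> bump_alg g \<Longrightarrow> bump_alg (\<lambda>x. f x + g x)"
| mult: "bump_alg f \<Longrightarrow> bump_alg g \<Longrightarrow> bump_alg (\<lambda>x. f x * g x)"

lemma bump_alg_derivative:
  "bump_alg f \<Longrightarrow> \<exists>f'. (\<forall>x. (f has_derivative f' x) (at x)) \<and> (\<forall>i. bump_alg (\<lambda>x. f' x i))"
proof (induction rule: bump_alg.induct)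
  case (const c)
  show ?case by (intro exI[of _ "\<lambda>x i. 0"]) (auto intro: bump_alg.const)
next
  case (atom n \<alpha> v \<beta>)
  let ?t = "\<lambda>x. \<alpha> * (x \<bullet> v) + \<beta>"
  let ?f' = "\<lambda>x i. (bump (n + 2) (?t x) + (- real n) * bump (n + 1) (?t x)) * (\<alpha> * (i \<bullet> v))"
  have "((\<lambda>x. bump n (?t x)) has_derivative ?f' x) (at x)" for x
  proof -
    have "(?t has_derivative (\<lambda>i. \<alpha> * (i \<bullet> v))) (at x)"
      by (auto intro!: derivative_eq_intros)
    from has_derivative_compose[OF this bump_has_derivative[unfolded has_field_derivative_def]]
    show ?thesis by simp
  qed
  moreover have "bump_alg (\<lambda>x. ?f' x i)" for i
    by (intro bump_alg.intros)
  ultimately show ?case by (intro exI[of _ ?f']) auto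
next
  case (add f g)
  then obtain f' g' where "\<forall>x. (f has_derivative f' x) (at x)" "\<forall>i. bump_alg (\<lambda>x. f' x i)"
    "\<forall>x. (g has_derivative g' x) (at x)" "\<forall>i. bump_alg (\<lambda>x. g' x i)" by blast
  then show ?case
    by (intro exI[of _ "\<lambda>x i. f' x i + g' x i"]) (auto intro: bump_alg.add has_derivative_add)
next
  case (mult f g)
  then obtain f' g' where "\<forall>x. (f has_derivative f' x) (at x)" "\<forall>i. bump_alg (\<lambda>x. f' x i)"
    "\<forall>x. (g has_derivative g' x) (at x)" "\<forall>i. bump_alg (\<lambda>x. g' x i)" by blast
  with mult.hyps show ?case
    by (intro exI[of _ "\<lambda>x i. f x * g' x i + f' x i * g x"])
       (auto intro!: bump_alg.add bump_alg.mult has_derivative_mult)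
qed

lemma bump_alg_smooth: 
  assumes "bump_alg f" shows "smooth f"
proof -
  have "Ck k f" for k
    using assms
  proof (induction k arbitrary: f)
    case 0
    then obtain f' where "\<forall>x. (f has_derivative f' x) (at x)" using bump_alg_derivative by blast
    then have "continuous_on UNIV f"
      by (meson continuous_at_imp_continuous_on has_derivative_continuous)
    then show ?case by simp
  next
    case (Suc k)
    then obtain f' where f': "\<And>x. (f has_derivative f' x) (at x)" "\<forall>i. bump_alg (\<lambda>x. f' x i)"
      using bump_alg_derivative by blast
    moreover have "f differentiable_on UNIV"
      using f' by (auto simp: differentiable_on_def differentiable_def)
    ultimately show ?case using Suc.IH by (auto simp: frechet_derivative_eqI[OF f'(1)])
  qed
  then show ?thesis by (simp add: smooth_def)
qed

lemma bump_alg_prod: "finite A \<Longrightarrow> (\<And>i. i \<in> A \<Longrightarrow> bump_alg (f i)) \<Longrightarrow> bump_alg (\<lambda>x. \<Prod>i\<in>A. f i x)"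
  by (induction A rule: finite_induct) (auto intro: bump_alg.intros)

text \<open>In each coordinate exp(-1/s) is evaluated at the distances to both faces, multiplied by
  n + 1: the product vanishes off the open box and tends to 1 inside it as the scale grows. The
  closure of the nonzero set is only contained in the closed box, so use as a test function requires
  the closed box to lie in the domain.\<close>

lemma smooth_approx_box:
  fixes a b :: "'a::euclidean_space"
  shows "\<exists>\<phi>. (\<forall>n. smooth (\<phi> n) \<and> {x. \<phi> n x \<noteq> 0} \<subseteq> box a b \<and> (\<forall>x. 0 \<le> \<phi> n x \<and> \<phi> n x \<le> 1)) \<and>
    (\<forall>x. (\<lambda>n. \<phi> n x) \<longlonglongrightarrow> indicator (box a b) x)"
proof -
  define \<phi> where "\<phi> n x = (\<Prod>i\<in>Basis. bump 0 (real (Suc n) * (x \<bullet> i) + (- real (Suc n) * (a \<bullet> i)))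
      * bump 0 (- real (Suc n) * (x \<bullet> i) + real (Suc n) * (b \<bullet> i)))" for n and x :: 'a
  \<comment> \<open>The definition has the affine shape of the atoms of \<open>bump_alg\<close>;
    this form shows the signs.\<close>
  have eq: "\<phi> n x = (\<Prod>i\<in>Basis. bump 0 (real (Suc n) * (x \<bullet> i - a \<bullet> i)) * bump 0 (real (Suc n) * (b \<bullet> i - x \<bullet> i)))" for n x
    unfolding \<phi>_def by (intro prod.cong arg_cong2[where f="(*)"] arg_cong[where f="bump 0"]) (auto simp: algebra_simps)
  have le: "0 \<le> bump 0 t \<and> bump 0 t \<le> 1" for t by (simp add: bump_def)
  have "smooth (\<phi> n)" for n
    unfolding \<phi>_def by (intro bump_alg_smooth bump_alg_prod bump_alg.intros) auto
  moreover have "x \<in> box a b" if "\<phi> n x \<noteq> 0" for n x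
  proof -
    have "bump 0 (real (Suc n) * (x \<bullet> i - a \<bullet> i)) \<noteq> 0 \<and> bump 0 (real (Suc n) * (b \<bullet> i - x \<bullet> i)) \<noteq> 0"
      if "i \<in> Basis" for i
      using \<open>\<phi> n x \<noteq> 0\<close> that unfolding eq by auto
    then have "0 < real (Suc n) * (x \<bullet> i - a \<bullet> i) \<and> 0 < real (Suc n) * (b \<bullet> i - x \<bullet> i)" if "i \<in> Basis" for i
      using that unfolding bump_def by meson
    then show ?thesis by (simp add: mem_box zero_less_mult_iff)
  qed
  moreover have "0 \<le> \<phi> n x \<and> \<phi> n x \<le> 1" for n x
    unfolding eq using le by (auto intro!: prod_nonneg prod_le_1 mult_le_one)
  moreover have "(\<lambda>n. \<phi> n x) \<longlonglongrightarrow> indicator (box a b) x" for x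
  proof (cases "x \<in> box a b")
    case True
    have one: "(\<lambda>n. bump 0 (real (Suc n) * t)) \<longlonglongrightarrow> 1" if "t > 0" for t
    proof -
      have "(\<lambda>n. - (1 / real (Suc n)) * (1 / t)) \<longlonglongrightarrow> - 0 * (1 / t)"
        by (intro tendsto_intros LIMSEQ_Suc[OF lim_1_over_n])
      then have "(\<lambda>n. exp (- (1 / real (Suc n)) * (1 / t))) \<longlonglongrightarrow> exp (- 0 * (1 / t))"
        by (rule tendsto_exp)
      then show ?thesis using that by (simp add: bump_def)
    qed
    have "(\<lambda>n. \<phi> n x) \<longlonglongrightarrow> (\<Prod>i\<in>(Basis::'a set). 1 * 1)"
      unfolding eq using True by (intro tendsto_prod tendsto_mult one) (auto simp: mem_box)
    then show ?thesis using True by simp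
  next
    case False
    then have "\<phi> n x = 0" for n using \<open>\<And>x n. \<phi> n x \<noteq> 0 \<Longrightarrow> x \<in> box a b\<close> by blast
    then show ?thesis using False by simp
  qed
  ultimately show ?thesis by (intro exI[of _ \<phi>]) auto
qed

section \<open>Operations on test functions and their bounds\<close>

lemma test_functionsD:
  assumes "\<phi> \<in> test_functions \<Omega>"
  shows "smooth \<phi>" "compact (closure {x. \<phi> x \<noteq> 0})" "closure {x. \<phi> x \<noteq> 0} \<subseteq> \<Omega>"
  using assms by (auto simp: test_functions_def)

lemma test_function_outside: "\<phi> \<in> test_functions \<Omega> \<Longrightarrow> x \<notin> \<Omega> \<Longrightarrow> \<phi> x = 0"
  using test_functionsD(3)[of \<phi> \<Omega>] closure_subset[of "{x. \<phi> x \<noteq> 0}"] by auto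

lemma test_functions_zero [simp]: "(\<lambda>x. 0) \<in> test_functions \<Omega>"
  by (simp add: test_functions_def)

text \<open>Any compact superset of the nonzero set will do, which spares computing closures of
  supports.\<close>

lemma test_functions_subset:
  assumes "smooth \<phi>" "{x. \<phi> x \<noteq> 0} \<subseteq> K" "compact K" "K \<subseteq> \<Omega>"
  shows "\<phi> \<in> test_functions \<Omega>"
proof -
  have "closure {x. \<phi> x \<noteq> 0} \<subseteq> K" using assms by (intro closure_minimal compact_imp_closed)
  moreover have "compact (closure {x. \<phi> x \<noteq> 0})"
    using assms by (meson compact_closure bounded_subset compact_imp_bounded)
  ultimately show ?thesis using assms by (auto simp: test_functions_def)
qed

lemma test_functions_add:
  assumes "\<phi> \<in> test_functions \<Omega>" "\<psi> \<in> test_functions \<Omega>"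
  shows "(\<lambda>x. \<phi> x + \<psi> x) \<in> test_functions \<Omega>"
proof (rule test_functions_subset[where K="closure {x. \<phi> x \<noteq> 0} \<union> closure {x. \<psi> x \<noteq> 0}"])
  note t = test_functionsD[OF assms(1)] test_functionsD[OF assms(2)]
  show "smooth (\<lambda>x. \<phi> x + \<psi> x)" by (intro smooth_add t)
  show "{x. \<phi> x + \<psi> x \<noteq> 0} \<subseteq> closure {x. \<phi> x \<noteq> 0} \<union> closure {x. \<psi> x \<noteq> 0}"
  proof safe
    fix x assume *: "\<phi> x + \<psi> x \<noteq> 0" "x \<notin> closure {x. \<psi> x \<noteq> 0}"
    then have "\<psi> x = 0" using closure_subset[of "{x. \<psi> x \<noteq> 0}"] by auto
    then show "x \<in> closure {x. \<phi> x \<noteq> 0}" using * closure_subset[of "{x. \<phi> x \<noteq> 0}"] by auto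
  qed
qed (use test_functionsD[OF assms(1)] test_functionsD[OF assms(2)] in auto)

lemma test_functions_cmult:
  assumes "\<phi> \<in> test_functions \<Omega>"
  shows "(\<lambda>x. c * \<phi> x) \<in> test_functions \<Omega>"
proof (rule test_functions_subset[where K="closure {x. \<phi> x \<noteq> 0}"])
  show "smooth (\<lambda>x. c * \<phi> x)" by (intro smooth_cmult test_functionsD[OF assms])
  show "{x. c * \<phi> x \<noteq> 0} \<subseteq> closure {x. \<phi> x \<noteq> 0}"
    using closure_subset[of "{x. \<phi> x \<noteq> 0}"] by auto
qed (fact test_functionsD[OF assms])+

lemma test_functions_translate:
  assumes "\<phi> \<in> test_functions U" "\<And>x. x \<in> U \<Longrightarrow> x + a \<in> \<Omega>"
  shows "(\<lambda>x. \<phi> (x - a)) \<in> test_functions \<Omega>"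
proof -
  let ?K = "(\<lambda>x. a + x) ` closure {x. \<phi> x \<noteq> 0}"
  note t = test_functionsD[OF assms(1)]
  show ?thesis
  proof (rule test_functions_subset[where K="?K"])
    show "{x. \<phi> (x - a) \<noteq> 0} \<subseteq> ?K"
    proof safe
      fix x assume "\<phi> (x - a) \<noteq> 0"
      then have "x - a \<in> closure {x. \<phi> x \<noteq> 0}" using closure_subset[of "{x. \<phi> x \<noteq> 0}"] by auto
      then show "x \<in> ?K" by (rule rev_image_eqI) simp
    qed
    show "compact ?K" using t by (intro compact_translation)
    show "?K \<subseteq> \<Omega>" using t(3) assms(2) by (auto simp: add.commute)
  qed (use t in \<open>auto intro: smooth_translate\<close>)
qed

lemma continuous_compact_support_bounded:
  fixes f :: "'a::euclidean_space \<Rightarrow> real"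
  assumes "continuous_on UNIV f" "compact K" "\<And>x. x \<notin> K \<Longrightarrow> f x = 0"
  shows "\<exists>B\<ge>0. \<forall>x. \<bar>f x\<bar> \<le> B"
proof -
  have "bounded (f ` K)"
    using assms by (intro compact_imp_bounded compact_continuous_image) (auto intro: continuous_on_subset)
  then obtain B where "\<forall>x\<in>K. \<bar>f x\<bar> \<le> B" by (auto simp: bounded_iff)
  then have "\<bar>f x\<bar> \<le> max B 0" for x using assms(3)[of x] by (cases "x \<in> K") (auto simp: max_def)
  then show ?thesis by (intro exI[of _ "max B 0"]) auto
qed

lemma derivative_zero_outside:
  assumes "smooth \<phi>" "x \<notin> closure {x. \<phi> x \<noteq> 0}"
  shows "frechet_derivative \<phi> (at x) z = 0"
proof -
  have "((\<lambda>x. 0) has_derivative (\<lambda>z. 0)) (at x)" by simp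
  then have "(\<phi> has_derivative (\<lambda>z. 0)) (at x)"
  proof (rule has_derivative_transform_within_open)
    show "open (- closure {x. \<phi> x \<noteq> 0})" by (simp add: open_Compl)
    show "x \<in> - closure {x. \<phi> x \<noteq> 0}" using assms by simp
    show "\<And>x. x \<in> - closure {x. \<phi> x \<noteq> 0} \<Longrightarrow> 0 = \<phi> x"
      using closure_subset[of "{x. \<phi> x \<noteq> 0}"] by auto
  qed
  then show ?thesis by (simp add: frechet_derivative_eqI)
qed

lemma test_function_support:
  assumes "\<phi> \<in> test_functions \<Omega>"
  obtains K where "compact K" "K \<subseteq> \<Omega>" "\<And>x. x \<notin> K \<Longrightarrow> \<phi> x = 0"
    "\<And>x z. x \<notin> K \<Longrightarrow> frechet_derivative \<phi> (at x) z = 0"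
proof
  note t = test_functionsD[OF assms]
  show "compact (closure {x. \<phi> x \<noteq> 0})" "closure {x. \<phi> x \<noteq> 0} \<subseteq> \<Omega>" by (fact t)+
  show "\<phi> x = 0" if "x \<notin> closure {x. \<phi> x \<noteq> 0}" for x
    using that closure_subset[of "{x. \<phi> x \<noteq> 0}"] by auto
  show "frechet_derivative \<phi> (at x) z = 0" if "x \<notin> closure {x. \<phi> x \<noteq> 0}" for x z
    using derivative_zero_outside[OF t(1) that] .
qed

lemma test_function_bounded:
  assumes "\<phi> \<in> test_functions \<Omega>"
  shows "\<exists>B\<ge>0. \<forall>x. \<bar>\<phi> x\<bar> \<le> B"
proof -
  obtain K where "compact K" "\<And>x. x \<notin> K \<Longrightarrow> \<phi> x = 0"
    using test_function_support[OF assms] by metis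
  then show ?thesis
    by (rule continuous_compact_support_bounded[OF smooth_continuous_on[OF test_functionsD(1)[OF assms]]])
qed

lemma test_function_derivative_bounded:
  assumes "\<phi> \<in> test_functions \<Omega>"
  shows "\<exists>B\<ge>0. \<forall>x. \<bar>frechet_derivative \<phi> (at x) z\<bar> \<le> B"
proof -
  obtain K where "compact K" "\<And>x. x \<notin> K \<Longrightarrow> frechet_derivative \<phi> (at x) z = 0"
    using test_function_support[OF assms] by metis
  then show ?thesis
    by (rule continuous_compact_support_bounded[OF smooth_continuous_on_derivative[OF test_functionsD(1)[OF assms]]])
qed

lemma smooth_borel: "smooth f \<Longrightarrow> f \<in> borel_measurable borel"
  by (intro borel_measurable_continuous_onI smooth_continuous_on)

lemma smooth_derivative_borel: "smooth f \<Longrightarrow> (\<lambda>x. frechet_derivative f (at x) z) \<in> borel_measurable borel"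
  by (intro borel_measurable_continuous_onI smooth_continuous_on_derivative)

lemma borel_measurable_lebesgue_on:
  "f \<in> borel_measurable borel \<Longrightarrow> f \<in> borel_measurable (lebesgue_on \<Omega>)"
  by (intro measurable_restrict_space1 measurable_completion) simp

lemma continuous_compact_support_L2:
  fixes f :: "'a::euclidean_space \<Rightarrow> real"
  assumes "continuous_on UNIV f" "compact K" "\<And>x. x \<notin> K \<Longrightarrow> f x = 0" "\<Omega> \<in> sets lebesgue"
  shows "f \<in> L2 (lebesgue_on \<Omega>)"
proof -
  obtain B where B: "B \<ge> 0" "\<And>x. \<bar>f x\<bar> \<le> B"
    using continuous_compact_support_bounded[OF assms(1-3)] by auto
  have "L2_norm_sq (lebesgue_on \<Omega>) f = (\<integral>\<^sup>+x\<in>\<Omega>. ennreal ((norm (f x))\<^sup>2) \<partial>lebesgue)"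
    unfolding L2_norm_sq_def using assms by (subst nn_integral_restrict_space) auto
  also have "\<dots> \<le> (\<integral>\<^sup>+x. ennreal (B\<^sup>2) * indicator K x \<partial>lebesgue)"
  proof (intro nn_integral_mono)
    fix x
    have "(f x)\<^sup>2 \<le> B\<^sup>2" using B power_mono[of "\<bar>f x\<bar>" B 2] by simp
    then show "ennreal ((norm (f x))\<^sup>2) * indicator \<Omega> x \<le> ennreal (B\<^sup>2) * indicator K x"
      using assms(3)[of x] by (auto simp: indicator_def intro!: ennreal_leI)
  qed
  also have "\<dots> = ennreal (B\<^sup>2) * emeasure lebesgue K"
    using assms by (subst nn_integral_cmult_indicator) (auto simp: compact_imp_closed)
  also have "\<dots> < \<infinity>"
    using emeasure_bounded_finite[OF compact_imp_bounded[OF assms(2)]] assms(2)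
    by (simp add: ennreal_mult_less_top compact_imp_closed)
  finally show ?thesis
    using assms(1) by (simp add: L2_def borel_measurable_lebesgue_on borel_measurable_continuous_onI)
qed

lemma test_function_L2:
  assumes "\<phi> \<in> test_functions U" "\<Omega> \<in> sets lebesgue"
  shows "\<phi> \<in> L2 (lebesgue_on \<Omega>)"
proof -
  obtain K where "compact K" "\<And>x. x \<notin> K \<Longrightarrow> \<phi> x = 0"
    using test_function_support[OF assms(1)] by metis
  then show ?thesis using assms(2)
    by (rule continuous_compact_support_L2[OF smooth_continuous_on[OF test_functionsD(1)[OF assms(1)]]])
qed

lemma test_function_derivative_L2:
  assumes "\<phi> \<in> test_functions U" "\<Omega> \<in> sets lebesgue"
  shows "(\<lambda>x. frechet_derivative \<phi> (at x) z) \<in> L2 (lebesgue_on \<Omega>)"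
proof -
  obtain K where "compact K" "\<And>x. x \<notin> K \<Longrightarrow> frechet_derivative \<phi> (at x) z = 0"
    using test_function_support[OF assms(1)] by metis
  then show ?thesis using assms(2)
    by (rule continuous_compact_support_L2[OF smooth_continuous_on_derivative[OF test_functionsD(1)[OF assms(1)]]])
qed

section \<open>Weak gradients\<close>

text \<open>A bridge between two settings: the definitions use completed Lebesgue measure on the
  domain, while translation and Fubini take place for \<open>lborel\<close> on the whole
  space.\<close>

lemma integral_lebesgue_on_lborel:
  fixes G :: "'a::euclidean_space \<Rightarrow> real"
  assumes "\<Omega> \<in> sets lebesgue" "G \<in> borel_measurable borel" "\<And>x. x \<notin> \<Omega> \<Longrightarrow> G x = 0"
  shows "(\<integral>x. G x \<partial>lebesgue_on \<Omega>) = (\<integral>x. G x \<partial>lborel)"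
proof -
  have "(\<integral>x. G x \<partial>lebesgue_on \<Omega>) = (\<integral>x. indicator \<Omega> x *\<^sub>R G x \<partial>lebesgue)"
    using assms(1) by (subst integral_restrict_space) auto
  also have "\<dots> = (\<integral>x. G x \<partial>lebesgue)"
    using assms(3) by (intro Bochner_Integration.integral_cong) (auto simp: indicator_def)
  also have "\<dots> = (\<integral>x. G x \<partial>lborel)"
    using assms(2) by (intro integral_completion) simp
  finally show ?thesis .
qed

lemma L2_norm_sq_lebesgue_on:
  assumes "\<Omega> \<in> sets lebesgue"
  shows "L2_norm_sq (lebesgue_on \<Omega>) f = (\<integral>\<^sup>+x\<in>\<Omega>. ennreal ((norm (f x))\<^sup>2) \<partial>lborel)"
  unfolding L2_norm_sq_def using assms
  by (subst nn_integral_restrict_space) (auto simp: nn_integral_completion)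

lemma L2_norm_sq_lebesgue_on_lborel:
  fixes f :: "'a::euclidean_space \<Rightarrow> 'b::real_normed_vector"
  assumes "\<Omega> \<in> sets lebesgue" "\<And>x. x \<notin> \<Omega> \<Longrightarrow> f x = 0"
  shows "L2_norm_sq (lebesgue_on \<Omega>) f = (\<integral>\<^sup>+x. ennreal ((norm (f x))\<^sup>2) \<partial>lborel)"
  unfolding L2_norm_sq_lebesgue_on[OF assms(1)]
  using assms(2) by (intro nn_integral_cong) (auto simp: indicator_def)

lemma nn_integral_lborel_translate:
  fixes f :: "'a::euclidean_space \<Rightarrow> ennreal"
  assumes [measurable]: "f \<in> borel_measurable borel"
  shows "(\<integral>\<^sup>+x. f (x + a) \<partial>lborel) = (\<integral>\<^sup>+x. f x \<partial>lborel)"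
proof -
  have "(\<integral>\<^sup>+x. f x \<partial>lborel) = (\<integral>\<^sup>+x. f x \<partial>distr lborel borel ((+) a))"
    by (simp only: lborel_distr_plus)
  also have "\<dots> = (\<integral>\<^sup>+x. f (a + x) \<partial>lborel)"
    by (subst nn_integral_distr) auto
  finally show ?thesis by (simp add: add.commute)
qed

lemma integral_lborel_translate:
  fixes f :: "'a::euclidean_space \<Rightarrow> real"
  assumes [measurable]: "f \<in> borel_measurable borel"
  shows "(\<integral>x. f (x + a) \<partial>lborel) = (\<integral>x. f x \<partial>lborel)"
proof -
  have "(\<integral>x. f x \<partial>lborel) = (\<integral>x. f x \<partial>distr lborel borel ((+) a))"
    by (simp only: lborel_distr_plus)
  also have "\<dots> = (\<integral>x. f (a + x) \<partial>lborel)"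
    by (subst integral_distr) auto
  finally show ?thesis by (simp add: add.commute)
qed

lemma integrable_lborel_translate:
  fixes f :: "'a::euclidean_space \<Rightarrow> real"
  assumes "integrable lborel f"
  shows "integrable lborel (\<lambda>x. f (x + a))"
proof -
  have [measurable]: "f \<in> borel_measurable borel" using borel_measurable_integrable[OF assms] by simp
  have "integrable (distr lborel borel ((+) a)) f"
    using assms by (simp only: lborel_distr_plus)
  then have "integrable lborel (\<lambda>x. f (a + x))"
    by (subst (asm) integrable_distr_eq) auto
  then show ?thesis by (simp add: add.commute)
qed

lemma bounded_continuous_L2:
  fixes f :: "'a::euclidean_space \<Rightarrow> real"
  assumes "continuous_on UNIV f" "bounded \<Omega>" "\<Omega> \<in> sets lebesgue"
  shows "f \<in> L2 (lebesgue_on \<Omega>)"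
proof -
  have "compact (f ` closure \<Omega>)"
    using assms by (intro compact_continuous_image) (auto intro: continuous_on_subset)
  then obtain B where "\<forall>x\<in>closure \<Omega>. \<bar>f x\<bar> \<le> B"
    by (auto simp: bounded_iff dest!: compact_imp_bounded)
  then have B: "\<And>x. x \<in> closure \<Omega> \<Longrightarrow> \<bar>f x\<bar> \<le> B" by blast
  have "L2_norm_sq (lebesgue_on \<Omega>) f \<le> (\<integral>\<^sup>+x. ennreal (B\<^sup>2) \<partial>lebesgue_on \<Omega>)"
    unfolding L2_norm_sq_def
  proof (intro nn_integral_mono ennreal_leI)
    fix x assume "x \<in> space (lebesgue_on \<Omega>)"
    then have "\<bar>f x\<bar> \<le> B" using B closure_subset[of \<Omega>] by auto
    then show "(norm (f x))\<^sup>2 \<le> B\<^sup>2" by (intro power_mono) auto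
  qed
  also have "\<dots> = ennreal (B\<^sup>2) * emeasure lebesgue \<Omega>"
    using assms by (simp add: emeasure_restrict_space)
  also have "\<dots> < \<infinity>"
    using fmeasurableD2[OF bounded_set_imp_lmeasurable[OF assms(2,3)]]
    by (simp only: ennreal_mult_less_top top.not_eq_extremum infinity_ennreal_def) simp
  finally show ?thesis
    using assms(1) by (simp add: L2_def borel_measurable_lebesgue_on borel_measurable_continuous_onI)
qed

lemma L2_integrable_bounded:
  fixes f :: "'a::euclidean_space \<Rightarrow> real"
  assumes "f \<in> L2 (lebesgue_on \<Omega>)" "bounded \<Omega>" "\<Omega> \<in> sets lebesgue"
  shows "integrable (lebesgue_on \<Omega>) f"
  using L2_integrable_mult[OF assms(1) bounded_continuous_L2[of "\<lambda>_. 1"]] assms(2,3) by simp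

text \<open>Extension by zero gives a meaning to translates that leave the domain, and Borel
  measurability makes w(x + z) jointly measurable in x and z, as Fubini requires.\<close>

lemma ex_borel_representative:
  fixes w :: "'a::euclidean_space \<Rightarrow> real"
  assumes "w \<in> borel_measurable (lebesgue_on \<Omega>)" "open \<Omega>"
  shows "\<exists>w0\<in>borel_measurable borel. (\<forall>x. x \<notin> \<Omega> \<longrightarrow> w0 x = 0) \<and> (AE x in lebesgue_on \<Omega>. w x = w0 x)"
proof -
  have "(\<lambda>x. indicator \<Omega> x *\<^sub>R w x) \<in> borel_measurable lebesgue"
    using assms by (subst (asm) borel_measurable_restrict_space_iff) auto
  then obtain w1 where w1: "w1 \<in> borel_measurable lborel"
    and ae: "AE x in lborel. indicator \<Omega> x *\<^sub>R w x = w1 x"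
    using completion_ex_borel_measurable_real by blast
  have [measurable]: "w1 \<in> borel_measurable borel" "\<Omega> \<in> sets borel" using w1 assms by auto
  have "AE x in lebesgue. indicator \<Omega> x *\<^sub>R w x = w1 x" using ae by (rule AE_completion)
  then have "AE x in lebesgue_on \<Omega>. w x = indicator \<Omega> x * w1 x"
    using assms(2) by (subst AE_restrict_space_iff) (auto elim!: eventually_mono)
  then show ?thesis by (intro bexI[of _ "\<lambda>x. indicator \<Omega> x * w1 x"]) auto
qed

section \<open>The fundamental lemma of the calculus of variations\<close>

text \<open>Dynkin's argument: open boxes are stable under intersection and generate the Borel sets.
  The integral over the whole space is needed in the complement step.\<close>

lemma integrable_eq_0_of_boxes:
  fixes h :: "'a::euclidean_space \<Rightarrow> real"
  assumes h: "integrable lborel h" and box: "\<And>c d. (\<integral>x. indicator (box c d) x * h x \<partial>lborel) = 0"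
    and whole: "(\<integral>x. h x \<partial>lborel) = 0"
  shows "AE x in lborel. h x = 0"
proof -
  let ?G = "range (\<lambda>(a, b). box a b :: 'a set)"
  have sets: "sets borel = sigma_sets UNIV ?G" by (simp add: borel_eq_box)
  have "(\<integral>x. indicator A x * h x \<partial>lborel) = 0" if "A \<in> sets borel" for A
  proof -
    have "Int_stable ?G" by (auto simp: Int_stable_def box_Int_box)
    moreover have "?G \<subseteq> Pow UNIV" by simp
    moreover have "A \<in> sigma_sets UNIV ?G" using that sets by simp
    ultimately show ?thesis
    proof (induction rule: sigma_sets_induct_disjoint[consumes 3])
      case (basic A)
      then show ?case using box by auto
    next
      case empty
      show ?case by simp
    next
      case (compl A)
      then have [measurable]: "A \<in> sets borel" using sets by simp
      have "(\<integral>x. indicator (UNIV - A) x * h x \<partial>lborel) = (\<integral>x. h x - indicator A x * h x \<partial>lborel)"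
        by (intro Bochner_Integration.integral_cong) (auto simp: indicator_def)
      also have "\<dots> = 0"
        using compl whole h by (subst Bochner_Integration.integral_diff) (auto intro: integrable_real_mult_indicator simp: mult.commute)
      finally show ?case .
    next
      case (union A)
      then have Am: "A i \<in> sets lborel" for i using sets by auto
      have "(LINT x:(\<Union>i. A i)|lborel. h x) = (\<Sum>i. LINT x:A i|lborel. h x)"
      proof (rule lebesgue_integral_countable_add)
        show "set_integrable lborel (\<Union>i. A i) h"
          unfolding set_integrable_def using Am h by (intro integrable_mult_indicator) auto
        show "A i \<inter> A j = {}" if "i \<noteq> j" for i j
          using union(1) that by (auto simp: disjoint_family_on_def)
      qed (fact Am)
      then show ?case using union(3) by (simp add: set_lebesgue_integral_def)
    qed
  qed
  then show ?thesis
    by (intro sigma_finite_measure.density_zero[OF sigma_finite_lborel h]) (simp add: set_lebesgue_integral_def)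
qed

text \<open>Testing with smooth approximations of the indicator of a box shows that \<open>f\<close>
  integrates to 0 over every box whose closure lies in \<open>U\<close>; dominated convergence
  applies because an L2 function is integrable on the closed box. Inside one such box Dynkin's
  argument gives \<open>f = 0\<close>, and countably many of them cover \<open>U\<close>.\<close>

lemma fundamental_lemma:
  fixes f :: "'a::euclidean_space \<Rightarrow> real"
  assumes U: "open U" and f: "f \<in> L2 (lebesgue_on U)"
    and zero: "\<And>\<phi>. \<phi> \<in> test_functions U \<Longrightarrow> (\<integral>x. f x * \<phi> x \<partial>lebesgue_on U) = 0"
  shows "AE x in lebesgue_on U. f x = 0"
proof -
  have Um: "U \<in> sets lebesgue" using U by simp
  obtain f0 where f0m [measurable]: "f0 \<in> borel_measurable borel" and f0U: "\<And>x. x \<notin> U \<Longrightarrow> f0 x = 0"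
    and f0: "AE x in lebesgue_on U. f x = f0 x"
    using ex_borel_representative[of f U] f U by (auto simp: L2_def)
  have f0L: "f0 \<in> L2 (lebesgue_on U)"
    using f L2_norm_sq_cong_AE[OF f0] by (simp add: L2_def borel_measurable_lebesgue_on)
  have zero0: "(\<integral>x. f0 x * \<phi> x \<partial>lebesgue_on U) = 0" if "\<phi> \<in> test_functions U" for \<phi>
  proof -
    have "(\<integral>x. f0 x * \<phi> x \<partial>lebesgue_on U) = (\<integral>x. f x * \<phi> x \<partial>lebesgue_on U)"
      using f f0 test_function_L2[OF that Um]
      by (intro integral_cong_AE borel_measurable_times borel_measurable_lebesgue_on f0m L2_measurable)
         (auto elim!: eventually_mono simp: L2_def)
    then show ?thesis using zero[OF that] by simp
  qed
  have box_int: "integrable lborel (\<lambda>x. indicator (cbox a b) x * f0 x)" if "cbox a b \<subseteq> U" for a b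
  proof -
    have "integrable (lebesgue_on (cbox a b)) f0"
    proof (rule L2_integrable_bounded)
      show "f0 \<in> L2 (lebesgue_on (cbox a b))"
      proof -
        have "L2_norm_sq (lebesgue_on (cbox a b)) f0 \<le> L2_norm_sq (lebesgue_on U) f0"
          unfolding L2_norm_sq_lebesgue_on[OF Um] using that
          by (subst L2_norm_sq_lebesgue_on) (auto intro!: nn_integral_mono simp: indicator_def)
        then show ?thesis using f0L by (auto simp: L2_def borel_measurable_lebesgue_on intro: le_less_trans)
      qed
    qed auto
    then have "integrable lebesgue (\<lambda>x. indicator (cbox a b) x *\<^sub>R f0 x)"
      by (subst (asm) integrable_restrict_space) auto
    then show ?thesis by (subst (asm) integrable_completion) auto
  qed
  have box0: "(\<integral>x. indicator (box a b) x * f0 x \<partial>lborel) = 0" if "cbox a b \<subseteq> U" for a b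
  proof -
    obtain \<phi> where sm: "\<And>n. smooth (\<phi> n)" and supp: "\<And>n. {x. \<phi> n x \<noteq> 0} \<subseteq> box a b"
      and le: "\<And>n x. 0 \<le> \<phi> n x \<and> \<phi> n x \<le> 1"
      and lim: "\<And>x. (\<lambda>n. \<phi> n x) \<longlonglongrightarrow> indicator (box a b) x"
      using smooth_approx_box[of a b] by metis
    have \<phi>m [measurable]: "\<phi> n \<in> borel_measurable borel" for n using sm by (rule smooth_borel)
    have test: "\<phi> n \<in> test_functions U" for n
      using supp[of n] box_subset_cbox[of a b] that
      by (intro test_functions_subset[OF sm, where K="cbox a b"]) auto
    have "(\<integral>x. \<phi> n x * f0 x \<partial>lborel) = 0" for n
      using zero0[OF test, of n] integral_lebesgue_on_lborel[OF Um, of "\<lambda>x. f0 x * \<phi> n x"] f0U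
      by (simp add: mult.commute)
    moreover have "(\<lambda>n. \<integral>x. \<phi> n x * f0 x \<partial>lborel) \<longlonglongrightarrow> (\<integral>x. indicator (box a b) x * f0 x \<partial>lborel)"
    proof (rule integral_dominated_convergence)
      show "integrable lborel (\<lambda>x. norm (indicator (cbox a b) x * f0 x))"
        by (intro integrable_norm box_int that)
      show "AE x in lborel. (\<lambda>n. \<phi> n x * f0 x) \<longlonglongrightarrow> indicator (box a b) x * f0 x"
        by (intro AE_I2 tendsto_intros lim)
      show "AE x in lborel. norm (\<phi> n x * f0 x) \<le> norm (indicator (cbox a b) x * f0 x)" for n
      proof (intro AE_I2)
        fix x
        show "norm (\<phi> n x * f0 x) \<le> norm (indicator (cbox a b) x * f0 x)"
        proof (cases "\<phi> n x = 0")
          case False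
          then have "x \<in> cbox a b" using supp box_subset_cbox by blast
          then show ?thesis using le[of n x] by (simp add: abs_mult mult_left_le_one_le)
        qed simp
      qed
    qed auto
    ultimately show ?thesis by (simp add: LIMSEQ_const_iff)
  qed
  have ae_box: "AE x in lborel. x \<in> cbox a b \<longrightarrow> f0 x = 0" if cb: "cbox a b \<subseteq> U" for a b
  proof -
    let ?h = "\<lambda>x. indicator (box a b) x * f0 x"
    have eq: "indicator (box a b) x * f0 x = indicator (box a b) x * (indicator (cbox a b) x * f0 x)" for x
      using box_subset_cbox[of a b] by (auto simp: indicator_def)
    have "AE x in lborel. ?h x = 0"
    proof (rule integrable_eq_0_of_boxes)
      show "integrable lborel ?h"
        unfolding eq using integrable_mult_indicator[OF _ box_int[OF cb], of "box a b"] by simp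
      show "(\<integral>x. ?h x \<partial>lborel) = 0" by (rule box0[OF cb])
      show "(\<integral>x. indicator (box c d) x * ?h x \<partial>lborel) = 0" for c d
      proof -
        obtain p q where pq: "box a b \<inter> box c d = box p q" by (auto simp: box_Int_box)
        have eq2: "indicator (box c d) x * ?h x = indicator (box p q) x * f0 x" for x
          unfolding pq[symmetric] by (auto simp: indicator_def)
        show ?thesis
        \<comment> \<open>The closed box is the closure of the open box only if the latter is
          nonempty.\<close>
        proof (cases "box p q = {}")
          case False
          have "cbox p q = closure (box p q)" using False by simp
          also have "\<dots> \<subseteq> closure (box a b)" unfolding pq[symmetric] by (intro closure_mono) auto
          also have "\<dots> \<subseteq> cbox a b" by (intro closure_minimal box_subset_cbox) auto
          finally show ?thesis unfolding eq2 using cb by (intro box0) auto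
        qed (simp add: eq2)
      qed
    qed
    \<comment> \<open>The faces are null, so the conclusion passes to closed boxes, of which the
      countable cover below consists.\<close>
    moreover have "AE x in lborel. x \<notin> cbox a b - box a b"
    proof -
      have "negligible (cbox a b - box a b)" by (rule negligible_frontier_interval)
      then have "cbox a b - box a b \<in> null_sets lborel"
        by (simp add: negligible_iff_null_sets null_sets_completion_iff)
      then show ?thesis by (rule AE_not_in)
    qed
    ultimately show ?thesis by eventually_elim auto
  qed
  obtain D where D: "countable D" "D \<subseteq> Pow U" "\<And>X. X \<in> D \<Longrightarrow> \<exists>a b. X = cbox a b" "\<Union>D = U"
    by (rule open_countable_Union_open_cbox[OF U]) (rule that)
  have "AE x in lborel. x \<in> X \<longrightarrow> f0 x = 0" if "X \<in> D" for X
    using D(2) D(3)[OF that] that ae_box by auto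
  then have "AE x in lborel. \<forall>X\<in>D. x \<in> X \<longrightarrow> f0 x = 0"
    by (subst AE_ball_countable[OF D(1)]) blast
  then have "AE x in lborel. x \<in> U \<longrightarrow> f0 x = 0" by eventually_elim (use D(4) in blast)
  then have "AE x in lebesgue_on U. f0 x = 0"
    using Um by (subst AE_restrict_space_iff) (auto intro: AE_completion)
  with f0 show ?thesis by eventually_elim simp
qed

section \<open>Algebra, uniqueness and limits of weak gradients\<close>

text \<open>\<open>weak_gradient\<close> is a choice by \<open>SOME\<close>, so identities for it
  hold only almost everywhere. Sums, multiples and limits are therefore treated for a function
  together with one of its weak gradients.\<close>

definition H1_pair :: "'a::euclidean_space set \<Rightarrow> ('a \<Rightarrow> real) \<Rightarrow> ('a \<Rightarrow> 'a) \<Rightarrow> bool" where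
  "H1_pair \<Omega> u g \<longleftrightarrow> u \<in> L2 (lebesgue_on \<Omega>) \<and> g \<in> L2 (lebesgue_on \<Omega>) \<and> has_weak_gradient \<Omega> u g"

lemma H1_iff: "u \<in> H1 \<Omega> \<longleftrightarrow> (\<exists>g. H1_pair \<Omega> u g)"
  by (auto simp: H1_def H1_pair_def)

lemma H1_pair_weak_gradient:
  assumes "u \<in> H1 \<Omega>"
  shows "H1_pair \<Omega> u (weak_gradient \<Omega> u)"
proof -
  have "\<exists>g. g \<in> L2 (lebesgue_on \<Omega>) \<and> has_weak_gradient \<Omega> u g"
    using assms by (auto simp: H1_def)
  from someI_ex[OF this] assms show ?thesis
    unfolding weak_gradient_def H1_pair_def H1_def by simp
qed

lemma L2_inner_component:
  fixes g :: "'b \<Rightarrow> 'a::euclidean_space"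
  assumes "g \<in> L2 M"
  shows "(\<lambda>x. g x \<bullet> z) \<in> L2 M"
proof (rule L2_dominated)
  have [measurable]: "g \<in> borel_measurable M" using assms by (simp add: L2_def)
  show "(\<lambda>x. g x \<bullet> z) \<in> borel_measurable M" by measurable
  show "(\<lambda>x. norm z *\<^sub>R g x) \<in> L2 M" using assms by auto
  show "AE x in M. norm (g x \<bullet> z) \<le> norm (norm z *\<^sub>R g x)"
  proof (intro AE_I2)
    fix x
    show "norm (g x \<bullet> z) \<le> norm (norm z *\<^sub>R g x)"
      using Cauchy_Schwarz_ineq2[of "g x" z] by (simp add: mult.commute)
  qed
qed

text \<open>In each component the difference of the gradients annihilates every test function. This
  permits replacing \<open>weak_gradient\<close> by any other weak gradient under an
  integral.\<close>

lemma H1_pair_unique: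
  assumes \<Omega>: "open \<Omega>" and g: "H1_pair \<Omega> u g" "H1_pair \<Omega> u' g'"
    and eq: "AE x in lebesgue_on \<Omega>. u x = u' x"
  shows "AE x in lebesgue_on \<Omega>. g x = g' x"
proof -
  have \<Omega>m: "\<Omega> \<in> sets lebesgue" using \<Omega> by simp
  have L: "g \<in> L2 (lebesgue_on \<Omega>)" "g' \<in> L2 (lebesgue_on \<Omega>)" "u \<in> L2 (lebesgue_on \<Omega>)" "u' \<in> L2 (lebesgue_on \<Omega>)"
    using g by (auto simp: H1_pair_def)
  have "AE x in lebesgue_on \<Omega>. g x \<bullet> i - g' x \<bullet> i = 0" if i: "i \<in> Basis" for i
  proof (rule fundamental_lemma[OF \<Omega>])
    show "(\<lambda>x. g x \<bullet> i - g' x \<bullet> i) \<in> L2 (lebesgue_on \<Omega>)"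
      by (intro L2_diff L2_inner_component L)
    fix \<phi> assume \<phi>: "\<phi> \<in> test_functions \<Omega>"
    note \<phi>L = test_function_L2[OF \<phi> \<Omega>m] and D\<phi>L = test_function_derivative_L2[OF \<phi> \<Omega>m]
    have "(\<integral>x. (g x \<bullet> i - g' x \<bullet> i) * \<phi> x \<partial>lebesgue_on \<Omega>)
       = (\<integral>x. (g x \<bullet> i) * \<phi> x \<partial>lebesgue_on \<Omega>) - (\<integral>x. (g' x \<bullet> i) * \<phi> x \<partial>lebesgue_on \<Omega>)"
      unfolding left_diff_distrib
      by (intro Bochner_Integration.integral_diff L2_integrable_mult L2_inner_component L \<phi>L)
    also have "\<dots> = - (\<integral>x. u x * frechet_derivative \<phi> (at x) i \<partial>lebesgue_on \<Omega>)
        + (\<integral>x. u' x * frechet_derivative \<phi> (at x) i \<partial>lebesgue_on \<Omega>)"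
      using g \<phi> i by (simp add: H1_pair_def has_weak_gradient_def)
    also have "(\<integral>x. u x * frechet_derivative \<phi> (at x) i \<partial>lebesgue_on \<Omega>)
       = (\<integral>x. u' x * frechet_derivative \<phi> (at x) i \<partial>lebesgue_on \<Omega>)"
      by (intro integral_cong_AE borel_measurable_times L2_measurable L D\<phi>L)
         (use eq in \<open>auto elim: eventually_mono\<close>)
    finally show "(\<integral>x. (g x \<bullet> i - g' x \<bullet> i) * \<phi> x \<partial>lebesgue_on \<Omega>) = 0" by simp
  qed
  then have "AE x in lebesgue_on \<Omega>. \<forall>i\<in>Basis. g x \<bullet> i - g' x \<bullet> i = 0"
    by (intro AE_finite_allI) auto
  then show ?thesis by eventually_elim (auto intro: euclidean_eqI)
qed

lemma H1_pair_add:
  assumes \<Omega>: "\<Omega> \<in> sets lebesgue" and "H1_pair \<Omega> u g" "H1_pair \<Omega> u' g'"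
  shows "H1_pair \<Omega> (\<lambda>x. u x + u' x) (\<lambda>x. g x + g' x)"
proof -
  have L: "g \<in> L2 (lebesgue_on \<Omega>)" "g' \<in> L2 (lebesgue_on \<Omega>)" "u \<in> L2 (lebesgue_on \<Omega>)" "u' \<in> L2 (lebesgue_on \<Omega>)"
    using assms by (auto simp: H1_pair_def)
  have "has_weak_gradient \<Omega> (\<lambda>x. u x + u' x) (\<lambda>x. g x + g' x)"
    unfolding has_weak_gradient_def
  proof (intro ballI)
    fix \<phi> and i :: 'a assume \<phi>: "\<phi> \<in> test_functions \<Omega>" and i: "i \<in> Basis"
    note \<phi>L = test_function_L2[OF \<phi> \<Omega>] and D\<phi>L = test_function_derivative_L2[OF \<phi> \<Omega>]
    have "(\<integral>x. (u x + u' x) * frechet_derivative \<phi> (at x) i \<partial>lebesgue_on \<Omega>)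
      = (\<integral>x. u x * frechet_derivative \<phi> (at x) i \<partial>lebesgue_on \<Omega>) + (\<integral>x. u' x * frechet_derivative \<phi> (at x) i \<partial>lebesgue_on \<Omega>)"
      unfolding distrib_right by (intro Bochner_Integration.integral_add L2_integrable_mult L D\<phi>L)
    also have "\<dots> = - ((\<integral>x. (g x \<bullet> i) * \<phi> x \<partial>lebesgue_on \<Omega>) + (\<integral>x. (g' x \<bullet> i) * \<phi> x \<partial>lebesgue_on \<Omega>))"
      using assms \<phi> i by (simp add: H1_pair_def has_weak_gradient_def)
    also have "(\<integral>x. (g x \<bullet> i) * \<phi> x \<partial>lebesgue_on \<Omega>) + (\<integral>x. (g' x \<bullet> i) * \<phi> x \<partial>lebesgue_on \<Omega>)
       = (\<integral>x. ((g x + g' x) \<bullet> i) * \<phi> x \<partial>lebesgue_on \<Omega>)"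
      unfolding inner_add_left distrib_right
      by (intro Bochner_Integration.integral_add[symmetric] L2_integrable_mult L2_inner_component L \<phi>L)
    finally show "(\<integral>x. (u x + u' x) * frechet_derivative \<phi> (at x) i \<partial>lebesgue_on \<Omega>)
        = - (\<integral>x. ((g x + g' x) \<bullet> i) * \<phi> x \<partial>lebesgue_on \<Omega>)" .
  qed
  then show ?thesis using L by (auto simp: H1_pair_def)
qed

lemma H1_pair_cmult:
  assumes "H1_pair \<Omega> u g"
  shows "H1_pair \<Omega> (\<lambda>x. c * u x) (\<lambda>x. c *\<^sub>R g x)"
  using assms by (auto simp: H1_pair_def has_weak_gradient_def mult.assoc)

lemma H1_pair_diff:
  assumes "\<Omega> \<in> sets lebesgue" "H1_pair \<Omega> u g" "H1_pair \<Omega> u' g'"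
  shows "H1_pair \<Omega> (\<lambda>x. u x - u' x) (\<lambda>x. g x - g' x)"
  using H1_pair_add[OF assms(1,2) H1_pair_cmult[OF assms(3), of "-1"]] by simp

lemma H1_pair_zero: "H1_pair \<Omega> (\<lambda>x. 0) (\<lambda>x. 0)"
  by (simp add: H1_pair_def has_weak_gradient_def)

lemma H1_pair_cong_AE:
  assumes "H1_pair \<Omega> u g" "AE x in lebesgue_on \<Omega>. u x = u' x" "u' \<in> borel_measurable (lebesgue_on \<Omega>)"
    and \<Omega>: "\<Omega> \<in> sets lebesgue"
  shows "H1_pair \<Omega> u' g"
proof -
  have L: "u \<in> L2 (lebesgue_on \<Omega>)" "u' \<in> L2 (lebesgue_on \<Omega>)"
    using assms L2_norm_sq_cong_AE[OF assms(2)] by (auto simp: H1_pair_def L2_def)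
  have "(\<integral>x. u' x * frechet_derivative \<phi> (at x) i \<partial>lebesgue_on \<Omega>)
      = (\<integral>x. u x * frechet_derivative \<phi> (at x) i \<partial>lebesgue_on \<Omega>)" if "\<phi> \<in> test_functions \<Omega>" for \<phi> i
    by (intro integral_cong_AE borel_measurable_times L2_measurable L test_function_derivative_L2[OF that \<Omega>])
       (use assms(2) in \<open>auto elim: eventually_mono\<close>)
  then show ?thesis using assms(1) L by (auto simp: H1_pair_def has_weak_gradient_def)
qed

text \<open>For a fixed test function both sides of the defining identity are pairings with an L2
  function, hence continuous under strong convergence.\<close>

lemma H1_pair_limit:
  assumes \<Omega>: "\<Omega> \<in> sets lebesgue" and p: "\<And>n. H1_pair \<Omega> (u n) (g n)"
    and L: "v \<in> L2 (lebesgue_on \<Omega>)" "d \<in> L2 (lebesgue_on \<Omega>)"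
    and lim: "(\<lambda>n. L2_norm_sq (lebesgue_on \<Omega>) (\<lambda>x. u n x - v x)) \<longlonglongrightarrow> 0"
      "(\<lambda>n. L2_norm_sq (lebesgue_on \<Omega>) (\<lambda>x. g n x - d x)) \<longlonglongrightarrow> 0"
  shows "H1_pair \<Omega> v d"
proof -
  have pL: "u n \<in> L2 (lebesgue_on \<Omega>)" "g n \<in> L2 (lebesgue_on \<Omega>)" for n
    using p by (auto simp: H1_pair_def)
  have "has_weak_gradient \<Omega> v d"
    unfolding has_weak_gradient_def
  proof (intro ballI)
    fix \<phi> and i :: 'a assume \<phi>: "\<phi> \<in> test_functions \<Omega>" and i: "i \<in> Basis"
    note \<phi>L = test_function_L2[OF \<phi> \<Omega>] and D\<phi>L = test_function_derivative_L2[OF \<phi> \<Omega>]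
    have 1: "(\<lambda>n. \<integral>x. u n x * frechet_derivative \<phi> (at x) i \<partial>lebesgue_on \<Omega>)
        \<longlonglongrightarrow> (\<integral>x. v x * frechet_derivative \<phi> (at x) i \<partial>lebesgue_on \<Omega>)"
      using L2_tendsto_integral_inner[OF pL(1) L(1) D\<phi>L lim(1)] by simp
    have \<phi>i: "(\<lambda>x. \<phi> x *\<^sub>R i) \<in> L2 (lebesgue_on \<Omega>)"
      using \<phi>L i by (intro L2_dominated[OF _ \<phi>L]) (auto simp: L2_def)
    have 2: "(\<lambda>n. \<integral>x. (g n x \<bullet> i) * \<phi> x \<partial>lebesgue_on \<Omega>) \<longlonglongrightarrow> (\<integral>x. (d x \<bullet> i) * \<phi> x \<partial>lebesgue_on \<Omega>)"
      using L2_tendsto_integral_inner[OF pL(2) L(2) \<phi>i lim(2)] by (simp add: mult.commute)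
    have "(\<lambda>n. - (\<integral>x. (g n x \<bullet> i) * \<phi> x \<partial>lebesgue_on \<Omega>)) \<longlonglongrightarrow> (\<integral>x. v x * frechet_derivative \<phi> (at x) i \<partial>lebesgue_on \<Omega>)"
      using 1 p \<phi> i by (simp add: H1_pair_def has_weak_gradient_def)
    from LIMSEQ_unique[OF this tendsto_minus[OF 2]]
    show "(\<integral>x. v x * frechet_derivative \<phi> (at x) i \<partial>lebesgue_on \<Omega>) = - (\<integral>x. (d x \<bullet> i) * \<phi> x \<partial>lebesgue_on \<Omega>)" .
  qed
  then show ?thesis using L by (simp add: H1_pair_def)
qed

section \<open>Difference quotients and positive parts\<close>

text \<open>The translation falls on the smooth factor, so \<open>f\<close> only has to be
  integrable. The mean value theorem bounds the difference quotients of \<open>\<psi>\<close> along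
  \<open>z\<close> by \<open>B\<close>, and \<open>B * norm (f x)\<close> dominates.\<close>

lemma DERIV_integral_translate:
  fixes f \<psi> :: "'a::euclidean_space \<Rightarrow> real"
  assumes f: "integrable lborel f"
    and D: "\<And>x. (\<psi> has_derivative \<psi>' x) (at x)"
    and bound: "\<And>x. \<bar>\<psi> x\<bar> \<le> C" "\<And>x. \<bar>\<psi>' x z\<bar> \<le> B"
    and meas [measurable]: "(\<lambda>x. \<psi>' x z) \<in> borel_measurable borel"
  shows "((\<lambda>s. \<integral>x. f x * \<psi> (x - s *\<^sub>R z) \<partial>lborel) has_real_derivative
    - (\<integral>x. f x * \<psi>' (x - s *\<^sub>R z) z \<partial>lborel)) (at s)"
proof -
  have fm [measurable]: "f \<in> borel_measurable borel" using borel_measurable_integrable[OF f] by simp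
  have "continuous_on UNIV \<psi>"
    using D by (meson continuous_at_imp_continuous_on has_derivative_continuous)
  then have \<psi>m [measurable]: "\<psi> \<in> borel_measurable borel" by (rule borel_measurable_continuous_onI)
  have Dt: "((\<lambda>t. \<psi> (x - t *\<^sub>R z)) has_real_derivative - \<psi>' (x - t *\<^sub>R z) z) (at t)" for x t
  proof -
    have "((\<lambda>t. x - t *\<^sub>R z) has_derivative (\<lambda>h. - (h *\<^sub>R z))) (at t)"
      by (auto intro!: derivative_eq_intros)
    from has_derivative_compose[OF this D]
    have "((\<lambda>t. \<psi> (x - t *\<^sub>R z)) has_derivative (\<lambda>h. \<psi>' (x - t *\<^sub>R z) (- (h *\<^sub>R z)))) (at t)" .
    moreover have "(\<lambda>h. \<psi>' (x - t *\<^sub>R z) (- (h *\<^sub>R z))) = (*) (- \<psi>' (x - t *\<^sub>R z) z)"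
    proof
      interpret linear "\<psi>' (x - t *\<^sub>R z)" using D by (rule has_derivative_linear)
      fix h show "\<psi>' (x - t *\<^sub>R z) (- (h *\<^sub>R z)) = - \<psi>' (x - t *\<^sub>R z) z * h"
        by (simp add: neg scale)
    qed
    ultimately show ?thesis by (simp add: has_field_derivative_def)
  qed
  have int: "integrable lborel (\<lambda>x. f x * \<psi> (x - t *\<^sub>R z))" for t
  proof (rule Bochner_Integration.integrable_bound)
    show "integrable lborel (\<lambda>x. C * f x)" using f by simp
    show "AE x in lborel. norm (f x * \<psi> (x - t *\<^sub>R z)) \<le> norm (C * f x)"
    proof (intro AE_I2)
      fix x
      have "\<bar>\<psi> (x - t *\<^sub>R z)\<bar> \<le> \<bar>C\<bar>" using bound(1)[of "x - t *\<^sub>R z"] by linarith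
      then show "norm (f x * \<psi> (x - t *\<^sub>R z)) \<le> norm (C * f x)"
        by (simp add: abs_mult mult.commute[of "\<bar>f x\<bar>"] mult_right_mono)
    qed
  qed measurable
  let ?h = "\<lambda>s. \<integral>x. f x * \<psi> (x - s *\<^sub>R z) \<partial>lborel"
  have "((\<lambda>t. (?h t - ?h s) / (t - s)) \<longlongrightarrow> - (\<integral>x. f x * \<psi>' (x - s *\<^sub>R z) z \<partial>lborel)) (at s)"
    unfolding tendsto_at_iff_sequentially
  proof (intro allI impI)
    fix X :: "nat \<Rightarrow> real" assume X: "\<forall>i. X i \<in> UNIV - {s}" "X \<longlonglongrightarrow> s"
    let ?q = "\<lambda>i x. f x * ((\<psi> (x - X i *\<^sub>R z) - \<psi> (x - s *\<^sub>R z)) / (X i - s))"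
    have "(\<lambda>i. \<integral>x. ?q i x \<partial>lborel) \<longlonglongrightarrow> (\<integral>x. f x * - \<psi>' (x - s *\<^sub>R z) z \<partial>lborel)"
    proof (rule integral_dominated_convergence)
      show "integrable lborel (\<lambda>x. B * norm (f x))" using f by simp
      show "AE x in lborel. (\<lambda>i. ?q i x) \<longlonglongrightarrow> f x * - \<psi>' (x - s *\<^sub>R z) z"
      proof (intro AE_I2 tendsto_mult_left)
        fix x
        have "((\<lambda>t. (\<psi> (x - t *\<^sub>R z) - \<psi> (x - s *\<^sub>R z)) / (t - s)) \<longlongrightarrow> - \<psi>' (x - s *\<^sub>R z) z) (at s)"
          using Dt[of x s] by (simp add: has_field_derivative_iff)
        then show "(\<lambda>i. (\<psi> (x - X i *\<^sub>R z) - \<psi> (x - s *\<^sub>R z)) / (X i - s)) \<longlonglongrightarrow> - \<psi>' (x - s *\<^sub>R z) z"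
          using X unfolding tendsto_at_iff_sequentially by (auto simp: o_def)
      qed
      show "AE x in lborel. norm (?q i x) \<le> B * norm (f x)" for i
      proof (intro AE_I2)
        fix x
        have "norm (\<psi> (x - X i *\<^sub>R z) - \<psi> (x - s *\<^sub>R z)) \<le> B * norm (X i - s)"
          using bound(2)
          by (intro field_differentiable_bound[where S=UNIV and f'="\<lambda>t. - \<psi>' (x - t *\<^sub>R z) z"])
             (auto intro: Dt)
        moreover have "0 < norm (X i - s)" using X by auto
        ultimately have "norm ((\<psi> (x - X i *\<^sub>R z) - \<psi> (x - s *\<^sub>R z)) / (X i - s)) \<le> B"
          by (simp add: divide_le_eq)
        then show "norm (?q i x) \<le> B * norm (f x)"
          by (simp only: norm_mult mult.commute[of "norm (f x)"] mult_right_mono norm_ge_zero)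
      qed
    qed measurable
    moreover have "(\<integral>x. ?q i x \<partial>lborel) = (?h (X i) - ?h s) / (X i - s)" for i
    proof -
      have "(\<integral>x. ?q i x \<partial>lborel) = (\<integral>x. (f x * \<psi> (x - X i *\<^sub>R z) - f x * \<psi> (x - s *\<^sub>R z)) / (X i - s) \<partial>lborel)"
        by (simp add: right_diff_distrib)
      also have "\<dots> = (\<integral>x. f x * \<psi> (x - X i *\<^sub>R z) - f x * \<psi> (x - s *\<^sub>R z) \<partial>lborel) / (X i - s)"
        by simp
      also have "\<dots> = (?h (X i) - ?h s) / (X i - s)"
        using int by (subst Bochner_Integration.integral_diff) auto
      finally show ?thesis .
    qed
    ultimately have "(\<lambda>i. (?h (X i) - ?h s) / (X i - s)) \<longlonglongrightarrow> (\<integral>x. f x * - \<psi>' (x - s *\<^sub>R z) z \<partial>lborel)"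
      by (simp only:)
    then show "((\<lambda>t. (?h t - ?h s) / (t - s)) \<circ> X) \<longlonglongrightarrow> - (\<integral>x. f x * \<psi>' (x - s *\<^sub>R z) z \<partial>lborel)"
      by (simp add: o_def)
  qed
  then show ?thesis by (simp add: has_field_derivative_iff)
qed

text \<open>The integral of \<open>F\<close> is unchanged by translation, so its derivative with
  respect to the shift is 0; by the preceding formula that derivative is minus the integral of
  \<open>F' x z\<close>.\<close>

lemma integral_derivative_compact_support:
  fixes F :: "'a::euclidean_space \<Rightarrow> real"
  assumes D: "\<And>x. (F has_derivative F' x) (at x)"
    and cont: "continuous_on UNIV (\<lambda>x. F' x z)"
    and K: "compact K" "\<And>x. x \<notin> K \<Longrightarrow> F x = 0" "\<And>x. x \<notin> K \<Longrightarrow> F' x z = 0"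
  shows "(\<integral>x. F' x z \<partial>lborel) = 0"
proof -
  have cF: "continuous_on UNIV F"
    using D by (meson continuous_at_imp_continuous_on has_derivative_continuous)
  obtain C where C: "\<And>x. \<bar>F x\<bar> \<le> C" using continuous_compact_support_bounded[OF cF K(1,2)] by auto
  obtain B where B: "\<And>x. \<bar>F' x z\<bar> \<le> B" using continuous_compact_support_bounded[OF cont K(1,3)] by auto
  have Fm [measurable]: "F \<in> borel_measurable borel" "(\<lambda>x. F' x z) \<in> borel_measurable borel"
    using cF cont by (auto intro: borel_measurable_continuous_onI)
  obtain R where R: "\<And>x. x \<in> K \<Longrightarrow> norm x \<le> R"
    using compact_imp_bounded[OF K(1)] by (auto simp: bounded_iff)
  \<comment> \<open>A ball of this radius contains the support of every translate by
    \<open>s *\<^sub>R z\<close> with s between -1 and 1; its indicator is the integrable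
    factor.\<close>
  let ?b = "cball (0::'a) (R + norm z)"
  let ?h = "\<lambda>s. \<integral>x. indicator ?b x * F (x - s *\<^sub>R z) \<partial>lborel"
  have f: "integrable lborel (indicator ?b :: 'a \<Rightarrow> real)"
    using emeasure_lborel_cball_finite[of 0 "R + norm z"] by (intro integrable_real_indicator) auto
  have ball: "x \<in> ?b" if "x - s *\<^sub>R z \<in> K" "\<bar>s\<bar> \<le> 1" for x s
  proof -
    have "norm x \<le> norm (x - s *\<^sub>R z) + norm (s *\<^sub>R z)" using norm_triangle_sub[of x "s *\<^sub>R z"] by simp
    also have "\<dots> \<le> R + norm z" using R[OF that(1)] that(2) by (simp add: mult_left_le_one_le add_mono)
    finally show ?thesis by simp
  qed
  have const: "?h s = (\<integral>x. F x \<partial>lborel)" if "\<bar>s\<bar> \<le> 1" for s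
  proof -
    have "?h s = (\<integral>x. F (x + (- s *\<^sub>R z)) \<partial>lborel)"
      using ball[OF _ that] K(2) by (intro Bochner_Integration.integral_cong) (auto simp: indicator_def)
    then show ?thesis by (subst (asm) integral_lborel_translate) auto
  qed
  have "(?h has_real_derivative - (\<integral>x. indicator ?b x * F' (x - 0 *\<^sub>R z) z \<partial>lborel)) (at 0)"
    by (rule DERIV_integral_translate[OF f D C B]) measurable
  then have "- (\<integral>x. indicator ?b x * F' (x - 0 *\<^sub>R z) z \<partial>lborel) = 0"
  proof (rule DERIV_local_const[of _ _ 0 1])
    show "\<forall>y. \<bar>0 - y\<bar> < 1 \<longrightarrow> ?h 0 = ?h y"
    proof (intro allI impI)
      fix y :: real assume "\<bar>0 - y\<bar> < 1"
      then show "?h 0 = ?h y" using const[of y] const[of 0] by simp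
    qed
  qed simp
  moreover have "(\<integral>x. indicator ?b x * F' (x - 0 *\<^sub>R z) z \<partial>lborel) = (\<integral>x. F' x z \<partial>lborel)"
    using ball[of _ 0] K(3) by (intro Bochner_Integration.integral_cong) (auto simp: indicator_def)
  ultimately show ?thesis by simp
qed

text \<open>Integration by parts: the derivative of the product of \<open>\<phi>\<close> with a test
  function is continuous with compact support and integrates to 0.\<close>

lemma smooth_H1_pair:
  fixes \<phi> :: "'a::euclidean_space \<Rightarrow> real"
  assumes \<phi>: "smooth \<phi>" and \<Omega>: "open \<Omega>" "bounded \<Omega>"
  shows "H1_pair \<Omega> \<phi> (\<lambda>x. \<Sum>i\<in>Basis. frechet_derivative \<phi> (at x) i *\<^sub>R i)"
proof -
  have \<Omega>m: "\<Omega> \<in> sets lebesgue" using \<Omega> by simp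
  let ?g = "\<lambda>x. \<Sum>i\<in>Basis. frechet_derivative \<phi> (at x) i *\<^sub>R i"
  have gi: "?g x \<bullet> i = frechet_derivative \<phi> (at x) i" if "i \<in> Basis" for x i
    using that by (simp add: inner_sum_left inner_Basis if_distrib cong: if_cong)
  have cg: "continuous_on UNIV ?g" by (intro continuous_intros smooth_continuous_on_derivative \<phi>)
  have "?g \<in> L2 (lebesgue_on \<Omega>)"
  proof (rule L2_dominated)
    show "?g \<in> borel_measurable (lebesgue_on \<Omega>)"
      by (intro borel_measurable_lebesgue_on borel_measurable_continuous_onI cg)
    show "(\<lambda>x. norm (?g x)) \<in> L2 (lebesgue_on \<Omega>)"
      by (intro bounded_continuous_L2 continuous_on_norm cg \<Omega> \<Omega>m)
  qed simp
  moreover have "\<phi> \<in> L2 (lebesgue_on \<Omega>)"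
    by (intro bounded_continuous_L2 smooth_continuous_on \<phi> \<Omega> \<Omega>m)
  moreover have "has_weak_gradient \<Omega> \<phi> ?g"
    unfolding has_weak_gradient_def
  proof (intro ballI)
    fix \<psi> and i :: 'a assume \<psi>: "\<psi> \<in> test_functions \<Omega>" and i: "i \<in> Basis"
    have sm: "smooth \<psi>" using \<psi> by (rule test_functionsD)
    obtain K where K: "compact K" "K \<subseteq> \<Omega>" "\<And>x. x \<notin> K \<Longrightarrow> \<psi> x = 0"
      "\<And>x z. x \<notin> K \<Longrightarrow> frechet_derivative \<psi> (at x) z = 0"
      using test_function_support[OF \<psi>] by metis
    let ?F' = "\<lambda>x z. \<phi> x * frechet_derivative \<psi> (at x) z + frechet_derivative \<phi> (at x) z * \<psi> x"
    have meas [measurable]: "\<phi> \<in> borel_measurable borel" "\<psi> \<in> borel_measurable borel"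
      "(\<lambda>x. frechet_derivative \<phi> (at x) i) \<in> borel_measurable borel"
      "(\<lambda>x. frechet_derivative \<psi> (at x) i) \<in> borel_measurable borel"
      using \<phi> sm by (auto intro: smooth_borel smooth_derivative_borel)
    have zero: "(\<integral>x. ?F' x i \<partial>lborel) = 0"
    proof (rule integral_derivative_compact_support[OF _ _ K(1)])
      show "((\<lambda>x. \<phi> x * \<psi> x) has_derivative ?F' x) (at x)" for x
        by (intro has_derivative_mult smooth_has_derivative \<phi> sm)
      show "continuous_on UNIV (\<lambda>x. ?F' x i)"
        by (intro continuous_intros smooth_continuous_on_derivative smooth_continuous_on \<phi> sm)
    qed (auto simp: K(3,4))
    have "(\<integral>x. \<phi> x * frechet_derivative \<psi> (at x) i \<partial>lebesgue_on \<Omega>) + (\<integral>x. (?g x \<bullet> i) * \<psi> x \<partial>lebesgue_on \<Omega>)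
      = (\<integral>x. ?F' x i \<partial>lebesgue_on \<Omega>)"
      unfolding gi[OF i]
      by (intro Bochner_Integration.integral_add[symmetric] L2_integrable_mult
          bounded_continuous_L2 smooth_continuous_on smooth_continuous_on_derivative \<phi> sm \<Omega> \<Omega>m)
    also have "\<dots> = (\<integral>x. ?F' x i \<partial>lborel)"
    proof (rule integral_lebesgue_on_lborel[OF \<Omega>m])
      show "?F' x i = 0" if "x \<notin> \<Omega>" for x
      proof -
        have "x \<notin> K" using K(2) that by auto
        then show ?thesis by (simp add: K(3,4))
      qed
    qed measurable
    finally show "(\<integral>x. \<phi> x * frechet_derivative \<psi> (at x) i \<partial>lebesgue_on \<Omega>) = - (\<integral>x. (?g x \<bullet> i) * \<psi> x \<partial>lebesgue_on \<Omega>)"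
      using zero by simp
  qed
  ultimately show ?thesis by (simp add: H1_pair_def)
qed

section \<open>Bounds for translation differences\<close>

lemma sqnorm_component_le:
  fixes g :: "'b \<Rightarrow> 'a::euclidean_space"
  assumes "g \<in> L2 M"
  shows "sqnorm M (\<lambda>x. g x \<bullet> z) \<le> (norm z)\<^sup>2 * sqnorm M g"
proof -
  have "sqnorm M (\<lambda>x. g x \<bullet> z) \<le> (\<integral>x. (norm z)\<^sup>2 * (norm (g x))\<^sup>2 \<partial>M)"
    unfolding sqnorm_def
  proof (intro integral_mono)
    show "integrable M (\<lambda>x. (norm (g x \<bullet> z))\<^sup>2)"
      by (intro L2_integrable_sq L2_inner_component assms)
    show "integrable M (\<lambda>x. (norm z)\<^sup>2 * (norm (g x))\<^sup>2)"
      by (intro integrable_mult_right L2_integrable_sq assms)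
    fix x
    have "norm (g x \<bullet> z) \<le> norm z * norm (g x)" using Cauchy_Schwarz_ineq2[of "g x" z] by (simp add: mult.commute)
    then have "(norm (g x \<bullet> z))\<^sup>2 \<le> (norm z * norm (g x))\<^sup>2" by (intro power_mono) auto
    then show "(norm (g x \<bullet> z))\<^sup>2 \<le> (norm z)\<^sup>2 * (norm (g x))\<^sup>2" by (simp add: power_mult_distrib)
  qed
  then show ?thesis by (simp add: sqnorm_def)
qed

lemma sqnorm_lebesgue_on_lborel:
  fixes f :: "'a::euclidean_space \<Rightarrow> real"
  assumes "\<Omega> \<in> sets lebesgue" "f \<in> borel_measurable borel" "\<And>x. x \<notin> \<Omega> \<Longrightarrow> f x = 0"
  shows "sqnorm (lebesgue_on \<Omega>) f = (\<integral>x. (f x)\<^sup>2 \<partial>lborel)"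
  unfolding sqnorm_def using assms integral_lebesgue_on_lborel[of \<Omega> "\<lambda>x. (f x)\<^sup>2"] by simp

lemma integrable_lborel_of_L2:
  fixes w :: "'a::euclidean_space \<Rightarrow> real"
  assumes w: "w \<in> borel_measurable borel" "\<And>x. x \<notin> \<Omega> \<Longrightarrow> w x = 0" "w \<in> L2 (lebesgue_on \<Omega>)"
    and \<Omega>: "open \<Omega>" "bounded \<Omega>"
  shows "integrable lborel w"
proof -
  have "integrable (lebesgue_on \<Omega>) w" by (rule L2_integrable_bounded) (use w \<Omega> in auto)
  then have "integrable lebesgue (\<lambda>x. indicator \<Omega> x *\<^sub>R w x)"
    using \<Omega> by (subst (asm) integrable_restrict_space) auto
  moreover have "(\<lambda>x. indicator \<Omega> x *\<^sub>R w x) = w"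
  proof
    fix x show "indicator \<Omega> x *\<^sub>R w x = w x" using w(2)[of x] by (cases "x \<in> \<Omega>") auto
  qed
  ultimately show ?thesis using w(1) by (simp add: integrable_completion)
qed

text \<open>The finite-step form of integration by parts: a substitution in the first integral moves
  the shift from the test function to \<open>v\<close>.\<close>

lemma integral_translate_difference:
  fixes v \<psi> :: "'a::euclidean_space \<Rightarrow> real"
  assumes v: "integrable lborel v" and \<psi>: "\<psi> \<in> test_functions U" and U: "open U"
  shows "(\<integral>x. v x * \<psi> (x - z) \<partial>lborel) - (\<integral>x. v x * \<psi> x \<partial>lborel)
    = (\<integral>x. (v (x + z) - v x) * \<psi> x \<partial>lebesgue_on U)"
proof -
  have [measurable]: "v \<in> borel_measurable borel" using borel_measurable_integrable[OF v] by simp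
  have [measurable]: "\<psi> \<in> borel_measurable borel" using test_functionsD(1)[OF \<psi>] by (rule smooth_borel)
  obtain B where B: "B \<ge> 0" "\<And>x. \<bar>\<psi> x\<bar> \<le> B" using test_function_bounded[OF \<psi>] by auto
  have int: "integrable lborel (\<lambda>x. f x * \<psi> x)" if "integrable lborel f" for f
  proof (rule Bochner_Integration.integrable_bound)
    show "integrable lborel (\<lambda>x. B * f x)" using that by simp
    show "AE x in lborel. norm (f x * \<psi> x) \<le> norm (B * f x)"
      using B by (auto simp: abs_mult mult.commute[of "\<bar>f _\<bar>"] intro!: mult_right_mono)
    show "(\<lambda>x. f x * \<psi> x) \<in> borel_measurable lborel"
      using borel_measurable_integrable[OF that] by measurable
  qed
  have "(\<integral>x. v x * \<psi> (x - z) \<partial>lborel) = (\<integral>x. v (x + z) * \<psi> (x + z - z) \<partial>lborel)"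
    by (rule integral_lborel_translate[symmetric, of "\<lambda>x. v x * \<psi> (x - z)" z]) measurable
  then have "(\<integral>x. v x * \<psi> (x - z) \<partial>lborel) - (\<integral>x. v x * \<psi> x \<partial>lborel)
      = (\<integral>x. v (x + z) * \<psi> x - v x * \<psi> x \<partial>lborel)"
    using int[OF v] int[OF integrable_lborel_translate[OF v, of z]] by simp
  also have "\<dots> = (\<integral>x. (v (x + z) - v x) * \<psi> x \<partial>lebesgue_on U)"
    using U test_function_outside[OF \<psi>]
    by (subst integral_lebesgue_on_lborel) (auto simp: left_diff_distrib)
  finally show ?thesis .
qed

lemma L2_translate_difference:
  fixes w :: "'a::euclidean_space \<Rightarrow> real"
  assumes w: "w \<in> borel_measurable borel" "\<And>x. x \<notin> \<Omega> \<Longrightarrow> w x = 0" "w \<in> L2 (lebesgue_on \<Omega>)"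
    and \<Omega>: "open \<Omega>" and U: "open U"
  shows "(\<lambda>x. w (x + z) - w x) \<in> L2 (lebesgue_on U)"
proof -
  have [measurable]: "w \<in> borel_measurable borel" by (rule w)
  have tr: "(\<lambda>x. w (x + a)) \<in> L2 (lebesgue_on U)" for a
  proof -
    have "L2_norm_sq (lebesgue_on U) (\<lambda>x. w (x + a)) \<le> (\<integral>\<^sup>+x. ennreal ((norm (w (x + a)))\<^sup>2) \<partial>lborel)"
      using U by (subst L2_norm_sq_lebesgue_on) (auto intro!: nn_integral_mono simp: indicator_def)
    also have "\<dots> = (\<integral>\<^sup>+x. ennreal ((norm (w x))\<^sup>2) \<partial>lborel)"
      by (rule nn_integral_lborel_translate[of "\<lambda>x. ennreal ((norm (w x))\<^sup>2)"]) measurable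
    also have "\<dots> = L2_norm_sq (lebesgue_on \<Omega>) w"
      using \<Omega> w(2) by (subst L2_norm_sq_lebesgue_on_lborel) auto
    also have "\<dots> < \<infinity>" using w(3) by (simp add: L2_def)
    finally show ?thesis by (simp add: L2_def borel_measurable_lebesgue_on)
  qed
  show ?thesis using L2_diff[OF tr[of z] tr[of 0]] by simp
qed

text \<open>Along the shift, the pairing of \<open>w\<close> with a translated test function has as
  derivative the pairing of the component of \<open>g\<close> along \<open>z\<close> with that
  translate, which Cauchy-Schwarz bounds. The mean value theorem over [0, 1] then bounds the pairing
  of the difference with every test function on \<open>U\<close>, and duality bounds the difference
  itself.\<close>

lemma difference_quotient_bound:
  fixes w :: "'a::euclidean_space \<Rightarrow> real"
  assumes w: "w \<in> borel_measurable borel" "\<And>x. x \<notin> \<Omega> \<Longrightarrow> w x = 0" and p: "H1_pair \<Omega> w g"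
    and \<Omega>: "open \<Omega>" "bounded \<Omega>" and U: "open U"
    and seg: "\<And>x s. x \<in> U \<Longrightarrow> 0 \<le> s \<Longrightarrow> s \<le> 1 \<Longrightarrow> x + s *\<^sub>R z \<in> \<Omega>"
  shows "L2_norm_sq (lebesgue_on U) (\<lambda>x. w (x + z) - w x)
    \<le> ennreal ((norm z)\<^sup>2 * sqnorm (lebesgue_on \<Omega>) g)"
proof -
  have \<Omega>m: "\<Omega> \<in> sets lebesgue" and Um: "U \<in> sets lebesgue" using \<Omega> U by auto
  have L: "w \<in> L2 (lebesgue_on \<Omega>)" "g \<in> L2 (lebesgue_on \<Omega>)" using p by (auto simp: H1_pair_def)
  have [measurable]: "w \<in> borel_measurable borel" by (rule w)
  have wi: "integrable lborel w" by (rule integrable_lborel_of_L2[OF w L(1) \<Omega>])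
  let ?D = "\<lambda>x. w (x + z) - w x"
  let ?C = "norm z * sqrt (sqnorm (lebesgue_on \<Omega>) g)"
  have DL: "?D \<in> L2 (lebesgue_on U)" by (rule L2_translate_difference[OF w L(1) \<Omega>(1) U])
  have bound: "\<bar>\<integral>x. ?D x * \<psi> x \<partial>lebesgue_on U\<bar> \<le> ?C * sqrt (sqnorm (lebesgue_on U) \<psi>)"
    if \<psi>: "\<psi> \<in> test_functions U" for \<psi>
  proof -
    let ?h = "\<lambda>s. \<integral>x. w x * \<psi> (x - s *\<^sub>R z) \<partial>lborel"
    let ?h' = "\<lambda>s. - (\<integral>x. w x * frechet_derivative \<psi> (at (x - s *\<^sub>R z)) z \<partial>lborel)"
    have sm: "smooth \<psi>" using \<psi> by (rule test_functionsD)
    have [measurable]: "\<psi> \<in> borel_measurable borel" using sm by (rule smooth_borel)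
    obtain C1 where C1: "\<And>x. \<bar>\<psi> x\<bar> \<le> C1" using test_function_bounded[OF \<psi>] by auto
    obtain B1 where B1: "\<And>x. \<bar>frechet_derivative \<psi> (at x) z\<bar> \<le> B1" using test_function_derivative_bounded[OF \<psi>] by auto
    have der: "(?h has_real_derivative ?h' s) (at s)" for s
      by (rule DERIV_integral_translate[OF wi smooth_has_derivative[OF sm] C1 B1 smooth_derivative_borel[OF sm]])
    have h'_le: "\<bar>?h' s\<bar> \<le> ?C * sqrt (sqnorm (lebesgue_on U) \<psi>)" if s: "0 \<le> s" "s \<le> 1" for s
    proof -
      let ?\<psi> = "\<lambda>x. \<psi> (x - s *\<^sub>R z)"
      \<comment> \<open>The segment hypothesis enters here: the shifted test function still has its
        support in \<open>\<Omega>\<close>, where the weak gradient identity holds.\<close>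
      have \<psi>s: "?\<psi> \<in> test_functions \<Omega>"
        by (rule test_functions_translate[OF \<psi>]) (use seg s in auto)
      have Ds: "frechet_derivative ?\<psi> (at x) = frechet_derivative \<psi> (at (x - s *\<^sub>R z))" for x
      proof (rule frechet_derivative_eqI)
        have "((\<lambda>x. x - s *\<^sub>R z) has_derivative (\<lambda>h. h)) (at x)" by (auto intro!: derivative_eq_intros)
        from has_derivative_compose[OF this smooth_has_derivative[OF sm]]
        show "(?\<psi> has_derivative frechet_derivative \<psi> (at (x - s *\<^sub>R z))) (at x)" by simp
      qed
      have \<psi>L: "?\<psi> \<in> L2 (lebesgue_on \<Omega>)" by (rule test_function_L2[OF \<psi>s \<Omega>m])
      have D\<psi>L: "(\<lambda>x. frechet_derivative ?\<psi> (at x) i) \<in> L2 (lebesgue_on \<Omega>)" for i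
        by (rule test_function_derivative_L2[OF \<psi>s \<Omega>m])
      have "(\<integral>x. w x * frechet_derivative \<psi> (at (x - s *\<^sub>R z)) z \<partial>lborel)
          = (\<integral>x. w x * frechet_derivative ?\<psi> (at x) z \<partial>lebesgue_on \<Omega>)"
        unfolding Ds using w smooth_derivative_borel[OF sm, of z]
        by (intro integral_lebesgue_on_lborel[symmetric] \<Omega>m) auto
      also have "\<dots> = (\<integral>x. (\<Sum>i\<in>Basis. (z \<bullet> i) * (w x * frechet_derivative ?\<psi> (at x) i)) \<partial>lebesgue_on \<Omega>)"
        using frechet_derivative_direction[OF smooth_has_derivative[OF test_functionsD(1)[OF \<psi>s]], of _ z]
        by (simp add: sum_distrib_left mult.left_commute)
      also have "\<dots> = (\<Sum>i\<in>Basis. (z \<bullet> i) * (\<integral>x. w x * frechet_derivative ?\<psi> (at x) i \<partial>lebesgue_on \<Omega>))"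
        by (subst Bochner_Integration.integral_sum) (auto intro!: integrable_mult_right L2_integrable_mult L D\<psi>L)
      also have "\<dots> = (\<Sum>i\<in>Basis. - ((z \<bullet> i) * (\<integral>x. (g x \<bullet> i) * ?\<psi> x \<partial>lebesgue_on \<Omega>)))"
        using p \<psi>s by (intro sum.cong) (auto simp: H1_pair_def has_weak_gradient_def)
      also have "\<dots> = - (\<integral>x. (\<Sum>i\<in>Basis. (z \<bullet> i) * ((g x \<bullet> i) * ?\<psi> x)) \<partial>lebesgue_on \<Omega>)"
        by (subst Bochner_Integration.integral_sum)
           (auto intro!: integrable_mult_right L2_integrable_mult L2_inner_component L \<psi>L simp: sum_negf)
      also have "\<dots> = - (\<integral>x. (g x \<bullet> z) * ?\<psi> x \<partial>lebesgue_on \<Omega>)"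
        by (simp add: euclidean_inner[of "g _" z] sum_distrib_left sum_distrib_right mult_ac)
      finally have "\<bar>?h' s\<bar> = \<bar>\<integral>x. (g x \<bullet> z) \<bullet> ?\<psi> x \<partial>lebesgue_on \<Omega>\<bar>" by simp
      also have "\<dots> \<le> sqrt (sqnorm (lebesgue_on \<Omega>) (\<lambda>x. g x \<bullet> z)) * sqrt (sqnorm (lebesgue_on \<Omega>) ?\<psi>)"
        by (intro L2_Cauchy_Schwarz_sqrt L2_inner_component L \<psi>L)
      also have "\<dots> \<le> ?C * sqrt (sqnorm (lebesgue_on \<Omega>) ?\<psi>)"
        using real_sqrt_le_mono[OF sqnorm_component_le[OF L(2), of z]]
        by (intro mult_right_mono) (auto simp: real_sqrt_mult)
      also have "sqnorm (lebesgue_on \<Omega>) ?\<psi> = sqnorm (lebesgue_on U) \<psi>"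
      proof -
        have "sqnorm (lebesgue_on \<Omega>) ?\<psi> = (\<integral>x. (\<psi> (x + (- s *\<^sub>R z)))\<^sup>2 \<partial>lborel)"
          using test_function_outside[OF \<psi>s] by (subst sqnorm_lebesgue_on_lborel[OF \<Omega>m]) auto
        also have "\<dots> = (\<integral>x. (\<psi> x)\<^sup>2 \<partial>lborel)"
          by (rule integral_lborel_translate) measurable
        also have "\<dots> = sqnorm (lebesgue_on U) \<psi>"
          using test_function_outside[OF \<psi>] by (subst sqnorm_lebesgue_on_lborel[OF Um]) auto
        finally show ?thesis .
      qed
      finally show ?thesis .
    qed
    obtain s where s: "0 < s" "s < 1" "?h 1 - ?h 0 = (1 - 0) * ?h' s"
      using MVT2[of 0 1 ?h ?h'] der by auto
    have "(\<integral>x. ?D x * \<psi> x \<partial>lebesgue_on U) = ?h 1 - ?h 0"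
      using integral_translate_difference[OF wi \<psi> U, of z] by simp
    also have "\<dots> = ?h' s" using s(3) by simp
    finally show ?thesis using h'_le[of s] s(1,2) by simp
  qed
  text \<open>Representing the functional and identifying the representative with the difference avoids
    the density of test functions in \<open>L\<^sup>2\<close>.\<close>
  have "\<exists>G\<in>L2 (lebesgue_on U). sqnorm (lebesgue_on U) G \<le> ?C\<^sup>2 \<and>
     (\<forall>\<psi>\<in>test_functions U. (\<integral>x. ?D x * \<psi> x \<partial>lebesgue_on U) = (\<integral>x. G x * \<psi> x \<partial>lebesgue_on U))"
  proof (rule L2_Riesz)
    show "test_functions U \<subseteq> L2 (lebesgue_on U)" using test_function_L2[OF _ Um] by auto
    show "(\<integral>x. ?D x * (f x + g x) \<partial>lebesgue_on U) = (\<integral>x. ?D x * f x \<partial>lebesgue_on U) + (\<integral>x. ?D x * g x \<partial>lebesgue_on U)"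
      if "f \<in> test_functions U" "g \<in> test_functions U" for f g
      unfolding distrib_left
      by (intro Bochner_Integration.integral_add L2_integrable_mult DL
          test_function_L2[OF that(1) Um] test_function_L2[OF that(2) Um])
    show "(\<integral>x. ?D x * (c * f x) \<partial>lebesgue_on U) = c * (\<integral>x. ?D x * f x \<partial>lebesgue_on U)" for f c
      by (simp add: mult.left_commute)
  qed (auto intro: test_functions_add test_functions_cmult bound)
  then obtain G where G: "G \<in> L2 (lebesgue_on U)" "sqnorm (lebesgue_on U) G \<le> ?C\<^sup>2"
    "\<And>\<psi>. \<psi> \<in> test_functions U \<Longrightarrow> (\<integral>x. ?D x * \<psi> x \<partial>lebesgue_on U) = (\<integral>x. G x * \<psi> x \<partial>lebesgue_on U)" by blast
  have "AE x in lebesgue_on U. ?D x - G x = 0"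
  proof (rule fundamental_lemma[OF U])
    show "(\<lambda>x. ?D x - G x) \<in> L2 (lebesgue_on U)" by (intro L2_diff DL G)
    show "(\<integral>x. (?D x - G x) * \<psi> x \<partial>lebesgue_on U) = 0" if "\<psi> \<in> test_functions U" for \<psi>
    proof -
      have "(\<integral>x. (?D x - G x) * \<psi> x \<partial>lebesgue_on U)
          = (\<integral>x. ?D x * \<psi> x \<partial>lebesgue_on U) - (\<integral>x. G x * \<psi> x \<partial>lebesgue_on U)"
        unfolding left_diff_distrib[of "?D _"]
        by (intro Bochner_Integration.integral_diff L2_integrable_mult DL G(1) test_function_L2[OF that Um])
      then show ?thesis using G(3)[OF that] by simp
    qed
  qed
  then have "AE x in lebesgue_on U. ?D x = G x" by eventually_elim simp
  then have "L2_norm_sq (lebesgue_on U) ?D = L2_norm_sq (lebesgue_on U) G" by (rule L2_norm_sq_cong_AE)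
  also have "\<dots> = ennreal (sqnorm (lebesgue_on U) G)" by (rule L2_norm_sq_eq[OF G(1)])
  also have "\<dots> \<le> ennreal ((norm z)\<^sup>2 * sqnorm (lebesgue_on \<Omega>) g)"
    using G(2) by (intro ennreal_leI) (simp add: power_mult_distrib)
  finally show ?thesis .
qed

text \<open>Truncation at 0 is 1-Lipschitz, so translation differences of the positive part are
  pointwise at most those of \<open>w\<close>. Dividing by the step and letting it tend to 0 bounds
  the pairing with a partial derivative of a test function by the L2 norm of the test function
  itself, so each distributional derivative is an L2 function. Its explicit form is not identified;
  only membership in \<open>H1\<close> is claimed.\<close>

lemma H1_positive_part:
  fixes w :: "'a::euclidean_space \<Rightarrow> real"
  assumes w: "w \<in> H1 \<Omega>" and \<Omega>: "open \<Omega>" "bounded \<Omega>"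
  shows "(\<lambda>x. max (w x) 0) \<in> H1 \<Omega>"
proof -
  have \<Omega>m: "\<Omega> \<in> sets lebesgue" using \<Omega> by auto
  obtain g where g: "H1_pair \<Omega> w g" using w H1_iff by blast
  then have wm: "w \<in> borel_measurable (lebesgue_on \<Omega>)" by (simp add: H1_pair_def L2_def)
  obtain w0 where w0: "w0 \<in> borel_measurable borel" "\<And>x. x \<notin> \<Omega> \<Longrightarrow> w0 x = 0"
    and ae: "AE x in lebesgue_on \<Omega>. w x = w0 x"
    using ex_borel_representative[OF wm \<Omega>(1)] by auto
  note [measurable] = w0(1)
  have p: "H1_pair \<Omega> w0 g"
    by (rule H1_pair_cong_AE[OF g ae _ \<Omega>m]) (intro borel_measurable_lebesgue_on w0)
  have L: "w0 \<in> L2 (lebesgue_on \<Omega>)" "g \<in> L2 (lebesgue_on \<Omega>)" using p by (auto simp: H1_pair_def)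
  define v where "v x = max (w0 x) 0" for x
  have vm [measurable]: "v \<in> borel_measurable borel" unfolding v_def by measurable
  have v0: "v x = 0" if "x \<notin> \<Omega>" for x using w0(2)[OF that] by (simp add: v_def)
  have vL: "v \<in> L2 (lebesgue_on \<Omega>)"
    by (rule L2_dominated[OF _ L(1)]) (auto intro: borel_measurable_lebesgue_on simp: v_def)
  have vi: "integrable lborel v" by (rule integrable_lborel_of_L2[OF vm v0 vL \<Omega>])
  let ?N = "sqrt (sqnorm (lebesgue_on \<Omega>) g)"
  have bound: "\<bar>- (\<integral>x. v x * frechet_derivative \<phi> (at x) i \<partial>lebesgue_on \<Omega>)\<bar> \<le> ?N * sqrt (sqnorm (lebesgue_on \<Omega>) \<phi>)"
    if \<phi>: "\<phi> \<in> test_functions \<Omega>" and i: "i \<in> Basis" for \<phi> and i :: 'a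
  proof -
    have sm: "smooth \<phi>" using \<phi> by (rule test_functionsD)
    have [measurable]: "\<phi> \<in> borel_measurable borel" using sm by (rule smooth_borel)
    obtain K where K: "compact K" "K \<subseteq> \<Omega>" "\<And>x. x \<notin> K \<Longrightarrow> \<phi> x = 0"
      using test_function_support[OF \<phi>] by metis
    obtain \<delta> where \<delta>: "\<delta> > 0" "(\<Union>x\<in>K. ball x \<delta>) \<subseteq> \<Omega>"
      using compact_subset_open_imp_ball_epsilon_subset[OF K(1) \<Omega>(1) K(2)] by blast
    \<comment> \<open>Half of the margin \<open>\<delta>\<close> goes to the neighbourhood
      \<open>U\<close> of the support and half to the shift, so segments shorter than
      \<open>\<delta>/2\<close> starting in \<open>U\<close> stay in
      \<open>\<Omega>\<close>.\<close>
    define U where "U = (\<Union>x\<in>K. ball x (\<delta>/2))"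
    have U: "open U" by (auto simp: U_def)
    have KU: "K \<subseteq> U" using \<delta>(1) by (auto simp: U_def)
    have \<phi>U: "\<phi> \<in> test_functions U"
      by (rule test_functions_subset[OF sm _ K(1) KU]) (use K(3) in auto)
    have seg: "x + s *\<^sub>R (t *\<^sub>R i) \<in> \<Omega>" if "x \<in> U" "0 \<le> s" "s \<le> 1" "0 < t" "t < \<delta>/2" for x s t
    proof -
      obtain y where y: "y \<in> K" "dist y x < \<delta>/2" using \<open>x \<in> U\<close> by (auto simp: U_def)
      have "norm (s *\<^sub>R (t *\<^sub>R i)) \<le> t"
        using that i by (simp add: mult_left_le_one_le)
      then have "dist y (x + s *\<^sub>R (t *\<^sub>R i)) < \<delta>"
        using y(2) that(5) dist_triangle[of y "x + s *\<^sub>R (t *\<^sub>R i)" x] by (simp add: dist_norm)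
      then have "x + s *\<^sub>R (t *\<^sub>R i) \<in> ball y \<delta>" by simp
      then show ?thesis using \<delta>(2) y(1) by blast
    qed
    let ?h = "\<lambda>s. \<integral>x. v x * \<phi> (x - s *\<^sub>R i) \<partial>lborel"
    obtain C1 where C1: "\<And>x. \<bar>\<phi> x\<bar> \<le> C1" using test_function_bounded[OF \<phi>] by auto
    obtain B1 where B1: "\<And>x. \<bar>frechet_derivative \<phi> (at x) i\<bar> \<le> B1" using test_function_derivative_bounded[OF \<phi>] by auto
    have "(?h has_real_derivative - (\<integral>x. v x * frechet_derivative \<phi> (at (x - 0 *\<^sub>R i)) i \<partial>lborel)) (at 0)"
      by (rule DERIV_integral_translate[OF vi smooth_has_derivative[OF sm] C1 B1 smooth_derivative_borel[OF sm]])
    also have "(\<integral>x. v x * frechet_derivative \<phi> (at (x - 0 *\<^sub>R i)) i \<partial>lborel)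
        = (\<integral>x. v x * frechet_derivative \<phi> (at x) i \<partial>lebesgue_on \<Omega>)"
      using v0 smooth_derivative_borel[OF sm, of i] by (subst integral_lebesgue_on_lborel[OF \<Omega>m]) auto
    finally have lim: "((\<lambda>t. (?h t - ?h 0) / (t - 0)) \<longlongrightarrow>
        - (\<integral>x. v x * frechet_derivative \<phi> (at x) i \<partial>lebesgue_on \<Omega>)) (at_right 0)"
      by (auto simp: has_field_derivative_iff intro: tendsto_mono[OF at_le])
    \<comment> \<open>The bound is established for positive steps only, hence the limit from the
      right above.\<close>
    have "\<forall>\<^sub>F t in at_right 0. \<bar>(?h t - ?h 0) / (t - 0)\<bar> \<le> ?N * sqrt (sqnorm (lebesgue_on \<Omega>) \<phi>)"
      unfolding eventually_at_right_field
    proof (intro exI[of _ "\<delta>/2"] conjI allI impI)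
      fix t assume t: "0 < t" "t < \<delta>/2"
      have "\<bar>?h t - ?h 0\<bar> = \<bar>\<integral>x. (v (x + t *\<^sub>R i) - v x) \<bullet> \<phi> x \<partial>lebesgue_on U\<bar>"
        using integral_translate_difference[OF vi \<phi>U U, of "t *\<^sub>R i"] by simp
      also have "\<dots> \<le> sqrt (sqnorm (lebesgue_on U) (\<lambda>x. v (x + t *\<^sub>R i) - v x)) * sqrt (sqnorm (lebesgue_on U) \<phi>)"
        using U by (intro L2_Cauchy_Schwarz_sqrt L2_translate_difference[OF vm v0 vL \<Omega>(1)] test_function_L2[OF \<phi>U]) auto
      also have "sqnorm (lebesgue_on U) \<phi> = sqnorm (lebesgue_on \<Omega>) \<phi>"
        using U test_function_outside[OF \<phi>U] test_function_outside[OF \<phi>]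
        by (subst (1 2) sqnorm_lebesgue_on_lborel) (use \<Omega>m in auto)
      also have "sqnorm (lebesgue_on U) (\<lambda>x. v (x + t *\<^sub>R i) - v x) \<le> t\<^sup>2 * sqnorm (lebesgue_on \<Omega>) g"
      proof -
        have "ennreal (sqnorm (lebesgue_on U) (\<lambda>x. v (x + t *\<^sub>R i) - v x)) = L2_norm_sq (lebesgue_on U) (\<lambda>x. v (x + t *\<^sub>R i) - v x)"
          by (rule L2_norm_sq_eq[symmetric]) (rule L2_translate_difference[OF vm v0 vL \<Omega>(1) U])
        also have "\<dots> \<le> L2_norm_sq (lebesgue_on U) (\<lambda>x. w0 (x + t *\<^sub>R i) - w0 x)"
          unfolding L2_norm_sq_def v_def by (intro nn_integral_mono ennreal_leI power_mono) auto
        also have "\<dots> \<le> ennreal ((norm (t *\<^sub>R i))\<^sup>2 * sqnorm (lebesgue_on \<Omega>) g)"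
          by (rule difference_quotient_bound[OF w0 p \<Omega> U]) (use seg t in auto)
        finally show ?thesis using i by (subst (asm) ennreal_le_iff) auto
      qed
      finally have "\<bar>?h t - ?h 0\<bar> \<le> sqrt (t\<^sup>2 * sqnorm (lebesgue_on \<Omega>) g) * sqrt (sqnorm (lebesgue_on \<Omega>) \<phi>)"
        by (simp add: mult_right_mono)
      then have "\<bar>?h t - ?h 0\<bar> \<le> t * (?N * sqrt (sqnorm (lebesgue_on \<Omega>) \<phi>))"
        using t by (simp add: real_sqrt_mult mult.assoc)
      then show "\<bar>(?h t - ?h 0) / (t - 0)\<bar> \<le> ?N * sqrt (sqnorm (lebesgue_on \<Omega>) \<phi>)"
        using t by (simp add: abs_divide pos_divide_le_eq mult.commute)
    qed (use \<delta> in auto)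
    then show ?thesis
      by (rule tendsto_upperbound[OF tendsto_rabs[OF lim]]) simp
  qed
  have "\<exists>G\<in>L2 (lebesgue_on \<Omega>). sqnorm (lebesgue_on \<Omega>) G \<le> ?N\<^sup>2 \<and>
     (\<forall>\<phi>\<in>test_functions \<Omega>. - (\<integral>x. v x * frechet_derivative \<phi> (at x) i \<partial>lebesgue_on \<Omega>) = (\<integral>x. G x * \<phi> x \<partial>lebesgue_on \<Omega>))"
    if i: "i \<in> Basis" for i
  proof (rule L2_Riesz)
    show "test_functions \<Omega> \<subseteq> L2 (lebesgue_on \<Omega>)" using test_function_L2[OF _ \<Omega>m] by auto
    have vD: "integrable (lebesgue_on \<Omega>) (\<lambda>x. v x * frechet_derivative f (at x) i)" if "f \<in> test_functions \<Omega>" for f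
      by (intro L2_integrable_mult vL test_function_derivative_L2[OF that \<Omega>m])
    show "- (\<integral>x. v x * frechet_derivative (\<lambda>x. f x + g x) (at x) i \<partial>lebesgue_on \<Omega>)
        = - (\<integral>x. v x * frechet_derivative f (at x) i \<partial>lebesgue_on \<Omega>) + - (\<integral>x. v x * frechet_derivative g (at x) i \<partial>lebesgue_on \<Omega>)"
      if fg: "f \<in> test_functions \<Omega>" "g \<in> test_functions \<Omega>" for f g
    proof -
      have "frechet_derivative (\<lambda>x. f x + g x) (at x) = (\<lambda>z. frechet_derivative f (at x) z + frechet_derivative g (at x) z)" for x
        by (intro frechet_derivative_eqI has_derivative_add
            smooth_has_derivative[OF test_functionsD(1)[OF fg(1)]] smooth_has_derivative[OF test_functionsD(1)[OF fg(2)]])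
      then show ?thesis using vD fg by (simp add: distrib_left)
    qed
    show "- (\<integral>x. v x * frechet_derivative (\<lambda>x. c * f x) (at x) i \<partial>lebesgue_on \<Omega>)
        = c * - (\<integral>x. v x * frechet_derivative f (at x) i \<partial>lebesgue_on \<Omega>)"
      if f: "f \<in> test_functions \<Omega>" for f c
    proof -
      have "frechet_derivative (\<lambda>x. c * f x) (at x) = (\<lambda>z. c * frechet_derivative f (at x) z)" for x
        by (intro frechet_derivative_eqI has_derivative_mult_right smooth_has_derivative[OF test_functionsD(1)[OF f]])
      then show ?thesis by (simp add: mult.left_commute)
    qed
    show "\<bar>- (\<integral>x. v x * frechet_derivative f (at x) i \<partial>lebesgue_on \<Omega>)\<bar> \<le> ?N * sqrt (sqnorm (lebesgue_on \<Omega>) f)"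
      if "f \<in> test_functions \<Omega>" for f
      by (rule bound[OF that i])
  qed (rule test_functions_zero test_functions_add test_functions_cmult; assumption?)+
  then have "\<forall>i\<in>Basis. \<exists>G. G \<in> L2 (lebesgue_on \<Omega>) \<and> (\<forall>\<phi>\<in>test_functions \<Omega>.
      - (\<integral>x. v x * frechet_derivative \<phi> (at x) i \<partial>lebesgue_on \<Omega>) = (\<integral>x. G x * \<phi> x \<partial>lebesgue_on \<Omega>))"
    by blast
  from bchoice[OF this] obtain G where "\<forall>i\<in>Basis. G i \<in> L2 (lebesgue_on \<Omega>) \<and> (\<forall>\<phi>\<in>test_functions \<Omega>.
      - (\<integral>x. v x * frechet_derivative \<phi> (at x) i \<partial>lebesgue_on \<Omega>) = (\<integral>x. G i x * \<phi> x \<partial>lebesgue_on \<Omega>))" ..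
  then have G: "\<And>i. i \<in> Basis \<Longrightarrow> G i \<in> L2 (lebesgue_on \<Omega>)"
    "\<And>i \<phi>. i \<in> Basis \<Longrightarrow> \<phi> \<in> test_functions \<Omega> \<Longrightarrow>
      - (\<integral>x. v x * frechet_derivative \<phi> (at x) i \<partial>lebesgue_on \<Omega>) = (\<integral>x. G i x * \<phi> x \<partial>lebesgue_on \<Omega>)"
    by blast+
  let ?G = "\<lambda>x. \<Sum>i\<in>Basis. G i x *\<^sub>R i"
  have Gi: "?G x \<bullet> i = G i x" if "i \<in> Basis" for x i
    using that by (simp add: inner_sum_left inner_Basis if_distrib cong: if_cong)
  have "(\<lambda>x. \<Sum>i\<in>A. G i x *\<^sub>R i) \<in> L2 (lebesgue_on \<Omega>)" if "finite A" "A \<subseteq> Basis" for A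
    using that
  proof (induction A rule: finite_induct)
    case (insert i A)
    have "(\<lambda>x. G i x *\<^sub>R i) \<in> L2 (lebesgue_on \<Omega>)"
      using G(1)[of i] insert.prems by (intro L2_dominated[OF _ G(1)[of i]]) (auto simp: L2_def)
    then show ?case using insert by (auto intro: L2_add)
  qed simp
  then have "?G \<in> L2 (lebesgue_on \<Omega>)" by simp
  moreover have "has_weak_gradient \<Omega> v ?G"
    unfolding has_weak_gradient_def
  proof (intro ballI)
    fix \<phi> and i :: 'a assume *: "\<phi> \<in> test_functions \<Omega>" "i \<in> Basis"
    show "(\<integral>x. v x * frechet_derivative \<phi> (at x) i \<partial>lebesgue_on \<Omega>) = - (\<integral>x. (?G x \<bullet> i) * \<phi> x \<partial>lebesgue_on \<Omega>)"
      unfolding Gi[OF *(2)] using G(2)[OF *(2,1)] by linarith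
  qed
  ultimately have "H1_pair \<Omega> v ?G" using vL by (simp add: H1_pair_def)
  then have "H1_pair \<Omega> (\<lambda>x. max (w x) 0) ?G"
  proof (rule H1_pair_cong_AE[OF _ _ _ \<Omega>m])
    show "AE x in lebesgue_on \<Omega>. v x = max (w x) 0" using ae by eventually_elim (simp add: v_def)
    show "(\<lambda>x. max (w x) 0) \<in> borel_measurable (lebesgue_on \<Omega>)" using wm by measurable
  qed
  then show ?thesis using H1_iff by blast
qed

section \<open>Local compactness\<close>

text \<open>The variance identity, from expanding the square in the inner integral and then
  integrating once more.\<close>

lemma nn_integral_difference_square:
  fixes f :: "'a \<Rightarrow> real"
  assumes f: "f \<in> L2 M" and fin: "emeasure M (space M) < \<infinity>"
  shows "(\<integral>\<^sup>+x. (\<integral>\<^sup>+y. ennreal ((f x - f y)\<^sup>2) \<partial>M) \<partial>M)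
    = ennreal (2 * measure M (space M) * sqnorm M f - 2 * (\<integral>x. f x \<partial>M)\<^sup>2)"
proof -
  interpret finite_measure M using fin by (intro finite_measureI) auto
  let ?\<mu> = "measure M (space M)" and ?I = "\<integral>x. f x \<partial>M" and ?S = "sqnorm M f"
  have one: "(\<lambda>x. 1::real) \<in> L2 M"
    using fin by (simp add: L2_def L2_norm_sq_def)
  have fi: "integrable M f" using L2_integrable_mult[OF f one] by simp
  have f2: "integrable M (\<lambda>x. (f x)\<^sup>2)" using L2_integrable_sq[OF f] by simp
  have S: "?S = (\<integral>x. (f x)\<^sup>2 \<partial>M)" by (simp add: sqnorm_def)
  have inner: "(\<integral>\<^sup>+y. ennreal ((f x - f y)\<^sup>2) \<partial>M) = ennreal (?\<mu> * (f x)\<^sup>2 - 2 * f x * ?I + ?S)" for x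
  proof -
    have eq: "(\<lambda>y. (f x - f y)\<^sup>2) = (\<lambda>y. (f x)\<^sup>2 - 2 * f x * f y + (f y)\<^sup>2)"
      by (auto simp: power2_diff)
    have int: "integrable M (\<lambda>y. (f x - f y)\<^sup>2)"
      unfolding eq using fi f2 by simp
    have "(\<integral>y. (f x - f y)\<^sup>2 \<partial>M) = ?\<mu> * (f x)\<^sup>2 - 2 * f x * ?I + ?S"
      unfolding eq S using fi f2 by simp
    then show ?thesis using nn_integral_eq_integral[OF int] by simp
  qed
  have nonneg: "0 \<le> ?\<mu> * (f x)\<^sup>2 - 2 * f x * ?I + ?S" for x
  proof -
    have "?\<mu> * (f x)\<^sup>2 - 2 * f x * ?I + ?S = (\<integral>y. (f x - f y)\<^sup>2 \<partial>M)"
      unfolding S power2_diff using fi f2 by simp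
    then show ?thesis by simp
  qed
  have int: "integrable M (\<lambda>x. ?\<mu> * (f x)\<^sup>2 - 2 * f x * ?I + ?S)"
    using fi f2 by simp
  have "(\<integral>x. ?\<mu> * (f x)\<^sup>2 - 2 * f x * ?I + ?S \<partial>M) = 2 * ?\<mu> * ?S - 2 * ?I\<^sup>2"
  proof -
    have "(\<integral>x. ?\<mu> * (f x)\<^sup>2 - 2 * f x * ?I + ?S \<partial>M)
        = (\<integral>x. ?\<mu> * (f x)\<^sup>2 \<partial>M) - (\<integral>x. 2 * f x * ?I \<partial>M) + (\<integral>x. ?S \<partial>M)"
      using fi f2 by (subst Bochner_Integration.integral_add) auto
    also have "\<dots> = 2 * ?\<mu> * ?S - 2 * ?I\<^sup>2"
      by (simp add: S power2_eq_square)
    finally show ?thesis .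
  qed
  then show ?thesis
    unfolding inner using nn_integral_eq_integral[OF int] nonneg by simp
qed

text \<open>With mass m, second moment S and integral I over the cell, the double integral is D =
  2mS - 2I^2. Hence mS = D/2 + I^2 is at most D + I^2, and m is at least 1/K. By Cauchy-Schwarz I^2
  is at most mS, which keeps the real expressions nonnegative on the way to
  \<open>ennreal\<close>.\<close>

lemma cell_estimate:
  fixes f :: "'a::euclidean_space \<Rightarrow> real"
  assumes fm [measurable]: "f \<in> borel_measurable borel"
    and f2: "(\<integral>\<^sup>+x. ennreal ((f x)\<^sup>2) \<partial>lborel) < \<infinity>"
    and C [measurable]: "C \<in> sets borel" and fin: "emeasure lborel C < \<infinity>"
    and K: "0 < K" "ennreal (1 / K) \<le> emeasure lborel C"
  shows "(\<integral>\<^sup>+x\<in>C. ennreal ((f x)\<^sup>2) \<partial>lborel)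
    \<le> ennreal K * ((\<integral>\<^sup>+x\<in>C. (\<integral>\<^sup>+y\<in>C. ennreal ((f x - f y)\<^sup>2) \<partial>lborel) \<partial>lborel)
      + ennreal ((\<integral>x. indicator C x * f x \<partial>lborel)\<^sup>2))"
proof -
  let ?M = "restrict_space lborel C"
  have C': "C \<inter> space lborel \<in> sets lborel" by simp
  have eqn: "(\<integral>\<^sup>+x. g x \<partial>?M) = (\<integral>\<^sup>+x\<in>C. g x \<partial>lborel)" for g :: "'a \<Rightarrow> ennreal"
    by (rule nn_integral_restrict_space[OF C'])
  have spaceM: "emeasure ?M (space ?M) = emeasure lborel C"
    by (simp add: emeasure_restrict_space space_restrict_space)
  have nn: "L2_norm_sq ?M f = (\<integral>\<^sup>+x\<in>C. ennreal ((f x)\<^sup>2) \<partial>lborel)"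
    unfolding L2_norm_sq_def eqn by simp
  have fL: "f \<in> L2 ?M"
  proof -
    have "L2_norm_sq ?M f \<le> (\<integral>\<^sup>+x. ennreal ((f x)\<^sup>2) \<partial>lborel)"
      unfolding nn by (intro nn_integral_mono) (auto simp: indicator_def)
    then show ?thesis using f2 by (auto simp: L2_def measurable_restrict_space1 intro: le_less_trans)
  qed
  let ?\<mu> = "measure ?M (space ?M)" and ?I = "\<integral>x. f x \<partial>?M" and ?S = "sqnorm ?M f"
  have "emeasure ?M (space ?M) = ennreal ?\<mu>"
    by (rule emeasure_eq_ennreal_measure) (use fin spaceM in auto)
  then have \<mu>: "emeasure lborel C = ennreal ?\<mu>"
    by (simp only: spaceM)
  then have K\<mu>: "1 \<le> K * ?\<mu>"
    using K by (simp add: ennreal_le_iff divide_le_eq mult.commute)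
  have id: "(\<integral>\<^sup>+x\<in>C. (\<integral>\<^sup>+y\<in>C. ennreal ((f x - f y)\<^sup>2) \<partial>lborel) \<partial>lborel) = ennreal (2 * ?\<mu> * ?S - 2 * ?I\<^sup>2)"
    using nn_integral_difference_square[OF fL] fin spaceM by (simp add: eqn)
  have I: "(\<integral>x. indicator C x * f x \<partial>lborel) = ?I"
    by (simp add: integral_restrict_space[OF C'])
  have nonneg: "?I\<^sup>2 \<le> ?\<mu> * ?S"
  proof -
    have one: "(\<lambda>x. 1::real) \<in> L2 ?M" using fin spaceM by (simp add: L2_def L2_norm_sq_def)
    have "sqnorm ?M (\<lambda>x. 1::real) = ?\<mu>" by (simp add: sqnorm_def)
    then show ?thesis using L2_Cauchy_Schwarz[OF fL one] by (simp add: mult.commute)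
  qed
  have "?S \<le> K * ?\<mu> * ?S"
    using K\<mu> mult_right_mono[of 1 "K * ?\<mu>" ?S] by simp
  also have "\<dots> \<le> K * ((2 * ?\<mu> * ?S - 2 * ?I\<^sup>2) + ?I\<^sup>2)"
  proof -
    have "?\<mu> * ?S \<le> (2 * ?\<mu> * ?S - 2 * ?I\<^sup>2) + ?I\<^sup>2" using nonneg by linarith
    then show ?thesis using K(1) by (simp only: mult.assoc) (intro mult_left_mono, auto)
  qed
  finally have "ennreal ?S \<le> ennreal (K * ((2 * ?\<mu> * ?S - 2 * ?I\<^sup>2) + ?I\<^sup>2))" by (rule ennreal_leI)
  also have "\<dots> = ennreal K * (ennreal (2 * ?\<mu> * ?S - 2 * ?I\<^sup>2) + ennreal (?I\<^sup>2))"
  proof -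
    have "0 \<le> 2 * ?\<mu> * ?S - 2 * ?I\<^sup>2" "?I\<^sup>2 \<le> 2 * ?\<mu> * ?S"
      using nonneg zero_le_power2[of ?I] by linarith+
    then show ?thesis using K(1)
      by (subst ennreal_mult) (simp_all add: ennreal_plus[symmetric] del: ennreal_plus)
  qed
  finally show ?thesis
    unfolding id I using nn L2_norm_sq_eq[OF fL] by simp
qed

section \<open>Lattice cells and interior sets\<close>

text \<open>For positive \<open>k\<close> this is, up to the factor k, the lower corner of the
  half-open lattice cube of side 1/k containing x. It labels that cube, and the cubes are its
  fibres.\<close>

definition lattice_floor :: "nat \<Rightarrow> 'a::euclidean_space \<Rightarrow> 'a" where
  "lattice_floor k x = (\<Sum>i\<in>Basis. of_int \<lfloor>real k * (x \<bullet> i)\<rfloor> *\<^sub>R i)"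

lemma lattice_floor_inner: "i \<in> Basis \<Longrightarrow> lattice_floor k x \<bullet> i = of_int \<lfloor>real k * (x \<bullet> i)\<rfloor>"
  by (simp add: lattice_floor_def inner_sum_left inner_Basis if_distrib cong: if_cong)

lemma lattice_floor_measurable [measurable]: "lattice_floor k \<in> borel_measurable borel"
  unfolding lattice_floor_def[abs_def] by measurable

lemma lattice_floor_eq:
  "lattice_floor k x = lattice_floor k y \<longleftrightarrow> (\<forall>i\<in>Basis. \<lfloor>real k * (x \<bullet> i)\<rfloor> = \<lfloor>real k * (y \<bullet> i)\<rfloor>)"
  by (subst euclidean_eq_iff) (simp add: lattice_floor_inner)

lemma lattice_floor_close:
  fixes x y :: "'a::euclidean_space"
  assumes "lattice_floor k x = lattice_floor k y" "0 < k" "i \<in> Basis"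
  shows "\<bar>x \<bullet> i - y \<bullet> i\<bar> < 1 / real k"
proof -
  have "\<lfloor>real k * (x \<bullet> i)\<rfloor> = \<lfloor>real k * (y \<bullet> i)\<rfloor>"
    using assms by (simp add: lattice_floor_eq)
  then have "\<bar>real k * (x \<bullet> i) - real k * (y \<bullet> i)\<bar> < 1" by linarith
  also have "real k * (x \<bullet> i) - real k * (y \<bullet> i) = real k * (x \<bullet> i - y \<bullet> i)" by (simp add: algebra_simps)
  finally have "real k * \<bar>x \<bullet> i - y \<bullet> i\<bar> < 1" by (simp only: abs_mult abs_of_nat)
  then show ?thesis using assms(2) by (simp add: pos_less_divide_eq mult.commute)
qed

lemma finite_lattice_floor_image:
  fixes A :: "'a::euclidean_space set"
  assumes "bounded A"
  shows "finite (lattice_floor k ` A)"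
proof -
  obtain R where R: "\<And>x. x \<in> A \<Longrightarrow> norm x \<le> R" using assms by (auto simp: bounded_iff)
  let ?P = "PiE (Basis::'a set) (\<lambda>_. {- \<lceil>real k * R\<rceil> - 1 .. \<lceil>real k * R\<rceil> + 1})"
  have "lattice_floor k ` A \<subseteq> (\<lambda>a. \<Sum>i\<in>Basis. of_int (a i) *\<^sub>R i) ` ?P"
  proof
    fix c assume "c \<in> lattice_floor k ` A"
    then obtain x where x: "x \<in> A" "c = lattice_floor k x" by auto
    let ?a = "restrict (\<lambda>i. \<lfloor>real k * (x \<bullet> i)\<rfloor>) Basis"
    have "?a \<in> ?P"
    proof (intro restrict_PiE_iff[THEN iffD2] ballI)
      fix i :: 'a assume "i \<in> Basis"
      then have "\<bar>x \<bullet> i\<bar> \<le> R" using R[OF x(1)] Basis_le_norm[of i x] by linarith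
      then have "\<bar>real k * (x \<bullet> i)\<bar> \<le> real k * R" by (simp add: abs_mult mult_left_mono)
      then show "\<lfloor>real k * (x \<bullet> i)\<rfloor> \<in> {- \<lceil>real k * R\<rceil> - 1 .. \<lceil>real k * R\<rceil> + 1}"
        by (simp add: abs_le_iff) linarith
    qed
    moreover have "c = (\<Sum>i\<in>Basis. of_int (?a i) *\<^sub>R i)"
      unfolding x(2) lattice_floor_def by (intro sum.cong) auto
    ultimately show "c \<in> (\<lambda>a. \<Sum>i\<in>Basis. of_int (a i) *\<^sub>R i) ` ?P" by blast
  qed
  then show ?thesis by (rule finite_subset) (intro finite_imageI finite_PiE, auto)
qed

text \<open>An open cube inside the cell and a bounded box around it suffice, so the volume of the
  half-open cell is never computed. These are the bounds that \<open>cell_estimate\<close> asks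
  for.\<close>

lemma emeasure_lattice_cell:
  fixes x :: "'a::euclidean_space"
  assumes "0 < k"
  shows "ennreal (1 / real k ^ DIM('a)) \<le> emeasure lborel (lattice_floor k -` {lattice_floor k x})"
    and "emeasure lborel (lattice_floor k -` {lattice_floor k x}) < \<infinity>"
proof -
  let ?a = "(1 / real k) *\<^sub>R lattice_floor k x"
  let ?b = "?a + (1 / real k) *\<^sub>R One"
  have "ennreal (1 / real k ^ DIM('a)) = emeasure lborel (box ?a ?b)"
    using assms by (subst emeasure_lborel_box_eq) (simp add: inner_add_left power_one_over[symmetric])
  also have "\<dots> \<le> emeasure lborel (lattice_floor k -` {lattice_floor k x})"
  proof (rule emeasure_mono)
    show "lattice_floor k -` {lattice_floor k x} \<in> sets lborel"
      using measurable_sets[OF lattice_floor_measurable, of "{lattice_floor k x}" k] by simp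
    show "box ?a ?b \<subseteq> lattice_floor k -` {lattice_floor k x}"
    proof
      fix y assume y: "y \<in> box ?a ?b"
      have "\<lfloor>real k * (y \<bullet> i)\<rfloor> = \<lfloor>real k * (x \<bullet> i)\<rfloor>" if "i \<in> Basis" for i
      proof -
        have "of_int \<lfloor>real k * (x \<bullet> i)\<rfloor> < real k * (y \<bullet> i)" "real k * (y \<bullet> i) < of_int \<lfloor>real k * (x \<bullet> i)\<rfloor> + 1"
          using y that assms by (auto simp: mem_box lattice_floor_inner inner_add_left field_simps)
        then show ?thesis by (simp add: floor_eq_iff)
      qed
      then show "y \<in> lattice_floor k -` {lattice_floor k x}" by (simp add: lattice_floor_eq)
    qed
  qed
  finally show "ennreal (1 / real k ^ DIM('a)) \<le> emeasure lborel (lattice_floor k -` {lattice_floor k x})" .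
  have "bounded (lattice_floor k -` {lattice_floor k x})"
  proof (rule bounded_subset[OF bounded_cbox])
    show "lattice_floor k -` {lattice_floor k x} \<subseteq> cbox (x - One) (x + One)"
    proof
      fix y assume "y \<in> lattice_floor k -` {lattice_floor k x}"
      then have "\<bar>y \<bullet> i - x \<bullet> i\<bar> < 1 / real k" if "i \<in> Basis" for i
        using lattice_floor_close[of k y x i] assms that by simp
      moreover have "1 / real k \<le> 1" using assms by simp
      ultimately show "y \<in> cbox (x - One) (x + One)"
        by (force simp: mem_box inner_diff_left inner_add_left abs_le_iff)
    qed
  qed
  then show "emeasure lborel (lattice_floor k -` {lattice_floor k x}) < \<infinity>"
    by (rule emeasure_bounded_finite)
qed

definition inner_set :: "'a::euclidean_space set \<Rightarrow> real \<Rightarrow> 'a set" where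
  "inner_set \<Omega> \<delta> = {x. \<delta> < infdist x (- \<Omega>)}"

lemma open_inner_set: "open (inner_set \<Omega> \<delta>)"
  unfolding inner_set_def by (intro open_Collect_less continuous_intros)

lemma inner_set_shift:
  assumes "x \<in> inner_set \<Omega> \<delta>" "dist x y \<le> \<delta>"
  shows "y \<in> \<Omega>"
proof (rule ccontr)
  assume "y \<notin> \<Omega>"
  then have "infdist x (- \<Omega>) \<le> dist x y" by (intro infdist_le) simp
  then show False using assms by (simp add: inner_set_def)
qed

lemma inner_set_shift_inner:
  assumes "x \<in> inner_set \<Omega> (2 * \<delta>)" "dist x y \<le> \<delta>"
  shows "y \<in> inner_set \<Omega> \<delta>"
  using assms infdist_triangle[of x "- \<Omega>" y] by (simp add: inner_set_def)

lemma Union_inner_set: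
  assumes "open \<Omega>" "bounded \<Omega>" "X \<longlonglongrightarrow> 0"
  shows "\<Omega> \<subseteq> (\<Union>j::nat. inner_set \<Omega> (X j))"
proof
  fix x assume x: "x \<in> \<Omega>"
  \<comment> \<open>The complement must be nonempty, since \<open>infdist\<close> to the empty set
    is 0 by convention.\<close>
  have "\<Omega> \<noteq> UNIV" using assms(2) not_bounded_UNIV by auto
  then have "- \<Omega> \<noteq> {}" by blast
  moreover have "closed (- \<Omega>)" using assms(1) by (simp add: closed_Compl)
  ultimately have "0 < infdist x (- \<Omega>)"
    using x infdist_pos_not_in_closed[of "- \<Omega>" x] by simp
  from order_tendstoD(2)[OF assms(3) this] obtain j where "X j < infdist x (- \<Omega>)"
    by (auto simp: eventually_sequentially)
  then show "x \<in> (\<Union>j. inner_set \<Omega> (X j))" by (auto simp: inner_set_def)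
qed

text \<open>On a cell, the mean and the double integral of squared differences control the \<open>L\<^sup>2\<close> norm.
  Summed over all cells, the double integrals are at most an integral over short translations.\<close>

lemma lattice_estimate:
  fixes f :: "'a::euclidean_space \<Rightarrow> real"
  assumes f: "f \<in> borel_measurable borel" "\<And>x. x \<notin> \<Omega> \<Longrightarrow> f x = 0" and p: "H1_pair \<Omega> f g"
    and \<Omega>: "open \<Omega>" "bounded \<Omega>"
    and k: "0 < k" "real DIM('a) / real k \<le> \<delta>"
  shows "(\<integral>\<^sup>+x\<in>inner_set \<Omega> (2 * \<delta>). ennreal ((f x)\<^sup>2) \<partial>lborel)
    \<le> ennreal (2 ^ DIM('a) * (real DIM('a) / real k)\<^sup>2 * sqnorm (lebesgue_on \<Omega>) g)
      + ennreal (real k ^ DIM('a) * (\<Sum>c\<in>lattice_floor k ` \<Omega>. (\<integral>x. indicator (lattice_floor k -` {c}) x * f x \<partial>lborel)\<^sup>2))"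
proof -
  note [measurable] = f(1)
  let ?N = "DIM('a)" and ?A = "inner_set \<Omega> (2 * \<delta>)" and ?U = "inner_set \<Omega> \<delta>"
  let ?q = "lattice_floor k :: 'a \<Rightarrow> 'a"
  define I where "I = ?q ` ?A"
  define Q where "Q c = ?q -` {c}" for c
  have Qm [measurable]: "Q c \<in> sets borel" for c
    unfolding Q_def using measurable_sets[OF lattice_floor_measurable, of "{c}" k] by simp
  have Um [measurable]: "?U \<in> sets borel" "?A \<in> sets borel" by (auto intro!: borel_open open_inner_set)
  have \<delta>: "0 \<le> \<delta>" using k by (meson divide_nonneg_nonneg of_nat_0_le_iff order_trans)
  have A\<Omega>: "?A \<subseteq> \<Omega>" using inner_set_shift[of _ \<Omega> "2 * \<delta>"] \<delta> by (metis dist_self mult_nonneg_nonneg subsetI zero_le_numeral)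
  have finI: "finite I" unfolding I_def by (intro finite_lattice_floor_image bounded_subset[OF \<Omega>(2) A\<Omega>])
  have close: "dist x y \<le> real ?N / real k" if "\<And>i. i \<in> Basis \<Longrightarrow> \<bar>x \<bullet> i - y \<bullet> i\<bar> \<le> 1 / real k" for x y :: 'a
  proof -
    have "dist x y \<le> (\<Sum>i\<in>Basis. \<bar>(x - y) \<bullet> i\<bar>)" unfolding dist_norm by (rule norm_le_l1)
    also have "\<dots> \<le> (\<Sum>i\<in>(Basis::'a set). 1 / real k)" using that by (intro sum_mono) (simp add: inner_diff_left)
    finally show ?thesis by simp
  qed
  \<comment> \<open>The reason for the 2 in \<open>2 * \<delta>\<close>: a cell has diameter at most
    N/k, hence at most \<open>\<delta>\<close>, so a cell that meets \<open>?A\<close> stays in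
    \<open>?U\<close>, and from there a shift of length \<open>\<delta>\<close> remains in
    \<open>\<Omega>\<close>.\<close>
  have QU: "Q c \<subseteq> ?U" if c: "c \<in> I" for c
  proof
    fix y assume "y \<in> Q c"
    then obtain x where x: "x \<in> ?A" "?q x = ?q y" using c by (auto simp: I_def Q_def)
    have "dist x y \<le> real ?N / real k"
      using lattice_floor_close[OF x(2) k(1)] by (intro close) (simp add: less_imp_le)
    then show "y \<in> ?U" using inner_set_shift_inner[OF x(1)] k(2) by simp
  qed
  have f2: "(\<integral>\<^sup>+x. ennreal ((f x)\<^sup>2) \<partial>lborel) < \<infinity>"
    using p L2_norm_sq_lebesgue_on_lborel[of \<Omega> f] f(2) \<Omega> by (simp add: H1_pair_def L2_def)
  \<comment> \<open>Two points of one cell differ by a vector of this open cube. Its volume (2/k)^N,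
    multiplied by the k^N of the cell estimate, leaves the factor 2^N of the statement.\<close>
  let ?B = "box (- ((1 / real k) *\<^sub>R One)) ((1 / real k) *\<^sub>R One) :: 'a set"
  have emB: "emeasure lborel ?B = ennreal ((2 / real k) ^ ?N)"
  proof -
    have "(\<Prod>b\<in>Basis. ((1 / real k) *\<^sub>R (One :: 'a) - - ((1 / real k) *\<^sub>R One)) \<bullet> b)
        = (\<Prod>b\<in>(Basis :: 'a set). 2 / real k)"
      by (intro prod.cong) (auto simp: inner_add_left)
    then show ?thesis using k(1) by (simp add: emeasure_lborel_box_eq)
  qed
  have shift: "(\<integral>\<^sup>+y. ennreal ((f x - f y)\<^sup>2) * indicator ?B (y - x) \<partial>lborel)
      = (\<integral>\<^sup>+z. ennreal ((f (x + z) - f x)\<^sup>2) * indicator ?B z \<partial>lborel)" for x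
  proof -
    have "(\<integral>\<^sup>+y. ennreal ((f x - f y)\<^sup>2) * indicator ?B (y - x) \<partial>lborel)
       = (\<integral>\<^sup>+z. ennreal ((f x - f (z + x))\<^sup>2) * indicator ?B (z + x - x) \<partial>lborel)"
      by (rule nn_integral_lborel_translate[symmetric, of "\<lambda>y. ennreal ((f x - f y)\<^sup>2) * indicator ?B (y - x)" x]) measurable
    then show ?thesis by (simp add: add.commute power2_commute)
  qed
  have "(\<Sum>c\<in>I. \<integral>\<^sup>+x\<in>Q c. (\<integral>\<^sup>+y\<in>Q c. ennreal ((f x - f y)\<^sup>2) \<partial>lborel) \<partial>lborel)
      = (\<integral>\<^sup>+x. (\<Sum>c\<in>I. (\<integral>\<^sup>+y\<in>Q c. ennreal ((f x - f y)\<^sup>2) \<partial>lborel) * indicator (Q c) x) \<partial>lborel)"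
    by (rule nn_integral_sum[symmetric]) measurable
  \<comment> \<open>For each x only the cell of x contributes, so summing over the cells costs no
    factor.\<close>
  also have "\<dots> \<le> (\<integral>\<^sup>+x. (\<integral>\<^sup>+y. ennreal ((f x - f y)\<^sup>2) * indicator ?B (y - x) \<partial>lborel) * indicator ?U x \<partial>lborel)"
  proof (intro nn_integral_mono)
    fix x
    show "(\<Sum>c\<in>I. (\<integral>\<^sup>+y\<in>Q c. ennreal ((f x - f y)\<^sup>2) \<partial>lborel) * indicator (Q c) x)
       \<le> (\<integral>\<^sup>+y. ennreal ((f x - f y)\<^sup>2) * indicator ?B (y - x) \<partial>lborel) * indicator ?U x"
    proof (cases "?q x \<in> I")
      case True
      then have xU: "x \<in> ?U" using QU[of "?q x"] by (auto simp: Q_def)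
      have "(\<Sum>c\<in>I. (\<integral>\<^sup>+y\<in>Q c. ennreal ((f x - f y)\<^sup>2) \<partial>lborel) * indicator (Q c) x)
          = (\<Sum>c\<in>I. if c = ?q x then (\<integral>\<^sup>+y\<in>Q c. ennreal ((f x - f y)\<^sup>2) \<partial>lborel) else 0)"
        by (intro sum.cong) (auto simp: Q_def indicator_def)
      also have "\<dots> = (\<integral>\<^sup>+y\<in>Q (?q x). ennreal ((f x - f y)\<^sup>2) \<partial>lborel)"
        using True finI by simp
      also have "\<dots> \<le> (\<integral>\<^sup>+y. ennreal ((f x - f y)\<^sup>2) * indicator ?B (y - x) \<partial>lborel)"
      proof (intro nn_integral_mono mult_left_mono)
        fix y
        have "y - x \<in> ?B" if "y \<in> Q (?q x)"
          using lattice_floor_close[of k y x] k(1) that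
          by (force simp: Q_def mem_box inner_diff_left abs_less_iff)
        then show "indicator (Q (?q x)) y \<le> (indicator ?B (y - x) :: ennreal)"
          by (auto simp: indicator_def)
      qed simp
      finally show ?thesis using xU by simp
    next
      case False
      then have "(\<Sum>c\<in>I. (\<integral>\<^sup>+y\<in>Q c. ennreal ((f x - f y)\<^sup>2) \<partial>lborel) * indicator (Q c) x) = 0"
        by (intro sum.neutral) (auto simp: Q_def indicator_def)
      then show ?thesis by simp
    qed
  qed
  also have "\<dots> = (\<integral>\<^sup>+x. (\<integral>\<^sup>+z. ennreal ((f (x + z) - f x)\<^sup>2) * indicator ?B z * indicator ?U x \<partial>lborel) \<partial>lborel)"
    unfolding shift by (intro nn_integral_cong nn_integral_multc[symmetric]) measurable
  \<comment> \<open>With the shift z outermost, the inner integral is a translation difference over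
    \<open>?U\<close>, and \<open>difference_quotient_bound\<close> applies for each fixed
    z.\<close>
  also have "\<dots> = (\<integral>\<^sup>+z. (\<integral>\<^sup>+x. ennreal ((f (x + z) - f x)\<^sup>2) * indicator ?B z * indicator ?U x \<partial>lborel) \<partial>lborel)"
    by (rule lborel_pair.Fubini'[symmetric]) measurable
  also have "\<dots> \<le> (\<integral>\<^sup>+z. ennreal ((real ?N / real k)\<^sup>2 * sqnorm (lebesgue_on \<Omega>) g) * indicator ?B z \<partial>lborel)"
  proof (intro nn_integral_mono)
    fix z
    show "(\<integral>\<^sup>+x. ennreal ((f (x + z) - f x)\<^sup>2) * indicator ?B z * indicator ?U x \<partial>lborel)
       \<le> ennreal ((real ?N / real k)\<^sup>2 * sqnorm (lebesgue_on \<Omega>) g) * indicator ?B z"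
    proof (cases "z \<in> ?B")
      case True
      have nz: "norm z \<le> real ?N / real k"
        using close[of z 0] True by (force simp: mem_box abs_le_iff)
      have "(\<integral>\<^sup>+x. ennreal ((f (x + z) - f x)\<^sup>2) * indicator ?B z * indicator ?U x \<partial>lborel)
          = L2_norm_sq (lebesgue_on ?U) (\<lambda>x. f (x + z) - f x)"
        using True by (subst L2_norm_sq_lebesgue_on) (auto simp: open_inner_set)
      also have "\<dots> \<le> ennreal ((norm z)\<^sup>2 * sqnorm (lebesgue_on \<Omega>) g)"
      proof (rule difference_quotient_bound[OF f p \<Omega> open_inner_set])
        fix x s assume "x \<in> ?U" "0 \<le> s" "s \<le> (1::real)"
        moreover have "dist x (x + s *\<^sub>R z) \<le> \<delta>"
          using nz k(2) \<open>0 \<le> s\<close> \<open>s \<le> 1\<close> mult_left_le_one_le[of "norm z" s] by (simp add: dist_norm)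
        ultimately show "x + s *\<^sub>R z \<in> \<Omega>" by (auto intro: inner_set_shift)
      qed
      also have "\<dots> \<le> ennreal ((real ?N / real k)\<^sup>2 * sqnorm (lebesgue_on \<Omega>) g)"
        using nz by (intro ennreal_leI mult_right_mono power_mono) auto
      finally show ?thesis using True by simp
    qed simp
  qed
  also have "\<dots> = ennreal ((real ?N / real k)\<^sup>2 * sqnorm (lebesgue_on \<Omega>) g) * ennreal ((2 / real k) ^ ?N)"
    by (subst nn_integral_cmult_indicator) (auto simp: emB)
  finally have DD: "(\<Sum>c\<in>I. \<integral>\<^sup>+x\<in>Q c. (\<integral>\<^sup>+y\<in>Q c. ennreal ((f x - f y)\<^sup>2) \<partial>lborel) \<partial>lborel)
     \<le> ennreal ((real ?N / real k)\<^sup>2 * sqnorm (lebesgue_on \<Omega>) g * (2 / real k) ^ ?N)"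
    by (simp add: ennreal_mult)
  let ?D = "\<lambda>c. \<integral>\<^sup>+x\<in>Q c. (\<integral>\<^sup>+y\<in>Q c. ennreal ((f x - f y)\<^sup>2) \<partial>lborel) \<partial>lborel"
  let ?a = "\<lambda>c. \<integral>x. indicator (Q c) x * f x \<partial>lborel"
  have "(\<integral>\<^sup>+x\<in>?A. ennreal ((f x)\<^sup>2) \<partial>lborel) \<le> (\<integral>\<^sup>+x. (\<Sum>c\<in>I. ennreal ((f x)\<^sup>2) * indicator (Q c) x) \<partial>lborel)"
  proof (intro nn_integral_mono)
    fix x
    show "ennreal ((f x)\<^sup>2) * indicator ?A x \<le> (\<Sum>c\<in>I. ennreal ((f x)\<^sup>2) * indicator (Q c) x)"
    proof (cases "x \<in> ?A")
      case True
      then have "?q x \<in> I" by (simp add: I_def)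
      then have "ennreal ((f x)\<^sup>2) * indicator (Q (?q x)) x \<le> (\<Sum>c\<in>I. ennreal ((f x)\<^sup>2) * indicator (Q c) x)"
        by (intro member_le_sum finI) auto
      then show ?thesis using True by (simp add: Q_def)
    qed simp
  qed
  also have "\<dots> = (\<Sum>c\<in>I. \<integral>\<^sup>+x\<in>Q c. ennreal ((f x)\<^sup>2) \<partial>lborel)"
    by (rule nn_integral_sum) measurable
  also have "\<dots> \<le> (\<Sum>c\<in>I. ennreal (real k ^ ?N) * (?D c + ennreal ((?a c)\<^sup>2)))"
  proof (intro sum_mono cell_estimate f f2 Qm)
    fix c assume "c \<in> I"
    then obtain x where x: "c = ?q x" by (auto simp: I_def)
    show "emeasure lborel (Q c) < \<infinity>" "ennreal (1 / real k ^ ?N) \<le> emeasure lborel (Q c)"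
      unfolding Q_def x by (rule emeasure_lattice_cell[OF k(1)])+
    show "0 < real k ^ ?N" using k(1) by simp
  qed
  also have "\<dots> = ennreal (real k ^ ?N) * (\<Sum>c\<in>I. ?D c) + ennreal (real k ^ ?N) * ennreal (\<Sum>c\<in>I. (?a c)\<^sup>2)"
    by (simp add: sum_distrib_left[symmetric] sum.distrib distrib_left sum_ennreal)
  \<comment> \<open>The cell integrals are summed over all cells meeting \<open>\<Omega>\<close>, an
    index set that no longer depends on \<open>\<delta>\<close>.\<close>
  also have "\<dots> \<le> ennreal (real k ^ ?N) * ennreal ((real ?N / real k)\<^sup>2 * sqnorm (lebesgue_on \<Omega>) g * (2 / real k) ^ ?N)
      + ennreal (real k ^ ?N) * ennreal (\<Sum>c\<in>?q ` \<Omega>. (?a c)\<^sup>2)"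
  proof (intro add_mono mult_left_mono DD ennreal_leI sum_mono2)
    show "finite (?q ` \<Omega>)" by (intro finite_lattice_floor_image \<Omega>)
    show "I \<subseteq> ?q ` \<Omega>" unfolding I_def using A\<Omega> by auto
  qed auto
  also have "\<dots> = ennreal (2 ^ ?N * (real ?N / real k)\<^sup>2 * sqnorm (lebesgue_on \<Omega>) g)
      + ennreal (real k ^ ?N * (\<Sum>c\<in>?q ` \<Omega>. (?a c)\<^sup>2))"
    using k(1) by (simp add: ennreal_mult[symmetric] sum_nonneg power_divide mult_ac)
  finally show ?thesis by (simp add: Q_def)
qed

text \<open>The integrals over the cells of all lattices form countably many bounded sequences, so
  one subsequence makes them all converge. On a fixed interior set the lattice estimate bounds the
  difference of two terms: its gradient part is small once the mesh is fine, uniformly in the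
  indices, and for that mesh the part with the cell integrals is small for large indices. The
  subsequence is therefore Cauchy in L2 on each interior set.\<close>

lemma Rellich_AE:
  fixes f :: "nat \<Rightarrow> 'a::euclidean_space \<Rightarrow> real"
  assumes f: "\<And>n. f n \<in> borel_measurable borel" "\<And>n x. x \<notin> \<Omega> \<Longrightarrow> f n x = 0"
    and p: "\<And>n. H1_pair \<Omega> (f n) (g n)"
    and \<Omega>: "open \<Omega>" "bounded \<Omega>"
    and M: "\<And>n. sqnorm (lebesgue_on \<Omega>) (f n) \<le> M" "\<And>n. sqnorm (lebesgue_on \<Omega>) (g n) \<le> M"
  shows "\<exists>r l. strict_mono r \<and> l \<in> borel_measurable borel \<and>
    (AE x in lborel. x \<in> \<Omega> \<longrightarrow> (\<lambda>n. f (r n) x) \<longlonglongrightarrow> l x)"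
proof -
  note [measurable] = f(1)
  have \<Omega>m: "\<Omega> \<in> sets lebesgue" using \<Omega> by auto
  have L: "f n \<in> L2 (lebesgue_on \<Omega>)" "g n \<in> L2 (lebesgue_on \<Omega>)" for n using p by (auto simp: H1_pair_def)
  have fi: "integrable lborel (f n)" for n by (rule integrable_lborel_of_L2[OF f L(1) \<Omega>])
  let ?N = "DIM('a)"
  define Q where "Q k c = lattice_floor k -` {c}" for k and c :: 'a
  have Qm [measurable]: "Q k c \<in> sets borel" for k c
    unfolding Q_def using measurable_sets[OF lattice_floor_measurable, of "{c}" k] by simp
  define a where "a n s = (\<integral>x. indicator (Q (fst s) (snd s)) x * f n x \<partial>lborel)" for n s
  let ?S = "\<Union>k. Pair k ` (lattice_floor k ` \<Omega>)"
  have one: "(\<lambda>x. 1::real) \<in> L2 (lebesgue_on \<Omega>)" by (rule bounded_continuous_L2) (use \<Omega> \<Omega>m in auto)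
  have "countable (Pair k ` (lattice_floor k ` \<Omega>))" for k
    by (intro countable_finite finite_imageI finite_lattice_floor_image \<Omega>)
  then have "countable ?S" by (intro countable_UN) auto
  moreover have "norm (a n s) \<le> sqrt M * sqrt (sqnorm (lebesgue_on \<Omega>) (\<lambda>x. 1::real))" for n s
  proof -
    have "norm (a n s) \<le> (\<integral>x. \<bar>f n x\<bar> \<partial>lborel)"
      unfolding a_def
    proof (rule order_trans[OF integral_norm_bound integral_mono])
      show "integrable lborel (\<lambda>x. norm (indicat_real (Q (fst s) (snd s)) x * f n x))"
        using integrable_norm[OF integrable_mult_indicator[OF _ fi, of "Q (fst s) (snd s)" n]] by simp
      show "integrable lborel (\<lambda>x. \<bar>f n x\<bar>)" using fi by simp
    qed (auto simp: indicator_def)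
    also have "\<dots> = (\<integral>x. \<bar>f n x\<bar> \<bullet> 1 \<partial>lebesgue_on \<Omega>)"
      using f by (subst integral_lebesgue_on_lborel[OF \<Omega>m]) auto
    also have "\<dots> \<le> sqrt (sqnorm (lebesgue_on \<Omega>) (\<lambda>x. \<bar>f n x\<bar>)) * sqrt (sqnorm (lebesgue_on \<Omega>) (\<lambda>x. 1::real))"
    proof (rule order_trans[OF abs_ge_self L2_Cauchy_Schwarz_sqrt[OF _ one]])
      show "(\<lambda>x. \<bar>f n x\<bar>) \<in> L2 (lebesgue_on \<Omega>)"
        by (rule L2_dominated[OF _ L(1)]) (auto intro!: borel_measurable_lebesgue_on)
    qed
    also have "\<dots> \<le> sqrt M * sqrt (sqnorm (lebesgue_on \<Omega>) (\<lambda>x. 1::real))"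
      using M(1)[of n] by (intro mult_right_mono real_sqrt_le_mono) (auto simp: sqnorm_def)
    finally show ?thesis .
  qed
  \<comment> \<open>\<open>function_convergent_subsequence\<close> is the diagonal extraction over a
    countable index set, as used for normal families.\<close>
  ultimately obtain \<rho> where \<rho>: "strict_mono (\<rho> :: nat \<Rightarrow> nat)"
    and conv: "\<And>s. s \<in> ?S \<Longrightarrow> \<exists>l. (\<lambda>n. a (\<rho> n) s) \<longlonglongrightarrow> l"
    by (rule function_convergent_subsequence[where f=a and S="?S"]) auto
  define A where "A j = inner_set \<Omega> (2 * (1 / real (Suc j)))" for j
  have Am [measurable]: "A j \<in> sets borel" for j unfolding A_def by (auto intro!: borel_open open_inner_set)
  have "\<exists>r l. strict_mono r \<and> l \<in> borel_measurable lborel \<and>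
    (AE x in lborel. x \<in> (\<Union>k. A k) \<longrightarrow> (\<lambda>n. f (\<rho> (r n)) x) \<longlonglongrightarrow> l x)"
  proof (rule AE_convergent_subseq)
    show "f (\<rho> n) \<in> borel_measurable lborel" for n using f by simp
    show "A k \<in> sets lborel" for k by simp
    show "incseq A"
    proof (intro monoI)
      fix i j :: nat assume "i \<le> j"
      then have "1 / real (Suc j) \<le> 1 / real (Suc i)" by (simp add: frac_le)
      then show "A i \<subseteq> A j" by (auto simp: A_def inner_set_def)
    qed
    fix j and e :: real assume e: "0 < e"
    have M0: "0 \<le> M" using M(1)[of 0] sqnorm_nonneg[of "lebesgue_on \<Omega>" "f 0"] by linarith
    \<comment> \<open>The mesh is fixed before the indices. \<open>4 * M\<close> bounds the squared
      gradient norm of any difference of two terms, and the second condition fits the cells to the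
      depth 2/(j+1) of \<open>A j\<close>.\<close>
    obtain k where k: "0 < k" "real ?N / real k \<le> 1 / real (Suc j)"
      "2 ^ ?N * (real ?N / real k)\<^sup>2 * (4 * M) \<le> e / 2"
    proof -
      have "(\<lambda>k. real ?N / real k) \<longlonglongrightarrow> 0"
        by (rule lim_const_over_n)
      then have "(\<lambda>k. 2 ^ ?N * (real ?N / real k)\<^sup>2 * (4 * M)) \<longlonglongrightarrow> 2 ^ ?N * 0\<^sup>2 * (4 * M)"
        by (intro tendsto_intros)
      then have "\<forall>\<^sub>F k in sequentially. 2 ^ ?N * (real ?N / real k)\<^sup>2 * (4 * M) < e / 2"
        using e by (intro order_tendstoD(2)) auto
      moreover have "\<forall>\<^sub>F k in sequentially. real ?N / real k < 1 / real (Suc j)"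
        using \<open>(\<lambda>k. real ?N / real k) \<longlonglongrightarrow> 0\<close> by (rule order_tendstoD(2)) simp
      ultimately have "\<forall>\<^sub>F k in sequentially. 0 < k \<and> real ?N / real k < 1 / real (Suc j) \<and>
          2 ^ ?N * (real ?N / real k)\<^sup>2 * (4 * M) < e / 2"
        using eventually_gt_at_top[of 0] by eventually_elim simp
      then show ?thesis using that by (auto simp: eventually_sequentially intro: less_imp_le)
    qed
    let ?I = "lattice_floor k ` \<Omega>"
    have finI: "finite ?I" by (intro finite_lattice_floor_image \<Omega>)
    have "\<exists>N. \<forall>m\<ge>N. \<forall>n\<ge>N. (\<Sum>c\<in>?I. (a (\<rho> m) (k, c) - a (\<rho> n) (k, c))\<^sup>2) < e / (2 * real k ^ ?N)"
    proof -
      obtain l where l: "\<And>c. c \<in> ?I \<Longrightarrow> (\<lambda>n. a (\<rho> n) (k, c)) \<longlonglongrightarrow> l c"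
        using conv[of "(k, c)" for c] by (simp add: image_iff) metis
      have "((\<lambda>(m, n). \<Sum>c\<in>?I. (a (\<rho> m) (k, c) - a (\<rho> n) (k, c))\<^sup>2) \<longlongrightarrow> (\<Sum>c\<in>?I. (l c - l c)\<^sup>2)) (sequentially \<times>\<^sub>F sequentially)"
        unfolding case_prod_beta
        by (intro tendsto_sum tendsto_power tendsto_diff)
           (auto intro!: filterlim_compose[OF l filterlim_fst] filterlim_compose[OF l filterlim_snd])
      then have "\<forall>\<^sub>F x in sequentially \<times>\<^sub>F sequentially. (\<lambda>(m, n). \<Sum>c\<in>?I. (a (\<rho> m) (k, c) - a (\<rho> n) (k, c))\<^sup>2) x < e / (2 * real k ^ ?N)"
        using e k(1) by (intro order_tendstoD(2)) auto
      then show ?thesis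
        unfolding eventually_prod_sequentially by auto
    qed
    then obtain N where N: "\<And>m n. m \<ge> N \<Longrightarrow> n \<ge> N \<Longrightarrow>
      (\<Sum>c\<in>?I. (a (\<rho> m) (k, c) - a (\<rho> n) (k, c))\<^sup>2) < e / (2 * real k ^ ?N)" by blast
    have "(\<integral>\<^sup>+x\<in>A j. ennreal ((norm (f (\<rho> m) x - f (\<rho> n) x))\<^sup>2) \<partial>lborel) \<le> ennreal e" if mn: "m \<ge> N" "n \<ge> N" for m n
    proof -
      let ?f = "\<lambda>x. f (\<rho> m) x - f (\<rho> n) x" and ?g = "\<lambda>x. g (\<rho> m) x - g (\<rho> n) x"
      have pd: "H1_pair \<Omega> ?f ?g" by (rule H1_pair_diff[OF \<Omega>m p p])
      have gle: "sqnorm (lebesgue_on \<Omega>) ?g \<le> 4 * M"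
      proof -
        have "ennreal (sqnorm (lebesgue_on \<Omega>) ?g) = L2_norm_sq (lebesgue_on \<Omega>) ?g"
          by (intro L2_norm_sq_eq[symmetric] L2_diff L)
        also have "\<dots> \<le> 2 * L2_norm_sq (lebesgue_on \<Omega>) (g (\<rho> m)) + 2 * L2_norm_sq (lebesgue_on \<Omega>) (g (\<rho> n))"
          by (intro L2_norm_sq_diff_le L2_measurable L)
        also have "\<dots> = ennreal (2 * sqnorm (lebesgue_on \<Omega>) (g (\<rho> m)) + 2 * sqnorm (lebesgue_on \<Omega>) (g (\<rho> n)))"
          by (simp add: L2_norm_sq_eq[OF L(2)] ennreal_mult)
        finally have "sqnorm (lebesgue_on \<Omega>) ?g \<le> 2 * sqnorm (lebesgue_on \<Omega>) (g (\<rho> m)) + 2 * sqnorm (lebesgue_on \<Omega>) (g (\<rho> n))"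
          by (subst (asm) ennreal_le_iff) auto
        then show ?thesis using M(2)[of "\<rho> m"] M(2)[of "\<rho> n"] by linarith
      qed
      have ad: "(\<integral>x. indicator (lattice_floor k -` {c}) x * ?f x \<partial>lborel) = a (\<rho> m) (k, c) - a (\<rho> n) (k, c)" for c
      proof -
        have int: "integrable lborel (\<lambda>x. indicator (Q k c) x * f i x)" for i
          using integrable_mult_indicator[OF _ fi, of "Q k c" i] by simp
        show ?thesis
          unfolding a_def Q_def[symmetric] using int
          by (simp add: right_diff_distrib)
      qed
      have "(\<integral>\<^sup>+x\<in>A j. ennreal ((norm (?f x))\<^sup>2) \<partial>lborel)
        \<le> ennreal (2 ^ ?N * (real ?N / real k)\<^sup>2 * sqnorm (lebesgue_on \<Omega>) ?g)
          + ennreal (real k ^ ?N * (\<Sum>c\<in>?I. (a (\<rho> m) (k, c) - a (\<rho> n) (k, c))\<^sup>2))"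
        using lattice_estimate[OF _ _ pd \<Omega> k(1,2)] f unfolding ad A_def by simp
      also have "\<dots> \<le> ennreal (e / 2) + ennreal (e / 2)"
      proof (intro add_mono ennreal_leI)
        show "2 ^ ?N * (real ?N / real k)\<^sup>2 * sqnorm (lebesgue_on \<Omega>) ?g \<le> e / 2"
          using gle by (intro order_trans[OF mult_left_mono k(3)]) auto
        show "real k ^ ?N * (\<Sum>c\<in>?I. (a (\<rho> m) (k, c) - a (\<rho> n) (k, c))\<^sup>2) \<le> e / 2"
          using N[OF mn] k(1) by (simp add: field_simps)
      qed
      also have "\<dots> = ennreal e" using e by (simp add: ennreal_plus[symmetric] del: ennreal_plus)
      finally show ?thesis .
    qed
    then show "\<exists>N. \<forall>m\<ge>N. \<forall>n\<ge>N. (\<integral>\<^sup>+x\<in>A j. ennreal ((norm (f (\<rho> m) x - f (\<rho> n) x))\<^sup>2) \<partial>lborel) \<le> ennreal e"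
      by blast
  qed
  then obtain r l where r: "strict_mono r" "l \<in> borel_measurable lborel"
    "AE x in lborel. x \<in> (\<Union>k. A k) \<longrightarrow> (\<lambda>n. f (\<rho> (r n)) x) \<longlonglongrightarrow> l x" by blast
  have "(\<lambda>j. 2 * (1 / real (Suc j))) \<longlonglongrightarrow> 2 * 0"
    by (intro tendsto_intros LIMSEQ_Suc[OF lim_1_over_n])
  then have sub: "\<Omega> \<subseteq> (\<Union>k. A k)"
    unfolding A_def by (intro Union_inner_set \<Omega>) simp
  have "AE x in lborel. x \<in> \<Omega> \<longrightarrow> (\<lambda>n. f ((\<rho> \<circ> r) n) x) \<longlonglongrightarrow> l x"
    using r(3) by eventually_elim (use sub in auto)
  moreover have "strict_mono (\<rho> \<circ> r)" using \<rho> r(1) by (simp add: strict_mono_o)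
  ultimately show ?thesis using r(2) by (intro exI[of _ "\<rho> \<circ> r"] exI[of _ l]) auto
qed

section \<open>Hausdorff measure and the boundary\<close>

text \<open>The points of \<open>X\<close> at distance at least 1/(n+1) from \<open>F\<close> form a
  set \<open>Y n\<close> separated from \<open>F\<close>, so additivity holds with
  \<open>Y n\<close> in place of \<open>X - F\<close>. The remainder consists of shells
  \<open>R k\<close> around \<open>F\<close>. Shells with indices of equal parity are separated from
  each other, so their values sum to at most \<open>f X\<close>; the series over all shells
  converges and its tails tend to 0.\<close>

lemma metric_outer_measure_closed:
  fixes f :: "'a::metric_space set \<Rightarrow> ennreal"
  assumes empty: "f {} = 0" and mono: "\<And>A B. A \<subseteq> B \<Longrightarrow> f A \<le> f B"
    and subadd: "\<And>A :: nat \<Rightarrow> 'a set. f (\<Union>i. A i) \<le> (\<Sum>i. f (A i))"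
    and metric: "\<And>A B d. 0 < d \<Longrightarrow> (\<And>x y. x \<in> A \<Longrightarrow> y \<in> B \<Longrightarrow> d \<le> dist x y) \<Longrightarrow> f A + f B \<le> f (A \<union> B)"
    and F: "closed F"
  shows "f (X \<inter> F) + f (X - F) = f X"
proof (rule antisym)
  have sub2: "f (A \<union> B) \<le> f A + f B" for A B
    using subadd[of "binaryset A B"] by (simp add: UN_binaryset_eq suminf_binaryset_eq[of f, OF empty])
  have "f X \<le> f ((X \<inter> F) \<union> (X - F))" by (intro mono) auto
  then show "f X \<le> f (X \<inter> F) + f (X - F)" using sub2 by (rule order_trans)
  show "f (X \<inter> F) + f (X - F) \<le> f X"
  proof (cases "F = {} \<or> f X = \<infinity>")
    case True
    then show ?thesis using empty by auto
  next
    case False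
    then have Fne: "F \<noteq> {}" and fin: "f X < \<infinity>" by (auto simp: top.not_eq_extremum)
    define Y where "Y n = {x \<in> X. 1 / real (Suc n) \<le> infdist x F}" for n
    define R where "R k = {x \<in> X. 1 / real (Suc (Suc k)) \<le> infdist x F \<and> infdist x F < 1 / real (Suc k)}" for k
    have sepY: "f (X \<inter> F) + f (Y n) \<le> f X" for n
    proof -
      have "f (X \<inter> F) + f (Y n) \<le> f ((X \<inter> F) \<union> Y n)"
      proof (rule metric[of "1 / real (Suc n)"])
        fix x y assume "x \<in> X \<inter> F" "y \<in> Y n"
        then show "1 / real (Suc n) \<le> dist x y"
          using infdist_le[of x F y] by (auto simp: Y_def dist_commute intro: order_trans)
      qed simp
      also have "\<dots> \<le> f X" by (intro mono) (auto simp: Y_def)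
      finally show ?thesis .
    qed

    have sumR: "(\<Sum>k<m. f (R (2 * k + p))) \<le> f (\<Union>k<m. R (2 * k + p))" for m p
    proof (induction m)
      case 0
      then show ?case by (simp add: empty)
    next
      case (Suc m)
      have "(\<Sum>k<Suc m. f (R (2 * k + p))) \<le> f (\<Union>k<m. R (2 * k + p)) + f (R (2 * m + p))"
        using Suc by (simp add: add_right_mono)
      also have "\<dots> \<le> f ((\<Union>k<m. R (2 * k + p)) \<union> R (2 * m + p))"
      proof (cases m)
        case (Suc m')
        show ?thesis
        proof (rule metric)
          \<comment> \<open>The earlier shells have distance at least 1/(2m+p) from
            \<open>F\<close>, the new one less than 1/(2m+p+1). The case m = 0 is split off because
            the first fraction may then divide by 0.\<close>
          show "0 < 1 / real (2 * m + p) - 1 / real (Suc (2 * m + p))"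
            using Suc by (simp add: frac_less2)
          fix x y assume "x \<in> (\<Union>k<m. R (2 * k + p))" and y: "y \<in> R (2 * m + p)"
          then obtain k where k: "k < m" "x \<in> R (2 * k + p)" by auto
          have "1 / real (2 * m + p) \<le> 1 / real (Suc (Suc (2 * k + p)))"
            using k(1) by (intro divide_left_mono) auto
          then have "1 / real (2 * m + p) \<le> infdist x F" using k(2) by (auto simp: R_def)
          moreover have "infdist y F < 1 / real (Suc (2 * m + p))" using y by (auto simp: R_def)
          ultimately show "1 / real (2 * m + p) - 1 / real (Suc (2 * m + p)) \<le> dist x y"
            using infdist_triangle_abs[of x F y] by linarith
        qed
      qed (simp add: empty)
      also have "(\<Union>k<m. R (2 * k + p)) \<union> R (2 * m + p) = (\<Union>k<Suc m. R (2 * k + p))"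
        by (auto simp: lessThan_Suc)
      finally show ?case .
    qed
    have sumR': "(\<Sum>k<m. f (R (2 * k + p))) \<le> f X" for m p
      by (rule order_trans[OF sumR]) (intro mono, auto simp: R_def)
    have fR: "f (R k) < \<infinity>" for k
      using le_less_trans[OF mono fin, of "R k"] by (auto simp: R_def)
    define a where "a k = enn2real (f (R k))" for k
    have a: "f (R k) = ennreal (a k)" "0 \<le> a k" for k
      using fR[of k] by (auto simp: a_def)
    define c where "c = enn2real (f X)"
    have c: "f X = ennreal c" "0 \<le> c" using fin by (auto simp: c_def)
    have ac: "(\<Sum>k<m. a (2 * k + p)) \<le> c" for m p
      using sumR'[of p m] by (simp add: a c sum_nonneg)
    have "summable a"
    proof (rule summableI_nonneg_bounded)
      show "(\<Sum>k<n. a k) \<le> 2 * c" for n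
      proof -
        have "(\<Sum>k<n. a k) \<le> (\<Sum>k<2*n. a k)" by (intro sum_mono2) (auto simp: a)
        also have "\<dots> = (\<Sum>k<n. a (2 * k)) + (\<Sum>k<n. a (2 * k + 1))"
          using sum_split_even_odd[of a a n] by simp
        also have "\<dots> \<le> c + c" using ac[of 0 n] ac[of 1 n] by simp
        finally show ?thesis by simp
      qed
    qed (simp add: a)
    then have tail: "(\<lambda>n. \<Sum>k. a (k + n)) \<longlonglongrightarrow> 0" by (rule suminf_exist_split2)
    have est: "f (X \<inter> F) + f (X - F) \<le> f X + ennreal (\<Sum>k. a (k + n))" for n
    proof -
      have "X - F \<subseteq> Y n \<union> (\<Union>k. R (k + n))"
      proof
        fix x assume x: "x \<in> X - F"
        then have pos: "0 < infdist x F" using infdist_pos_not_in_closed[OF F Fne] by simp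
        show "x \<in> Y n \<union> (\<Union>k. R (k + n))"
        proof (cases "1 / real (Suc n) \<le> infdist x F")
          case True
          then show ?thesis using x by (simp add: Y_def)
        next
          case False
          \<comment> \<open>The least such j places x in the shell with index j - 1; it exceeds n
            because x is not in \<open>Y n\<close>.\<close>
          obtain j where j: "1 / real (Suc j) \<le> infdist x F" "\<And>i. i < j \<Longrightarrow> infdist x F < 1 / real (Suc i)"
          proof -
            obtain j0 where "1 / real (Suc j0) < infdist x F" using nat_approx_posE[OF pos] by auto
            then have ex: "\<exists>j. 1 / real (Suc j) \<le> infdist x F" by (auto intro: less_imp_le)
            show ?thesis
              using that[of "LEAST j. 1 / real (Suc j) \<le> infdist x F"] LeastI_ex[OF ex] not_less_Least
              by (meson not_le)
          qed
          have "n < j"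
          proof (rule ccontr)
            assume "\<not> n < j"
            then have "1 / real (Suc n) \<le> 1 / real (Suc j)" by (intro divide_left_mono) auto
            then show False using j(1) False by linarith
          qed
          then obtain i where i: "j = Suc i" "n \<le> i" by (cases j) auto
          then have "x \<in> R i" using x j(1) j(2)[of i] by (simp add: R_def)
          moreover have "i = (i - n) + n" using i by simp
          ultimately show ?thesis by (metis UN_I UnI2 UNIV_I)
        qed
      qed
      then have "f (X - F) \<le> f (Y n \<union> (\<Union>k. R (k + n)))" by (rule mono)
      also have "\<dots> \<le> f (Y n) + (\<Sum>k. f (R (k + n)))"
        by (rule order_trans[OF sub2 add_left_mono[OF subadd]])
      also have "(\<Sum>k. f (R (k + n))) = ennreal (\<Sum>k. a (k + n))"
        unfolding a(1) using \<open>summable a\<close> by (intro suminf_ennreal2) (auto simp: a summable_iff_shift)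
      finally have "f (X \<inter> F) + f (X - F) \<le> f (X \<inter> F) + (f (Y n) + ennreal (\<Sum>k. a (k + n)))"
        by (rule add_left_mono)
      also have "\<dots> \<le> f X + ennreal (\<Sum>k. a (k + n))"
        using sepY[of n] by (simp add: add.assoc[symmetric] add_right_mono)
      finally show ?thesis .
    qed
    have "(\<lambda>n. f X + ennreal (\<Sum>k. a (k + n))) \<longlonglongrightarrow> f X + ennreal 0"
      by (intro tendsto_add tendsto_const tendsto_ennrealI tail)
    then show ?thesis
      using est by (intro tendsto_lowerbound[where F=sequentially]) auto
  qed
qed

text \<open>The sets satisfying Caratheodory's condition form a sigma-algebra on which
  \<open>f\<close> is a measure; it contains the closed sets and hence all Borel sets.\<close>

lemma measure_space_metric_outer_measure:
  fixes f :: "'a::metric_space set \<Rightarrow> ennreal"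
  assumes empty: "f {} = 0" and mono: "\<And>A B. A \<subseteq> B \<Longrightarrow> f A \<le> f B"
    and subadd: "\<And>A :: nat \<Rightarrow> 'a set. f (\<Union>i. A i) \<le> (\<Sum>i. f (A i))"
    and metric: "\<And>A B d. 0 < d \<Longrightarrow> (\<And>x y. x \<in> A \<Longrightarrow> y \<in> B \<Longrightarrow> d \<le> dist x y) \<Longrightarrow> f A + f B \<le> f (A \<union> B)"
  shows "measure_space UNIV (sets borel) f"
proof -
  interpret P: sigma_algebra UNIV "Pow UNIV :: 'a set set" by (rule sigma_algebra_Pow)
  let ?L = "lambda_system UNIV (Pow UNIV) f"
  have "outer_measure_space (Pow UNIV) f"
    by (auto simp: outer_measure_space_def positive_def increasing_def countably_subadditive_def
        empty intro: mono subadd)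
  then have ms: "measure_space UNIV ?L f" by (rule P.caratheodory_lemma)
  then interpret L: sigma_algebra UNIV ?L by (simp add: measure_space_def)
  have "Collect closed \<subseteq> ?L"
    unfolding P.lambda_system_eq using metric_outer_measure_closed[OF assms] by auto
  then have "sigma_sets UNIV (Collect closed) \<subseteq> ?L" by (rule L.sigma_sets_subset)
  then have "sets borel \<subseteq> ?L" by (simp add: borel_eq_closed)
  then show ?thesis
    using sets.sigma_algebra_axioms[of "borel :: 'a measure"] by (intro measure_down[OF ms]) auto
qed

section \<open>Hausdorff measure on the Borel sets\<close>

definition hausdorff_weight :: "nat \<Rightarrow> 'a::euclidean_space set \<Rightarrow> ennreal" where
  "hausdorff_weight n C = (if C = {} then 0 else ennreal (unit_ball_vol (real n) * (diameter C / 2) ^ n))"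

definition hausdorff_cover :: "real \<Rightarrow> 'a::euclidean_space set \<Rightarrow> (nat \<Rightarrow> 'a set) set" where
  "hausdorff_cover \<delta> A = {C. A \<subseteq> (\<Union>i. C i) \<and> (\<forall>i. bounded (C i) \<and> diameter (C i) \<le> \<delta>)}"

lemma hausdorff_pre_eq: "hausdorff_pre n \<delta> A = (INF C\<in>hausdorff_cover \<delta> A. \<Sum>i. hausdorff_weight n (C i))"
  by (simp add: hausdorff_pre_def hausdorff_cover_def hausdorff_weight_def)

lemma hausdorff_pre_lower: "C \<in> hausdorff_cover \<delta> A \<Longrightarrow> hausdorff_pre n \<delta> A \<le> (\<Sum>i. hausdorff_weight n (C i))"
  unfolding hausdorff_pre_eq by (rule INF_lower)

lemma hausdorff_pre_mono: "A \<subseteq> B \<Longrightarrow> hausdorff_pre n \<delta> A \<le> hausdorff_pre n \<delta> B"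
proof -
  assume "A \<subseteq> B"
  then have "hausdorff_cover \<delta> B \<subseteq> hausdorff_cover \<delta> A"
    unfolding hausdorff_cover_def by blast
  then show ?thesis unfolding hausdorff_pre_eq by (rule INF_superset_mono) simp
qed

lemma hausdorff_pre_antimono: "\<delta> \<le> \<delta>' \<Longrightarrow> hausdorff_pre n \<delta>' A \<le> hausdorff_pre n \<delta> A"
proof -
  assume "\<delta> \<le> \<delta>'"
  have "hausdorff_cover \<delta> A \<subseteq> hausdorff_cover \<delta>' A"
  proof
    fix C assume "C \<in> hausdorff_cover \<delta> A"
    then have C: "A \<subseteq> (\<Union>i. C i)" "\<And>i. bounded (C i)" "\<And>i. diameter (C i) \<le> \<delta>"
      by (simp_all add: hausdorff_cover_def)
    have "diameter (C i) \<le> \<delta>'" for i using C(3)[of i] \<open>\<delta> \<le> \<delta>'\<close> by linarith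
    with C(1,2) show "C \<in> hausdorff_cover \<delta>' A" by (simp add: hausdorff_cover_def)
  qed
  then show ?thesis unfolding hausdorff_pre_eq by (rule INF_superset_mono) simp
qed

text \<open>Nearly optimal covers of the single sets, with errors e/2^(i+1), are merged into one
  sequence along \<open>prod_decode\<close>; every member keeps its diameter bound.\<close>

lemma hausdorff_pre_subadd:
  fixes A :: "nat \<Rightarrow> 'a::euclidean_space set"
  shows "hausdorff_pre n \<delta> (\<Union>i. A i) \<le> (\<Sum>i. hausdorff_pre n \<delta> (A i))"
proof (rule ennreal_le_epsilon)
  fix e :: real assume e: "0 < e" and fin: "(\<Sum>i. hausdorff_pre n \<delta> (A i)) < top"
  have "\<exists>C\<in>hausdorff_cover \<delta> (A i). (\<Sum>j. hausdorff_weight n (C j)) \<le> hausdorff_pre n \<delta> (A i) + e * (1/2) ^ Suc i" for i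
  proof -
    have "hausdorff_pre n \<delta> (A i) < hausdorff_pre n \<delta> (A i) + e * (1/2) ^ Suc i"
      using fin e by (auto simp add: less_top dest!: ennreal_suminf_lessD)
    then show ?thesis
      unfolding hausdorff_pre_eq[of n \<delta> "A i"] by (subst (asm) INF_less_iff) (auto intro: less_imp_le)
  qed
  then obtain C where C: "\<And>i. C i \<in> hausdorff_cover \<delta> (A i)"
    and Cle: "\<And>i. (\<Sum>j. hausdorff_weight n (C i j)) \<le> hausdorff_pre n \<delta> (A i) + e * (1/2) ^ Suc i"
    by metis
  let ?C = "\<lambda>k. case_prod C (prod_decode k)"
  have "(\<Union>i. A i) \<subseteq> (\<Union>k. ?C k)"
  proof
    fix x assume "x \<in> (\<Union>i. A i)"
    then obtain i where "x \<in> A i" by auto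
    then obtain j where "x \<in> C i j" using C[of i] by (auto simp: hausdorff_cover_def)
    then have "x \<in> ?C (prod_encode (i, j))" by simp
    then show "x \<in> (\<Union>k. ?C k)" by (rule UN_I[OF UNIV_I])
  qed
  moreover have "bounded (?C k) \<and> diameter (?C k) \<le> \<delta>" for k
    using C by (auto simp: hausdorff_cover_def split: prod.split)
  ultimately have "?C \<in> hausdorff_cover \<delta> (\<Union>i. A i)" by (simp add: hausdorff_cover_def)
  then have "hausdorff_pre n \<delta> (\<Union>i. A i) \<le> (\<Sum>k. hausdorff_weight n (?C k))" by (rule hausdorff_pre_lower)
  also have "\<dots> = (\<Sum>k. (\<lambda>(i, j). hausdorff_weight n (C i j)) (prod_decode k))"
    by (simp add: case_prod_beta)
  also have "\<dots> = (\<Sum>i. \<Sum>j. hausdorff_weight n (C i j))" by (rule suminf_ennreal_2dimen) simp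
  also have "\<dots> \<le> (\<Sum>i. hausdorff_pre n \<delta> (A i) + e * (1/2) ^ Suc i)"
    by (intro suminf_le Cle) auto
  also have "\<dots> = (\<Sum>i. hausdorff_pre n \<delta> (A i)) + (\<Sum>i. ennreal e * ennreal ((1/2) ^ Suc i))"
    using e by (subst suminf_add[symmetric]) (auto simp del: ennreal_suminf_cmult simp add: ennreal_mult[symmetric])
  also have "\<dots> = (\<Sum>i. hausdorff_pre n \<delta> (A i)) + e"
    unfolding ennreal_suminf_cmult by (subst suminf_ennreal_eq[OF zero_le_power power_half_series]) auto
  finally show "hausdorff_pre n \<delta> (\<Union>i. A i) \<le> (\<Sum>i. hausdorff_pre n \<delta> (A i)) + e" .
qed

text \<open>A set of diameter at most \<open>\<delta>\<close> cannot meet both \<open>A\<close> and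
  \<open>B\<close>, so a cover of the union splits in two. Discarded members are replaced by the
  empty set, which has weight 0 even in dimension 0.\<close>

lemma hausdorff_pre_metric:
  assumes d: "\<delta> < d" and sep: "\<And>x y. x \<in> A \<Longrightarrow> y \<in> B \<Longrightarrow> d \<le> dist x y" and \<delta>: "0 < \<delta>"
  shows "hausdorff_pre n \<delta> A + hausdorff_pre n \<delta> B \<le> hausdorff_pre n \<delta> (A \<union> B)"
  unfolding hausdorff_pre_eq[of n \<delta> "A \<union> B"]
proof (rule INF_greatest)
  fix C assume C: "C \<in> hausdorff_cover \<delta> (A \<union> B)"
  let ?R = "\<lambda>S i. if C i \<inter> S \<noteq> {} then C i else {}"
  have cov: "?R S \<in> hausdorff_cover \<delta> S" if "S \<subseteq> A \<union> B" for S
  proof -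
    have "S \<subseteq> (\<Union>i. ?R S i)"
    proof
      fix x assume "x \<in> S"
      then have "x \<in> A \<union> B" using \<open>S \<subseteq> A \<union> B\<close> by blast
      then have "x \<in> (\<Union>i. C i)" using C unfolding hausdorff_cover_def by blast
      then obtain i where "x \<in> C i" by blast
      then have "x \<in> ?R S i" using \<open>x \<in> S\<close> by auto
      then show "x \<in> (\<Union>i. ?R S i)" by blast
    qed
    then show ?thesis using C \<delta> by (auto simp: hausdorff_cover_def)
  qed
  have "hausdorff_pre n \<delta> A + hausdorff_pre n \<delta> B
     \<le> (\<Sum>i. hausdorff_weight n (?R A i)) + (\<Sum>i. hausdorff_weight n (?R B i))"
    by (intro add_mono hausdorff_pre_lower cov) auto
  also have "\<dots> = (\<Sum>i. hausdorff_weight n (?R A i) + hausdorff_weight n (?R B i))"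
    by (rule suminf_add) auto
  also have "\<dots> \<le> (\<Sum>i. hausdorff_weight n (C i))"
  proof (intro suminf_le)
    fix i
    have "C i \<inter> A = {} \<or> C i \<inter> B = {}"
    proof (rule ccontr)
      assume "\<not> (C i \<inter> A = {} \<or> C i \<inter> B = {})"
      then obtain x y where xy: "x \<in> C i" "x \<in> A" "y \<in> C i" "y \<in> B" by auto
      have "dist x y \<le> diameter (C i)"
        using C xy by (intro diameter_bounded_bound) (auto simp: hausdorff_cover_def)
      also have "\<dots> \<le> \<delta>" using C by (auto simp: hausdorff_cover_def)
      finally show False using sep[OF xy(2,4)] d by linarith
    qed
    then show "hausdorff_weight n (?R A i) + hausdorff_weight n (?R B i) \<le> hausdorff_weight n (C i)"
      by (auto simp: hausdorff_weight_def)
  qed auto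
  finally show "hausdorff_pre n \<delta> A + hausdorff_pre n \<delta> B \<le> (\<Sum>i. hausdorff_weight n (C i))" .
qed

lemma hausdorff_pre_le_outer: "0 < \<delta> \<Longrightarrow> hausdorff_pre n \<delta> A \<le> hausdorff_outer n A"
  unfolding hausdorff_outer_def by (rule SUP_upper) simp

lemma measure_space_hausdorff:
  "measure_space UNIV (sets borel) (hausdorff_outer n :: 'a::euclidean_space set \<Rightarrow> ennreal)"
proof (rule measure_space_metric_outer_measure)
  show "hausdorff_outer n ({} :: 'a set) = 0"
  proof -
    have "hausdorff_pre n \<delta> ({} :: 'a set) \<le> 0" if "0 < \<delta>" for \<delta>
      using hausdorff_pre_lower[of "\<lambda>_. {}" \<delta> "{}::'a set" n] that
      by (simp add: hausdorff_cover_def hausdorff_weight_def)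
    then have "hausdorff_outer n ({} :: 'a set) \<le> 0"
      unfolding hausdorff_outer_def by (intro SUP_least) auto
    then show ?thesis by simp
  qed
  show "hausdorff_outer n A \<le> hausdorff_outer n B" if "A \<subseteq> B" for A B :: "'a set"
    unfolding hausdorff_outer_def using that by (intro SUP_mono) (auto intro: hausdorff_pre_mono)
  show "hausdorff_outer n (\<Union>i. A i) \<le> (\<Sum>i. hausdorff_outer n (A i))" for A :: "nat \<Rightarrow> 'a set"
    unfolding hausdorff_outer_def[of n "\<Union>i. A i"]
    by (intro SUP_least order_trans[OF hausdorff_pre_subadd] suminf_le hausdorff_pre_le_outer) auto
  fix A B :: "'a set" and d :: real
  assume d: "0 < d" and sep: "\<And>x y. x \<in> A \<Longrightarrow> y \<in> B \<Longrightarrow> d \<le> dist x y"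
  \<comment> \<open>The two suprema run independently, so the scales differ. A common scale below
    both and below d separates the sets, and shrinking the scale only increases each value.\<close>
  have *: "hausdorff_pre n \<delta> A + hausdorff_pre n \<epsilon> B \<le> hausdorff_outer n (A \<union> B)" if "0 < \<delta>" "0 < \<epsilon>" for \<delta> \<epsilon>
  proof -
    let ?\<eta> = "min (min \<delta> \<epsilon>) (d / 2)"
    have "hausdorff_pre n \<delta> A + hausdorff_pre n \<epsilon> B \<le> hausdorff_pre n ?\<eta> A + hausdorff_pre n ?\<eta> B"
      by (intro add_mono hausdorff_pre_antimono) auto
    also have "\<dots> \<le> hausdorff_pre n ?\<eta> (A \<union> B)"
      by (rule hausdorff_pre_metric[OF _ sep]) (use d that in auto)
    also have "\<dots> \<le> hausdorff_outer n (A \<union> B)"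
      using d that by (intro hausdorff_pre_le_outer) auto
    finally show ?thesis .
  qed
  have **: "hausdorff_pre n \<delta> A + hausdorff_outer n B \<le> hausdorff_outer n (A \<union> B)" if "0 < \<delta>" for \<delta>
    unfolding hausdorff_outer_def[of n B]
    by (subst ennreal_SUP_add_right) (auto intro!: SUP_least * that)
  show "hausdorff_outer n A + hausdorff_outer n B \<le> hausdorff_outer n (A \<union> B)"
    unfolding hausdorff_outer_def[of n A]
    by (subst ennreal_SUP_add_left[symmetric]) (auto intro!: SUP_least **)
qed

lemma sets_hausdorff_measure [simp, measurable_cong]:
  "sets (hausdorff_measure n :: 'a::euclidean_space measure) = sets borel"
  using sets.sigma_sets_eq[of "borel :: 'a::euclidean_space measure"]
  by (simp add: hausdorff_measure_def sets_measure_of)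

lemma space_hausdorff_measure [simp]: "space (hausdorff_measure n) = UNIV"
  by (simp add: hausdorff_measure_def space_measure_of)

text \<open>\<open>measure_of\<close> yields the zero measure unless the given function is countably
  additive on the sigma-algebra, so the name of the measure guarantees nothing before this
  point.\<close>

lemma emeasure_hausdorff_measure:
  fixes A :: "'a::euclidean_space set"
  assumes "A \<in> sets borel"
  shows "emeasure (hausdorff_measure n) A = hausdorff_outer n A"
proof -
  have "sigma_algebra UNIV (sets borel :: 'a set set)" "positive (sets borel) (hausdorff_outer n :: 'a set \<Rightarrow> ennreal)"
    "countably_additive (sets borel) (hausdorff_outer n :: 'a set \<Rightarrow> ennreal)"
    using measure_space_hausdorff[where 'a='a, of n] unfolding measure_space_def by blast+
  then show ?thesis
    unfolding hausdorff_measure_def using assms by (rule emeasure_measure_of_sigma)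
qed

lemma nn_integral_boundary_measure:
  fixes \<Omega> :: "'a::euclidean_space set"
  shows "(\<integral>\<^sup>+x. G x \<partial>boundary_measure \<Omega>) = (\<integral>\<^sup>+x\<in>frontier \<Omega>. G x \<partial>hausdorff_measure (DIM('a) - 1))"
  unfolding boundary_measure_def
proof (rule nn_integral_restrict_space)
  have "frontier \<Omega> \<in> sets borel" by (rule borel_closed) simp
  then show "frontier \<Omega> \<inter> space (hausdorff_measure (DIM('a) - 1)) \<in> sets (hausdorff_measure (DIM('a) - 1))"
    by simp
qed

text \<open>If sets of diameter d at most 1 cover \<open>B\<close>, then boxes around them,
  lengthened by D against the direction \<open>e\<close>, cover \<open>E\<close>. Such a box has
  side 2d in n = N - 1 directions and at most 2 + D in the remaining one, hence volume at most (2 +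
  D) 4^n (d/2)^n. Division by the Hausdorff weight, unit ball volume times (d/2)^n, gives
  \<open>K\<close>.\<close>

lemma emeasure_cylinder:
  fixes B E :: "'a::euclidean_space set"
  assumes e: "e \<in> Basis" and D: "0 \<le> D" and Em: "E \<in> sets borel"
    and E: "\<And>x. x \<in> E \<Longrightarrow> \<exists>t. 0 \<le> t \<and> t \<le> D \<and> x + t *\<^sub>R e \<in> B"
  defines "K \<equiv> (2 + D) * 4 ^ (DIM('a) - 1) / unit_ball_vol (real (DIM('a) - 1))"
  shows "emeasure lborel E \<le> ennreal K * hausdorff_outer (DIM('a) - 1) B"
proof -
  let ?n = "DIM('a) - 1"
  have K: "0 < K" unfolding K_def
    using D unit_ball_vol_pos[of "real (DIM('a) - 1)"] by (intro divide_pos_pos mult_pos_pos) simp_all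
  have "ennreal (1 / K) * emeasure lborel E \<le> hausdorff_pre ?n 1 B"
    unfolding hausdorff_pre_eq
  proof (rule INF_greatest)
    fix C assume C: "C \<in> hausdorff_cover 1 B"
    \<comment> \<open>An arbitrary value if \<open>C i\<close> is empty; \<open>S i\<close> is then
      empty as well.\<close>
    define c where "c i = (SOME y. y \<in> C i)" for i
    define S where "S i = (if C i = {} then {} else
      cbox (c i - diameter (C i) *\<^sub>R One - D *\<^sub>R e) (c i + diameter (C i) *\<^sub>R One))" for i
    have "E \<subseteq> (\<Union>i. S i)"
    proof
      fix x assume "x \<in> E"
      then obtain t where t: "0 \<le> t" "t \<le> D" "x + t *\<^sub>R e \<in> B" using E by blast
      then obtain i where i: "x + t *\<^sub>R e \<in> C i" using C by (auto simp: hausdorff_cover_def)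
      then have ci: "c i \<in> C i" unfolding c_def by (rule someI)
      have le: "norm (x + t *\<^sub>R e - c i) \<le> diameter (C i)"
        using diameter_bounded_bound[OF _ i ci] C by (auto simp: hausdorff_cover_def dist_norm)
      have "x \<bullet> b \<ge> (c i - diameter (C i) *\<^sub>R One - D *\<^sub>R e) \<bullet> b \<and> x \<bullet> b \<le> (c i + diameter (C i) *\<^sub>R One) \<bullet> b"
        if b: "b \<in> Basis" for b
      proof -
        have "\<bar>(x + t *\<^sub>R e - c i) \<bullet> b\<bar> \<le> diameter (C i)"
          using Basis_le_norm[OF b, of "x + t *\<^sub>R e - c i"] le by linarith
        then have "\<bar>x \<bullet> b + t * (e \<bullet> b) - c i \<bullet> b\<bar> \<le> diameter (C i)"
          by (simp add: inner_add_left inner_diff_left)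
        moreover have "0 \<le> t * (e \<bullet> b)" "t * (e \<bullet> b) \<le> D * (e \<bullet> b)"
          using e b t by (auto simp: inner_Basis)
        ultimately show ?thesis
          using b by (auto simp: inner_add_left inner_diff_left abs_le_iff)
      qed
      then have "x \<in> S i" using i by (auto simp: S_def mem_box)
      then show "x \<in> (\<Union>i. S i)" by blast
    qed
    moreover have Sm: "S i \<in> sets lborel" for i by (simp add: S_def)
    ultimately have "emeasure lborel E \<le> emeasure lborel (\<Union>i. S i)"
      by (intro emeasure_mono) auto
    also have "\<dots> \<le> (\<Sum>i. emeasure lborel (S i))"
      using Sm by (intro emeasure_subadditive_countably) auto
    also have "\<dots> \<le> (\<Sum>i. ennreal K * hausdorff_weight ?n (C i))"
    proof (intro suminf_le)
      fix i
      show "emeasure lborel (S i) \<le> ennreal K * hausdorff_weight ?n (C i)"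
      proof (cases "C i = {}")
        case False
        let ?d = "diameter (C i)"
        have d: "0 \<le> ?d" "?d \<le> 1" using C by (auto simp: hausdorff_cover_def diameter_ge_0)
        let ?l = "c i - ?d *\<^sub>R One - D *\<^sub>R e" and ?u = "c i + ?d *\<^sub>R One"
        have diff: "(?u - ?l) \<bullet> b = 2 * ?d + (if b = e then D else 0)" if "b \<in> Basis" for b
          using that e by (auto simp: inner_add_left inner_diff_left inner_Basis)
        have lu: "\<forall>b\<in>Basis. ?l \<bullet> b \<le> ?u \<bullet> b"
        proof
          fix b :: 'a assume b: "b \<in> Basis"
          have "0 \<le> (?u - ?l) \<bullet> b" unfolding diff[OF b] using d D by simp
          then show "?l \<bullet> b \<le> ?u \<bullet> b" by (simp add: inner_diff_left inner_add_left b)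
        qed
        have "emeasure lborel (S i) = ennreal (\<Prod>b\<in>Basis. (?u - ?l) \<bullet> b)"
          using False by (simp only: S_def if_False emeasure_lborel_cbox_eq if_P[OF lu])
        also have "(\<Prod>b\<in>Basis. (?u - ?l) \<bullet> b) = (\<Prod>b\<in>Basis. 2 * ?d + (if b = e then D else 0))"
          using diff by (rule prod.cong[OF refl])
        also have "\<dots> = (2 * ?d + D) * (\<Prod>b\<in>Basis - {e}. 2 * ?d + (if b = e then D else 0))"
          using e by (subst prod.remove[of _ e]) auto
        also have "(\<Prod>b\<in>Basis - {e}. 2 * ?d + (if b = e then D else 0)) = (\<Prod>b\<in>Basis - {e}. 2 * ?d)"
          by (intro prod.cong) auto
        also have "\<dots> = (2 * ?d) ^ ?n" using e by simp
        also have "(2 * ?d + D) * (2 * ?d) ^ ?n \<le> (2 + D) * (2 * ?d) ^ ?n"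
          using d by (intro mult_right_mono) auto
        also have "\<dots> = K * (unit_ball_vol (real ?n) * (?d / 2) ^ ?n)"
        proof -
          have ne: "unit_ball_vol (real ?n) \<noteq> 0" by (metis less_irrefl of_nat_0_le_iff unit_ball_vol_pos)
          have "4 ^ ?n * (?d / 2) ^ ?n = (4 * (?d / 2)) ^ ?n"
            by (rule power_mult_distrib[symmetric])
          then have eq4: "(2 * ?d) ^ ?n = 4 ^ ?n * (?d / 2) ^ ?n" by simp
          have "a * p = b * m / v * (v * q)" if "v \<noteq> 0" "p = m * q" "a = b" for a b m p q v :: real
            using that by simp
          from this[OF ne eq4 refl] show ?thesis unfolding K_def .
        qed
        finally show ?thesis
          using False K by (simp add: hausdorff_weight_def ennreal_mult'[symmetric] ennreal_leI)
      qed (simp add: S_def)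
    qed auto
    also have "\<dots> = ennreal K * (\<Sum>i. hausdorff_weight ?n (C i))" by simp
    finally have "ennreal (1 / K) * emeasure lborel E \<le> ennreal (1 / K) * (ennreal K * (\<Sum>i. hausdorff_weight ?n (C i)))"
      by (rule mult_left_mono) simp
    also have "\<dots> = (\<Sum>i. hausdorff_weight ?n (C i))"
      using K by (simp add: mult.assoc[symmetric] ennreal_mult'[symmetric])
    finally show "ennreal (1 / K) * emeasure lborel E \<le> (\<Sum>i. hausdorff_weight ?n (C i))" .
  qed
  also have "\<dots> \<le> hausdorff_outer ?n B" by (rule hausdorff_pre_le_outer) simp
  finally have "ennreal K * (ennreal (1 / K) * emeasure lborel E) \<le> ennreal K * hausdorff_outer ?n B"
    by (rule mult_left_mono) simp
  then show ?thesis
    using K by (simp add: mult.assoc[symmetric] ennreal_mult'[symmetric])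
qed

section \<open>The exit map in a coordinate direction\<close>

definition exit_time :: "'a::euclidean_space set \<Rightarrow> 'a \<Rightarrow> 'a \<Rightarrow> real" where
  "exit_time \<Omega> e x = Inf {s. 0 \<le> s \<and> x + s *\<^sub>R e \<notin> \<Omega>}"

text \<open>The complement is closed, so the infimum is attained and the exit point lies outside
  \<open>\<Omega>\<close>; earlier points of the ray lie inside, so it is also a limit of points of
  \<open>\<Omega>\<close>. At time 2R + 1 the point has norm at least R + 1 and has left.\<close>

lemma exit_time:
  assumes \<Omega>: "open \<Omega>" "\<And>x. x \<in> \<Omega> \<Longrightarrow> norm x \<le> R" and e: "e \<in> Basis" and x: "x \<in> \<Omega>"
  shows "0 \<le> exit_time \<Omega> e x" "exit_time \<Omega> e x \<le> 2 * R + 1"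
    "\<And>s. 0 \<le> s \<Longrightarrow> s < exit_time \<Omega> e x \<Longrightarrow> x + s *\<^sub>R e \<in> \<Omega>"
    "x + exit_time \<Omega> e x *\<^sub>R e \<notin> \<Omega>" "x + exit_time \<Omega> e x *\<^sub>R e \<in> frontier \<Omega>"
proof -
  let ?S = "{s. 0 \<le> s \<and> x + s *\<^sub>R e \<notin> \<Omega>}" and ?t = "exit_time \<Omega> e x"
  have R: "0 \<le> R" using \<Omega>(2)[OF x] norm_ge_zero[of x] by linarith
  have mem: "2 * R + 1 \<in> ?S"
  proof -
    have "\<not> norm (x + (2 * R + 1) *\<^sub>R e) \<le> R"
      using norm_diff_ineq[of "(2 * R + 1) *\<^sub>R e" x] \<Omega>(2)[OF x] R e by (simp add: add.commute)
    then show ?thesis using \<Omega>(2) R by auto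
  qed
  have bdd: "bdd_below ?S" by (rule bdd_belowI[of _ 0]) auto
  have "closed ?S"
  proof -
    have "closed ((\<lambda>s. x + s *\<^sub>R e) -` (- \<Omega>))"
      using \<Omega>(1) by (intro closed_vimage closed_Compl continuous_intros)
    then have "closed ({0..} \<inter> (\<lambda>s. x + s *\<^sub>R e) -` (- \<Omega>))" by (intro closed_Int) auto
    moreover have "{0..} \<inter> (\<lambda>s. x + s *\<^sub>R e) -` (- \<Omega>) = ?S" by auto
    ultimately show ?thesis by simp
  qed
  then have t: "?t \<in> ?S" unfolding exit_time_def using mem bdd by (intro closed_contains_Inf) auto
  show "0 \<le> ?t" "x + ?t *\<^sub>R e \<notin> \<Omega>" using t by auto
  show "?t \<le> 2 * R + 1" unfolding exit_time_def using mem bdd by (intro cInf_lower) auto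
  show inside: "x + s *\<^sub>R e \<in> \<Omega>" if "0 \<le> s" "s < ?t" for s
  proof (rule ccontr)
    assume "x + s *\<^sub>R e \<notin> \<Omega>"
    then have "?t \<le> s" unfolding exit_time_def using bdd that by (intro cInf_lower) auto
    then show False using that by simp
  qed
  have "?t \<noteq> 0" using t x by auto
  then have tpos: "0 < ?t" using t by auto
  have "x + ?t *\<^sub>R e \<in> closure \<Omega>"
    unfolding closure_sequential
  proof (intro exI conjI allI)
    have "(\<lambda>n. x + (?t - ?t * (1 / real (Suc n))) *\<^sub>R e) \<longlonglongrightarrow> x + (?t - ?t * 0) *\<^sub>R e"
      by (intro tendsto_intros LIMSEQ_Suc[OF lim_1_over_n])
    then show "(\<lambda>n. x + (?t - ?t * (1 / real (Suc n))) *\<^sub>R e) \<longlonglongrightarrow> x + ?t *\<^sub>R e" by simp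
    show "x + (?t - ?t * (1 / real (Suc n))) *\<^sub>R e \<in> \<Omega>" for n
      using tpos by (intro inside) (auto simp: field_simps)
  qed
  then show "x + ?t *\<^sub>R e \<in> frontier \<Omega>"
    using \<open>x + ?t *\<^sub>R e \<notin> \<Omega>\<close> \<Omega>(1) by (simp add: frontier_def interior_open)
qed

text \<open>For a at least 0, the exit time exceeds a exactly if the segment of length a in
  direction \<open>e\<close> stays in \<open>\<Omega>\<close>. The points for which this fails form
  the sum of a closed set and a compact segment, which is closed; the function is lower
  semicontinuous.\<close>

lemma exit_time_measurable:
  assumes \<Omega>: "open \<Omega>" "\<And>x. x \<in> \<Omega> \<Longrightarrow> norm x \<le> R" and e: "e \<in> Basis"
  shows "(\<lambda>x. if x \<in> \<Omega> then exit_time \<Omega> e x else 0) \<in> borel_measurable borel"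
proof -
  let ?T = "\<lambda>x. if x \<in> \<Omega> then exit_time \<Omega> e x else 0"
  have "{x. a < ?T x} \<in> sets borel" for a
  proof (cases "a < 0")
    case True
    then have "{x. a < ?T x} = UNIV" using exit_time(1)[OF \<Omega> e] by (auto intro: less_le_trans)
    then show ?thesis by simp
  next
    case False
    let ?Z = "(\<lambda>s. - s *\<^sub>R e) ` {0..a}"
    have eq: "{x. a < ?T x} = - (\<Union>y\<in>- \<Omega>. \<Union>z\<in>?Z. {y + z})"
    proof (rule set_eqI, rule iffI)
      fix x assume "x \<in> {x. a < ?T x}"
      then have x: "x \<in> \<Omega>" "a < exit_time \<Omega> e x" using False by (auto split: if_splits)
      have "x \<noteq> y + - s *\<^sub>R e" if "y \<notin> \<Omega>" "s \<in> {0..a}" for y s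
      proof
        assume "x = y + - s *\<^sub>R e"
        then have "y = x + s *\<^sub>R e" by simp
        then show False using exit_time(3)[OF \<Omega> e x(1), of s] x(2) that by auto
      qed
      then show "x \<in> - (\<Union>y\<in>- \<Omega>. \<Union>z\<in>?Z. {y + z})" by auto
    next
      fix x assume "x \<in> - (\<Union>y\<in>- \<Omega>. \<Union>z\<in>?Z. {y + z})"
      then have x: "x + s *\<^sub>R e \<in> \<Omega>" if "s \<in> {0..a}" for s
        using that by (force dest: spec[of _ "x + s *\<^sub>R e"])
      have x0: "x \<in> \<Omega>" using x[of 0] False by simp
      have "a < exit_time \<Omega> e x"
        using x exit_time(1,4)[OF \<Omega> e x0] by (meson atLeastAtMost_iff not_le)
      then show "x \<in> {x. a < ?T x}" using x0 by simp
    qed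
    have cl: "closed (\<Union>y\<in>- \<Omega>. \<Union>z\<in>?Z. {y + z})"
      using \<Omega>(1) by (intro closed_compact_sums compact_continuous_image continuous_intros) (auto simp: closed_Compl)
    show ?thesis unfolding eq by (rule borel_open[OF open_Compl[OF cl]])
  qed
  then show ?thesis by (subst borel_measurable_iff_greater) simp
qed

text \<open>The fundamental theorem of calculus on the ray to the exit point \<open>P x\<close>,
  with Cauchy-Schwarz, bounds the squared value at x by twice the squared value at
  \<open>P x\<close> plus 2D times the integral of the squared derivative over the ray. Integrated
  over x, the first term becomes a boundary integral with factor 2K; in the second, each shift of
  length up to D contributes at most the gradient norm, whence the 2 D^2.\<close>

lemma smooth_Poincare_boundary:
  fixes \<Omega> :: "'a::euclidean_space set"
  assumes \<Omega>: "open \<Omega>" "bounded \<Omega>"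
  shows "\<exists>C\<ge>0. \<forall>\<phi>. smooth \<phi> \<longrightarrow> L2_norm_sq (lebesgue_on \<Omega>) \<phi> \<le> ennreal C *
    (L2_norm_sq (boundary_measure \<Omega>) \<phi> +
     L2_norm_sq (lebesgue_on \<Omega>) (\<lambda>x. \<Sum>i\<in>Basis. frechet_derivative \<phi> (at x) i *\<^sub>R i))"
proof -
  obtain R where R: "\<And>x. x \<in> \<Omega> \<Longrightarrow> norm x \<le> R" "0 \<le> R"
    using \<Omega>(2) unfolding bounded_pos by (metis less_imp_le)
  obtain e :: 'a where e: "e \<in> Basis" using nonempty_Basis by blast
  define D where "D = 2 * R + 1"
  have D: "0 \<le> D" using R(2) by (simp add: D_def)
  define T where "T x = (if x \<in> \<Omega> then exit_time \<Omega> e x else 0)" for x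
  have Tm [measurable]: "T \<in> borel_measurable borel"
    unfolding T_def[abs_def] by (rule exit_time_measurable[OF \<Omega>(1) R(1) e])
  have [measurable]: "\<Omega> \<in> sets borel" "frontier \<Omega> \<in> sets borel" using \<Omega> by auto
  have \<Omega>m: "\<Omega> \<in> sets lebesgue" using \<Omega> by auto
  have T: "0 \<le> T x" "T x \<le> D" "\<And>s. 0 \<le> s \<Longrightarrow> s < T x \<Longrightarrow> x + s *\<^sub>R e \<in> \<Omega>" "x + T x *\<^sub>R e \<in> frontier \<Omega>"
    if "x \<in> \<Omega>" for x
    using exit_time[OF \<Omega>(1) R(1) e that] that by (auto simp: T_def D_def)
  define P where "P x = x + T x *\<^sub>R e" for x
  have Pm [measurable]: "P \<in> borel_measurable borel" unfolding P_def[abs_def] by measurable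
  let ?n = "DIM('a) - 1"
  define K where "K = (2 + D) * 4 ^ ?n / unit_ball_vol (real ?n)"
  have K: "0 \<le> K" using D unit_ball_vol_nonneg[of "real ?n"] by (simp add: K_def)
  let ?H = "hausdorff_measure ?n :: 'a measure"
  let ?\<nu> = "distr (restrict_space lborel \<Omega>) borel P"
  let ?\<mu> = "scale_measure (ennreal K) (density ?H (indicator (frontier \<Omega>)))"
  \<comment> \<open>Stated as an order between measures, so that the cylinder bound extends from
    indicators to all nonnegative Borel integrands.\<close>
  have \<nu>\<mu>: "?\<nu> \<le> ?\<mu>"
  proof -
    have sets: "sets ?\<nu> = sets ?\<mu>" by simp
    have "emeasure ?\<nu> \<le> emeasure ?\<mu>"
    proof (rule le_funI)
      fix B
      show "emeasure ?\<nu> B \<le> emeasure ?\<mu> B"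
      proof (cases "B \<in> sets borel")
        case True
        note [measurable] = True
        have "emeasure ?\<nu> B = emeasure (restrict_space lborel \<Omega>) (P -` B \<inter> \<Omega>)"
          by (subst emeasure_distr) (auto simp: space_restrict_space measurable_restrict_space1)
        also have "\<dots> = emeasure lborel (P -` B \<inter> \<Omega>)"
          by (subst emeasure_restrict_space) auto
        also have "\<dots> \<le> ennreal K * hausdorff_outer ?n (B \<inter> frontier \<Omega>)"
          unfolding K_def
        proof (rule emeasure_cylinder[OF e D])
          show "P -` B \<inter> \<Omega> \<in> sets borel"
            using measurable_sets[OF Pm True] by (simp add: sets.Int)
          show "\<exists>t. 0 \<le> t \<and> t \<le> D \<and> x + t *\<^sub>R e \<in> B \<inter> frontier \<Omega>" if "x \<in> P -` B \<inter> \<Omega>" for x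
            using that T[of x] by (intro exI[of _ "T x"]) (auto simp: P_def)
        qed
        also have "hausdorff_outer ?n (B \<inter> frontier \<Omega>) = emeasure ?H (B \<inter> frontier \<Omega>)"
          by (rule emeasure_hausdorff_measure[symmetric]) simp
        also have "\<dots> = emeasure (density ?H (indicator (frontier \<Omega>))) B"
          by (subst emeasure_density) (auto simp: indicator_inter_arith[symmetric] Int_commute nn_integral_indicator[symmetric] simp del: nn_integral_indicator)
        finally show ?thesis by simp
      qed (simp add: emeasure_notin_sets)
    qed
    then show ?thesis
      using sets sets_eq_imp_space_eq[OF sets] by (simp only: le_measure_iff if_True simp_thms)
  qed
  have trace: "(\<integral>\<^sup>+x\<in>\<Omega>. G (P x) \<partial>lborel) \<le> ennreal K * (\<integral>\<^sup>+x. G x \<partial>boundary_measure \<Omega>)"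
    if Gm [measurable]: "G \<in> borel_measurable borel" for G
  proof -
    have "(\<integral>\<^sup>+x\<in>\<Omega>. G (P x) \<partial>lborel) = (\<integral>\<^sup>+x. G (P x) \<partial>restrict_space lborel \<Omega>)"
      by (rule nn_integral_restrict_space[symmetric]) simp
    also have "\<dots> = (\<integral>\<^sup>+x. G x \<partial>?\<nu>)"
      by (subst nn_integral_distr) (auto simp: measurable_restrict_space1)
    also have "\<dots> \<le> (\<integral>\<^sup>+x. G x \<partial>?\<mu>)"
      by (rule nn_integral_mono_measure[OF _ \<nu>\<mu>]) simp
    also have "\<dots> = ennreal K * (\<integral>\<^sup>+x. indicator (frontier \<Omega>) x * G x \<partial>?H)"
      by (subst nn_integral_scale_measure) (auto simp: nn_integral_density)
    also have "\<dots> = ennreal K * (\<integral>\<^sup>+x. G x \<partial>boundary_measure \<Omega>)"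
      by (simp add: nn_integral_boundary_measure mult.commute)
    finally show ?thesis .
  qed
  have main: "L2_norm_sq (lebesgue_on \<Omega>) \<phi> \<le> ennreal (2 * K + 2 * D * D) *
      (L2_norm_sq (boundary_measure \<Omega>) \<phi> +
       L2_norm_sq (lebesgue_on \<Omega>) (\<lambda>x. \<Sum>i\<in>Basis. frechet_derivative \<phi> (at x) i *\<^sub>R i))"
    if sm: "smooth \<phi>" for \<phi>
  proof -
    let ?d = "\<lambda>x. frechet_derivative \<phi> (at x) e"
    let ?g = "\<lambda>x. \<Sum>i\<in>Basis. frechet_derivative \<phi> (at x) i *\<^sub>R i"
    have [measurable]: "\<phi> \<in> borel_measurable borel" "?d \<in> borel_measurable borel"
      using sm by (auto intro: smooth_borel smooth_derivative_borel)
    have pt: "ennreal ((\<phi> x)\<^sup>2) \<le> 2 * ennreal ((\<phi> (P x))\<^sup>2)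
        + ennreal (2 * D) * (\<integral>\<^sup>+s. ennreal ((?d (x + s *\<^sub>R e))\<^sup>2) * indicator \<Omega> (x + s *\<^sub>R e) * indicator {0..D} s \<partial>lborel)"
      if x: "x \<in> \<Omega>" for x
    proof -
      let ?f = "\<lambda>s. ?d (x + s *\<^sub>R e)" and ?t = "T x"
      let ?M = "restrict_space lborel {0..?t}"
      note Tx = T[OF x]
      have cf: "continuous_on UNIV ?f"
        by (rule continuous_on_compose2[OF smooth_continuous_on_derivative[OF sm, of UNIV]]) (auto intro!: continuous_intros)
      then have fm [measurable]: "?f \<in> borel_measurable borel" by (rule borel_measurable_continuous_onI)
      have I: "{0..?t} \<inter> space lborel \<in> sets lborel" by simp
      have FTC: "(\<integral>s. ?f s * indicator {0..?t} s \<partial>lborel) = \<phi> (x + ?t *\<^sub>R e) - \<phi> (x + 0 *\<^sub>R e)"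
        by (rule integral_FTC_Icc_real)
           (use Tx cf in \<open>auto intro!: smooth_derivative_along[OF sm] simp: continuous_on_eq_continuous_at\<close>)
      obtain B where B: "\<And>s. s \<in> {0..?t} \<Longrightarrow> \<bar>?f s\<bar> \<le> B"
      proof -
        have "compact (?f ` {0..?t})" using cf by (intro compact_continuous_image) (auto intro: continuous_on_subset)
        then obtain B where "\<forall>s\<in>{0..?t}. \<bar>?f s\<bar> \<le> B" by (auto simp: bounded_iff dest!: compact_imp_bounded)
        then show ?thesis using that by blast
      qed
      have nn: "L2_norm_sq ?M ?f = (\<integral>\<^sup>+s\<in>{0..?t}. ennreal ((?f s)\<^sup>2) \<partial>lborel)"
        unfolding L2_norm_sq_def by (subst nn_integral_restrict_space[OF I]) simp
      have emM: "emeasure ?M (space ?M) = ennreal ?t"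
        using Tx by (simp add: emeasure_restrict_space space_restrict_space)
      have fL: "?f \<in> L2 ?M"
      proof -
        have "L2_norm_sq ?M ?f \<le> (\<integral>\<^sup>+s. ennreal (B\<^sup>2) \<partial>?M)"
          unfolding L2_norm_sq_def
        proof (intro nn_integral_mono ennreal_leI)
          fix s assume "s \<in> space ?M"
          then have "\<bar>?f s\<bar> \<le> B" using B by (simp add: space_restrict_space)
          then show "(norm (?f s))\<^sup>2 \<le> B\<^sup>2" by (intro power_mono) auto
        qed
        also have "\<dots> < \<infinity>" using emM by (simp add: ennreal_mult_less_top)
        finally show ?thesis by (simp add: L2_def measurable_restrict_space1)
      qed
      have oneL: "(\<lambda>s. 1::real) \<in> L2 ?M" using emM by (simp add: L2_def L2_norm_sq_def)
      have sq1: "sqnorm ?M (\<lambda>s. 1::real) = ?t"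
        using L2_norm_sq_eq[OF oneL] emM Tx by (simp add: L2_norm_sq_def)
      have "(\<phi> (P x) - \<phi> x)\<^sup>2 = (\<integral>s. ?f s \<bullet> 1 \<partial>?M)\<^sup>2"
        using FTC by (simp add: P_def integral_restrict_space[OF I] mult.commute)
      also have "\<dots> \<le> sqnorm ?M ?f * ?t"
        using L2_Cauchy_Schwarz[OF fL oneL] sq1 by simp
      also have "\<dots> \<le> sqnorm ?M ?f * D" using Tx by (intro mult_left_mono) auto
      finally have diff: "(\<phi> (P x) - \<phi> x)\<^sup>2 \<le> D * sqnorm ?M ?f" by (simp add: mult.commute)
      have "(\<phi> x)\<^sup>2 \<le> 2 * (\<phi> (P x))\<^sup>2 + 2 * (\<phi> (P x) - \<phi> x)\<^sup>2"
        using norm_add_sq_le[of "\<phi> (P x)" "- (\<phi> (P x) - \<phi> x)"] by (simp add: power2_commute)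
      also have "\<dots> \<le> 2 * (\<phi> (P x))\<^sup>2 + 2 * D * sqnorm ?M ?f" using diff by simp
      finally have "ennreal ((\<phi> x)\<^sup>2) \<le> ennreal (2 * (\<phi> (P x))\<^sup>2 + 2 * D * sqnorm ?M ?f)" by (rule ennreal_leI)
      also have "\<dots> = 2 * ennreal ((\<phi> (P x))\<^sup>2) + ennreal (2 * D) * L2_norm_sq ?M ?f"
        using D by (simp add: L2_norm_sq_eq[OF fL] ennreal_mult)
      also have "L2_norm_sq ?M ?f \<le> (\<integral>\<^sup>+s. ennreal ((?f s)\<^sup>2) * indicator \<Omega> (x + s *\<^sub>R e) * indicator {0..D} s \<partial>lborel)"
        unfolding nn
      proof (rule nn_integral_mono_AE)
        show "AE s in lborel. ennreal ((?f s)\<^sup>2) * indicator {0..?t} s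
            \<le> ennreal ((?f s)\<^sup>2) * indicator \<Omega> (x + s *\<^sub>R e) * indicator {0..D} s"
          \<comment> \<open>The exit point itself is outside \<open>\<Omega>\<close>; it is a single
            parameter value and is discarded.\<close>
          using AE_lborel_singleton[of ?t]
        proof eventually_elim
          fix s assume "s \<noteq> ?t"
          then show "ennreal ((?f s)\<^sup>2) * indicator {0..?t} s
            \<le> ennreal ((?f s)\<^sup>2) * indicator \<Omega> (x + s *\<^sub>R e) * indicator {0..D} s"
            using Tx(2) Tx(3)[of s] by (cases "s \<in> {0..?t}") auto
        qed
      qed
      finally show ?thesis by (simp add: add_left_mono mult_left_mono)
    qed
    have "L2_norm_sq (lebesgue_on \<Omega>) \<phi> = (\<integral>\<^sup>+x\<in>\<Omega>. ennreal ((\<phi> x)\<^sup>2) \<partial>lborel)"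
      by (simp add: L2_norm_sq_lebesgue_on[OF \<Omega>m])
    also have "\<dots> \<le> (\<integral>\<^sup>+x. 2 * (ennreal ((\<phi> (P x))\<^sup>2) * indicator \<Omega> x)
        + ennreal (2 * D) * (\<integral>\<^sup>+s. ennreal ((?d (x + s *\<^sub>R e))\<^sup>2) * indicator \<Omega> (x + s *\<^sub>R e) * indicator {0..D} s \<partial>lborel) \<partial>lborel)"
      using pt by (intro nn_integral_mono) (auto simp: indicator_def)
    also have "\<dots> = 2 * (\<integral>\<^sup>+x\<in>\<Omega>. ennreal ((\<phi> (P x))\<^sup>2) \<partial>lborel)
        + ennreal (2 * D) * (\<integral>\<^sup>+x. (\<integral>\<^sup>+s. ennreal ((?d (x + s *\<^sub>R e))\<^sup>2) * indicator \<Omega> (x + s *\<^sub>R e) * indicator {0..D} s \<partial>lborel) \<partial>lborel)"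
      by (subst nn_integral_add, measurable) (subst (1 2) nn_integral_cmult, measurable)
    \<comment> \<open>The indicator of \<open>\<Omega>\<close> at the shifted point was kept for
      this exchange: for fixed s the inner integral is a translate of an integral over
      \<open>\<Omega>\<close>.\<close>
    also have "(\<integral>\<^sup>+x. (\<integral>\<^sup>+s. ennreal ((?d (x + s *\<^sub>R e))\<^sup>2) * indicator \<Omega> (x + s *\<^sub>R e) * indicator {0..D} s \<partial>lborel) \<partial>lborel)
       = (\<integral>\<^sup>+s. (\<integral>\<^sup>+x. ennreal ((?d (x + s *\<^sub>R e))\<^sup>2) * indicator \<Omega> (x + s *\<^sub>R e) * indicator {0..D} s \<partial>lborel) \<partial>lborel)"
      by (rule lborel_pair.Fubini'[symmetric]) measurable
    also have "\<dots> = (\<integral>\<^sup>+s. (\<integral>\<^sup>+x\<in>\<Omega>. ennreal ((?d x)\<^sup>2) \<partial>lborel) * indicator {0..D} s \<partial>lborel)"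
    proof (intro nn_integral_cong)
      fix s :: real
      have "(\<integral>\<^sup>+x. ennreal ((?d (x + s *\<^sub>R e))\<^sup>2) * indicator \<Omega> (x + s *\<^sub>R e) * indicator {0..D} s \<partial>lborel)
        = (\<integral>\<^sup>+x. ennreal ((?d (x + s *\<^sub>R e))\<^sup>2) * indicator \<Omega> (x + s *\<^sub>R e) \<partial>lborel) * indicator {0..D} s"
        by (rule nn_integral_multc) measurable
      also have "(\<integral>\<^sup>+x. ennreal ((?d (x + s *\<^sub>R e))\<^sup>2) * indicator \<Omega> (x + s *\<^sub>R e) \<partial>lborel)
        = (\<integral>\<^sup>+x\<in>\<Omega>. ennreal ((?d x)\<^sup>2) \<partial>lborel)"
        by (rule nn_integral_lborel_translate[of "\<lambda>x. ennreal ((?d x)\<^sup>2) * indicator \<Omega> x"]) measurable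
      finally show "(\<integral>\<^sup>+x. ennreal ((?d (x + s *\<^sub>R e))\<^sup>2) * indicator \<Omega> (x + s *\<^sub>R e) * indicator {0..D} s \<partial>lborel)
        = (\<integral>\<^sup>+x\<in>\<Omega>. ennreal ((?d x)\<^sup>2) \<partial>lborel) * indicator {0..D} s" .
    qed
    also have "\<dots> = (\<integral>\<^sup>+x\<in>\<Omega>. ennreal ((?d x)\<^sup>2) \<partial>lborel) * ennreal D"
      using D by (subst nn_integral_cmult_indicator) auto
    also have "(\<integral>\<^sup>+x\<in>\<Omega>. ennreal ((\<phi> (P x))\<^sup>2) \<partial>lborel) \<le> ennreal K * L2_norm_sq (boundary_measure \<Omega>) \<phi>"
      unfolding L2_norm_sq_def using trace[of "\<lambda>x. ennreal ((\<phi> x)\<^sup>2)"] by simp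
    also have "(\<integral>\<^sup>+x\<in>\<Omega>. ennreal ((?d x)\<^sup>2) \<partial>lborel) \<le> L2_norm_sq (lebesgue_on \<Omega>) ?g"
    proof -
      have "?d x = ?g x \<bullet> e" for x
        using e by (simp add: inner_sum_left inner_Basis if_distrib cong: if_cong)
      then have "(?d x)\<^sup>2 \<le> (norm (?g x))\<^sup>2" for x
        using Cauchy_Schwarz_ineq2[of "?g x" e] e power_mono[of "\<bar>?g x \<bullet> e\<bar>" "norm (?g x)" 2] by simp
      then show ?thesis
        unfolding L2_norm_sq_lebesgue_on[OF \<Omega>m]
        by (intro nn_integral_mono mult_right_mono ennreal_leI) auto
    qed
    finally have "L2_norm_sq (lebesgue_on \<Omega>) \<phi> \<le> 2 * (ennreal K * L2_norm_sq (boundary_measure \<Omega>) \<phi>)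
        + ennreal (2 * D) * (L2_norm_sq (lebesgue_on \<Omega>) ?g * ennreal D)"
      by (simp add: add_mono mult_left_mono mult_right_mono)
    also have "\<dots> = ennreal (2 * K) * L2_norm_sq (boundary_measure \<Omega>) \<phi> + ennreal (2 * D * D) * L2_norm_sq (lebesgue_on \<Omega>) ?g"
      using K D by (simp add: ennreal_mult mult_ac)
    also have "\<dots> \<le> ennreal (2 * K + 2 * D * D) * L2_norm_sq (boundary_measure \<Omega>) \<phi> + ennreal (2 * K + 2 * D * D) * L2_norm_sq (lebesgue_on \<Omega>) ?g"
      using K D by (intro add_mono mult_right_mono ennreal_leI) auto
    finally show ?thesis by (simp add: distrib_left)
  qed
  have "0 \<le> 2 * K + 2 * D * D" using K D by simp
  then show ?thesis using main by blast
qed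

section \<open>Functions with trace zero\<close>

abbreviation smooth_gradient :: "('a::euclidean_space \<Rightarrow> real) \<Rightarrow> 'a \<Rightarrow> 'a" where
  "smooth_gradient \<phi> \<equiv> \<lambda>x. \<Sum>i\<in>Basis. frechet_derivative \<phi> (at x) i *\<^sub>R i"

lemma H1_pair_L2: "H1_pair \<Omega> u g \<Longrightarrow> u \<in> L2 (lebesgue_on \<Omega>)" "H1_pair \<Omega> u g \<Longrightarrow> g \<in> L2 (lebesgue_on \<Omega>)"
  by (auto simp: H1_pair_def)

lemma H1_pair_weak_gradient_AE:
  assumes "open \<Omega>" "H1_pair \<Omega> u g"
  shows "AE x in lebesgue_on \<Omega>. weak_gradient \<Omega> u x = g x"
proof (rule H1_pair_unique[OF assms(1) _ assms(2)])
  show "H1_pair \<Omega> u (weak_gradient \<Omega> u)"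
    using assms(2) by (intro H1_pair_weak_gradient) (auto simp: H1_iff)
qed simp

lemma H1_norm_sq_pair:
  assumes "open \<Omega>" "H1_pair \<Omega> u g"
  shows "H1_norm_sq \<Omega> u = L2_norm_sq (lebesgue_on \<Omega>) u + L2_norm_sq (lebesgue_on \<Omega>) g"
  using L2_norm_sq_cong_AE[OF H1_pair_weak_gradient_AE[OF assms]] by (simp add: H1_norm_sq_def)

lemma smooth_boundary_measurable: "smooth \<phi> \<Longrightarrow> \<phi> \<in> borel_measurable (boundary_measure \<Omega>)"
  unfolding boundary_measure_def
  by (intro measurable_restrict_space1) (simp add: measurable_cong_sets[OF sets_hausdorff_measure refl] smooth_borel)

text \<open>\<open>has_trace\<close> with boundary value 0 asks for one sequence with two limits,
  one of them through \<open>weak_gradient\<close>. The sum of the three errors, with an explicit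
  gradient \<open>g\<close>, leaves a single null sequence that can be estimated and
  diagonalised.\<close>

definition trace_defect :: "'a::euclidean_space set \<Rightarrow> ('a \<Rightarrow> real) \<Rightarrow> ('a \<Rightarrow> 'a) \<Rightarrow> ('a \<Rightarrow> real) \<Rightarrow> ennreal" where
  "trace_defect \<Omega> v g \<phi> = L2_norm_sq (lebesgue_on \<Omega>) (\<lambda>x. \<phi> x - v x)
     + L2_norm_sq (lebesgue_on \<Omega>) (\<lambda>x. smooth_gradient \<phi> x - g x)
     + L2_norm_sq (boundary_measure \<Omega>) \<phi>"

lemma has_trace_0_iff:
  assumes \<Omega>: "open \<Omega>" "bounded \<Omega>" and p: "H1_pair \<Omega> v g"
  shows "has_trace \<Omega> v (\<lambda>x. 0) \<longleftrightarrow>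
    (\<exists>\<phi>. (\<forall>n. smooth (\<phi> n)) \<and> (\<lambda>n. trace_defect \<Omega> v g (\<phi> n)) \<longlonglongrightarrow> 0)"
proof -
  have \<Omega>m: "\<Omega> \<in> sets lebesgue" using \<Omega> by auto
  have H1n: "H1_norm_sq \<Omega> (\<lambda>x. \<phi> x - v x) = L2_norm_sq (lebesgue_on \<Omega>) (\<lambda>x. \<phi> x - v x)
     + L2_norm_sq (lebesgue_on \<Omega>) (\<lambda>x. smooth_gradient \<phi> x - g x)" if "smooth \<phi>" for \<phi>
    by (intro H1_norm_sq_pair H1_pair_diff smooth_H1_pair that \<Omega> \<Omega>m p)
  have vH: "v \<in> H1 \<Omega>" using p by (auto simp: H1_iff)
  show ?thesis
  proof
    assume "has_trace \<Omega> v (\<lambda>x. 0)"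
    then obtain \<phi> where \<phi>: "\<And>n. smooth (\<phi> n)" "(\<lambda>n. H1_norm_sq \<Omega> (\<lambda>x. \<phi> n x - v x)) \<longlonglongrightarrow> 0"
      "(\<lambda>n. L2_norm_sq (boundary_measure \<Omega>) (\<phi> n)) \<longlonglongrightarrow> 0"
      unfolding has_trace_def by auto
    have "(\<lambda>n. trace_defect \<Omega> v g (\<phi> n)) \<longlonglongrightarrow> 0 + 0"
      unfolding trace_defect_def H1n[OF \<phi>(1), symmetric] by (intro tendsto_add \<phi>)
    then show "\<exists>\<phi>. (\<forall>n. smooth (\<phi> n)) \<and> (\<lambda>n. trace_defect \<Omega> v g (\<phi> n)) \<longlonglongrightarrow> 0"
      using \<phi>(1) by auto
  next
    assume "\<exists>\<phi>. (\<forall>n. smooth (\<phi> n)) \<and> (\<lambda>n. trace_defect \<Omega> v g (\<phi> n)) \<longlonglongrightarrow> 0"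
    then obtain \<phi> where \<phi>: "\<And>n. smooth (\<phi> n)" "(\<lambda>n. trace_defect \<Omega> v g (\<phi> n)) \<longlonglongrightarrow> 0" by auto
    have "(\<lambda>n. H1_norm_sq \<Omega> (\<lambda>x. \<phi> n x - v x)) \<longlonglongrightarrow> 0"
      unfolding H1n[OF \<phi>(1)] by (rule tendsto_0_ennreal_mono[OF \<phi>(2)]) (simp add: trace_defect_def)
    moreover have "(\<lambda>n. L2_norm_sq (boundary_measure \<Omega>) (\<phi> n)) \<longlonglongrightarrow> 0"
      by (rule tendsto_0_ennreal_mono[OF \<phi>(2)]) (simp add: trace_defect_def)
    ultimately show "has_trace \<Omega> v (\<lambda>x. 0)"
      unfolding has_trace_def using vH \<phi>(1) by auto
  qed
qed

lemma L2_norm_sq_lincomb_le: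
  fixes f g :: "'a \<Rightarrow> 'b::euclidean_space"
  assumes "f \<in> borel_measurable M" "g \<in> borel_measurable M"
  shows "L2_norm_sq M (\<lambda>x. a *\<^sub>R f x + b *\<^sub>R g x) \<le> ennreal (2 * a\<^sup>2) * L2_norm_sq M f + ennreal (2 * b\<^sup>2) * L2_norm_sq M g"
proof -
  have "L2_norm_sq M (\<lambda>x. a *\<^sub>R f x + b *\<^sub>R g x) \<le> 2 * L2_norm_sq M (\<lambda>x. a *\<^sub>R f x) + 2 * L2_norm_sq M (\<lambda>x. b *\<^sub>R g x)"
    using assms by (intro L2_norm_sq_add_le borel_measurable_scaleR) auto
  then show ?thesis using assms by (simp add: L2_norm_sq_scaleR ennreal_mult mult.assoc)
qed

text \<open>The approximating sequences are combined with the same coefficients. Each term of the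
  defect is a squared norm, so the new defect is at most the combination of the old ones with
  weights 2a^2 and 2b^2.\<close>

lemma has_trace_0_lincomb:
  assumes \<Omega>: "open \<Omega>" "bounded \<Omega>" and p: "H1_pair \<Omega> v g" "H1_pair \<Omega> v' g'"
    and tr: "has_trace \<Omega> v (\<lambda>x. 0)" "has_trace \<Omega> v' (\<lambda>x. 0)"
  shows "has_trace \<Omega> (\<lambda>x. a * v x + b * v' x) (\<lambda>x. 0)"
proof -
  have \<Omega>m: "\<Omega> \<in> sets lebesgue" using \<Omega> by auto
  obtain \<phi> where \<phi>: "\<And>n. smooth (\<phi> n)" "(\<lambda>n. trace_defect \<Omega> v g (\<phi> n)) \<longlonglongrightarrow> 0"
    using tr(1) has_trace_0_iff[OF \<Omega> p(1)] by auto
  obtain \<psi> where \<psi>: "\<And>n. smooth (\<psi> n)" "(\<lambda>n. trace_defect \<Omega> v' g' (\<psi> n)) \<longlonglongrightarrow> 0"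
    using tr(2) has_trace_0_iff[OF \<Omega> p(2)] by auto
  let ?\<theta> = "\<lambda>n x. a * \<phi> n x + b * \<psi> n x"
  have sm: "smooth (?\<theta> n)" for n by (intro smooth_add smooth_cmult \<phi> \<psi>)
  have grad: "smooth_gradient (?\<theta> n) x = a *\<^sub>R smooth_gradient (\<phi> n) x + b *\<^sub>R smooth_gradient (\<psi> n) x" for n x
  proof -
    have "frechet_derivative (?\<theta> n) (at x)
        = (\<lambda>i. a * frechet_derivative (\<phi> n) (at x) i + b * frechet_derivative (\<psi> n) (at x) i)"
      by (intro frechet_derivative_eqI has_derivative_add has_derivative_mult_right smooth_has_derivative \<phi> \<psi>)
    then show ?thesis by (simp add: scaleR_add_left sum.distrib scaleR_sum_right)
  qed
  have pp: "H1_pair \<Omega> (\<lambda>x. a * v x + b * v' x) (\<lambda>x. a *\<^sub>R g x + b *\<^sub>R g' x)"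
    by (intro H1_pair_add H1_pair_cmult p \<Omega>m)
  have m: "\<phi> n \<in> borel_measurable (lebesgue_on \<Omega>)" "\<psi> n \<in> borel_measurable (lebesgue_on \<Omega>)"
    "smooth_gradient (\<phi> n) \<in> borel_measurable (lebesgue_on \<Omega>)" "smooth_gradient (\<psi> n) \<in> borel_measurable (lebesgue_on \<Omega>)"
    "v \<in> borel_measurable (lebesgue_on \<Omega>)" "v' \<in> borel_measurable (lebesgue_on \<Omega>)"
    "g \<in> borel_measurable (lebesgue_on \<Omega>)" "g' \<in> borel_measurable (lebesgue_on \<Omega>)" for n
    using H1_pair_L2[OF smooth_H1_pair[OF \<phi>(1) \<Omega>, of n]] H1_pair_L2[OF smooth_H1_pair[OF \<psi>(1) \<Omega>, of n]]
      H1_pair_L2[OF p(1)] H1_pair_L2[OF p(2)]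
    by (auto intro: L2_measurable)
  have le: "trace_defect \<Omega> (\<lambda>x. a * v x + b * v' x) (\<lambda>x. a *\<^sub>R g x + b *\<^sub>R g' x) (?\<theta> n)
     \<le> ennreal (2 * a\<^sup>2) * trace_defect \<Omega> v g (\<phi> n) + ennreal (2 * b\<^sup>2) * trace_defect \<Omega> v' g' (\<psi> n)" for n
  proof -
    have 1: "L2_norm_sq (lebesgue_on \<Omega>) (\<lambda>x. ?\<theta> n x - (a * v x + b * v' x))
      \<le> ennreal (2 * a\<^sup>2) * L2_norm_sq (lebesgue_on \<Omega>) (\<lambda>x. \<phi> n x - v x) + ennreal (2 * b\<^sup>2) * L2_norm_sq (lebesgue_on \<Omega>) (\<lambda>x. \<psi> n x - v' x)"
      using L2_norm_sq_lincomb_le[of "\<lambda>x. \<phi> n x - v x" "lebesgue_on \<Omega>" "\<lambda>x. \<psi> n x - v' x" a b] m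
      by (simp add: algebra_simps)
    have "(\<lambda>x. smooth_gradient (?\<theta> n) x - (a *\<^sub>R g x + b *\<^sub>R g' x))
       = (\<lambda>x. a *\<^sub>R (smooth_gradient (\<phi> n) x - g x) + b *\<^sub>R (smooth_gradient (\<psi> n) x - g' x))"
      by (simp only: grad scaleR_diff_right) (simp add: algebra_simps)
    then have 2: "L2_norm_sq (lebesgue_on \<Omega>) (\<lambda>x. smooth_gradient (?\<theta> n) x - (a *\<^sub>R g x + b *\<^sub>R g' x))
      \<le> ennreal (2 * a\<^sup>2) * L2_norm_sq (lebesgue_on \<Omega>) (\<lambda>x. smooth_gradient (\<phi> n) x - g x)
       + ennreal (2 * b\<^sup>2) * L2_norm_sq (lebesgue_on \<Omega>) (\<lambda>x. smooth_gradient (\<psi> n) x - g' x)"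
      using m by (simp only:) (intro L2_norm_sq_lincomb_le borel_measurable_diff)
    have 3: "L2_norm_sq (boundary_measure \<Omega>) (?\<theta> n)
      \<le> ennreal (2 * a\<^sup>2) * L2_norm_sq (boundary_measure \<Omega>) (\<phi> n) + ennreal (2 * b\<^sup>2) * L2_norm_sq (boundary_measure \<Omega>) (\<psi> n)"
      using L2_norm_sq_lincomb_le[OF smooth_boundary_measurable[OF \<phi>(1)] smooth_boundary_measurable[OF \<psi>(1)], where a=a and b=b] by simp
    have "x1 + x2 + x3 \<le> A * (a1 + a2 + a3) + B * (b1 + b2 + b3)"
      if "x1 \<le> A * a1 + B * b1" "x2 \<le> A * a2 + B * b2" "x3 \<le> A * a3 + B * b3"
      for x1 x2 x3 a1 a2 a3 b1 b2 b3 A B :: ennreal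
      using add_mono[OF add_mono[OF that(1,2)] that(3)] by (simp add: distrib_left add_ac)
    from this[OF 1 2 3] show ?thesis unfolding trace_defect_def .
  qed
  have "(\<lambda>n. trace_defect \<Omega> (\<lambda>x. a * v x + b * v' x) (\<lambda>x. a *\<^sub>R g x + b *\<^sub>R g' x) (?\<theta> n)) \<longlonglongrightarrow> 0"
    by (rule tendsto_0_ennreal_mono[OF tendsto_0_ennreal_lincomb[OF \<phi>(2) \<psi>(2)] le])
  then show ?thesis unfolding has_trace_0_iff[OF \<Omega> pp] using sm by (intro exI[of _ ?\<theta>] conjI allI)
qed

lemma has_trace_0_zero: "has_trace \<Omega> (\<lambda>x. 0) (\<lambda>x. 0)" if "open \<Omega>" "bounded \<Omega>"
proof -
  have "frechet_derivative (\<lambda>x. 0) (at x) = (\<lambda>i. 0)" for x :: 'a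
    by (rule frechet_derivative_eqI) simp
  then have "trace_defect \<Omega> (\<lambda>x. 0) (\<lambda>x. 0) (\<lambda>x. 0) = 0"
    by (simp add: trace_defect_def)
  then show ?thesis
    unfolding has_trace_0_iff[OF that H1_pair_zero] by (intro exI[of _ "\<lambda>n x. 0"]) auto
qed

text \<open>For each \<open>v n\<close> one approximant with defect at most 1/(n+1) is kept. Its
  defect with respect to the limit is at most twice that plus twice the distances of function and
  gradient, since the boundary term does not involve the function approximated.\<close>

lemma has_trace_0_closed:
  assumes \<Omega>: "open \<Omega>" "bounded \<Omega>" and p: "\<And>n. H1_pair \<Omega> (v n) (g n)" and q: "H1_pair \<Omega> w d"
    and tr: "\<And>n. has_trace \<Omega> (v n) (\<lambda>x. 0)"
    and lim: "(\<lambda>n. L2_norm_sq (lebesgue_on \<Omega>) (\<lambda>x. v n x - w x)) \<longlonglongrightarrow> 0"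
      "(\<lambda>n. L2_norm_sq (lebesgue_on \<Omega>) (\<lambda>x. g n x - d x)) \<longlonglongrightarrow> 0"
  shows "has_trace \<Omega> w (\<lambda>x. 0)"
proof -
  have "\<exists>\<phi>. smooth \<phi> \<and> trace_defect \<Omega> (v n) (g n) \<phi> \<le> ennreal (1 / Suc n)" for n
  proof -
    obtain \<phi> where \<phi>: "\<And>k. smooth (\<phi> k)" "(\<lambda>k. trace_defect \<Omega> (v n) (g n) (\<phi> k)) \<longlonglongrightarrow> 0"
      using tr[of n] has_trace_0_iff[OF \<Omega> p[of n]] by auto
    then show ?thesis using tendsto_0_ennrealD[OF \<phi>(2), of "1 / Suc n"] by auto
  qed
  then obtain \<phi> where sm: "\<And>n. smooth (\<phi> n)" and le: "\<And>n. trace_defect \<Omega> (v n) (g n) (\<phi> n) \<le> ennreal (1 / Suc n)"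
    by metis
  have m: "\<phi> n \<in> borel_measurable (lebesgue_on \<Omega>)" "smooth_gradient (\<phi> n) \<in> borel_measurable (lebesgue_on \<Omega>)"
    "v n \<in> borel_measurable (lebesgue_on \<Omega>)" "g n \<in> borel_measurable (lebesgue_on \<Omega>)"
    "w \<in> borel_measurable (lebesgue_on \<Omega>)" "d \<in> borel_measurable (lebesgue_on \<Omega>)" for n
    using H1_pair_L2[OF smooth_H1_pair[OF sm \<Omega>, of n]] H1_pair_L2[OF p[of n]] H1_pair_L2[OF q]
    by (auto intro: L2_measurable)
  let ?e = "\<lambda>n. L2_norm_sq (lebesgue_on \<Omega>) (\<lambda>x. v n x - w x) + L2_norm_sq (lebesgue_on \<Omega>) (\<lambda>x. g n x - d x)"
  have est: "trace_defect \<Omega> w d (\<phi> n) \<le> ennreal 2 * ennreal (1 / Suc n) + ennreal 2 * ?e n" for n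
  proof -
    have 1: "L2_norm_sq (lebesgue_on \<Omega>) (\<lambda>x. \<phi> n x - w x) \<le>
        2 * L2_norm_sq (lebesgue_on \<Omega>) (\<lambda>x. \<phi> n x - v n x) + 2 * L2_norm_sq (lebesgue_on \<Omega>) (\<lambda>x. v n x - w x)"
      using m by (intro L2_norm_sq_diff_triangle)
    have 2: "L2_norm_sq (lebesgue_on \<Omega>) (\<lambda>x. smooth_gradient (\<phi> n) x - d x) \<le>
        2 * L2_norm_sq (lebesgue_on \<Omega>) (\<lambda>x. smooth_gradient (\<phi> n) x - g n x) + 2 * L2_norm_sq (lebesgue_on \<Omega>) (\<lambda>x. g n x - d x)"
      using m by (intro L2_norm_sq_diff_triangle)
    have 3: "L2_norm_sq (boundary_measure \<Omega>) (\<phi> n) \<le> 2 * L2_norm_sq (boundary_measure \<Omega>) (\<phi> n)"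
      using mult_right_mono[of 1 2 "L2_norm_sq (boundary_measure \<Omega>) (\<phi> n)"] by simp
    have "x1 + x2 + x3 \<le> 2 * (a1 + a2 + a3) + 2 * (b1 + b2)"
      if "x1 \<le> 2 * a1 + 2 * b1" "x2 \<le> 2 * a2 + 2 * b2" "x3 \<le> 2 * a3"
      for x1 x2 x3 a1 a2 a3 b1 b2 :: ennreal
      using add_mono[OF add_mono[OF that(1,2)] that(3)] by (simp add: distrib_left add_ac)
    from this[OF 1 2 3] have "trace_defect \<Omega> w d (\<phi> n) \<le> 2 * trace_defect \<Omega> (v n) (g n) (\<phi> n) + 2 * ?e n"
      unfolding trace_defect_def .
    also have "\<dots> \<le> 2 * ennreal (1 / Suc n) + 2 * ?e n"
      by (intro add_right_mono mult_left_mono le) auto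
    finally show ?thesis by simp
  qed
  have "(\<lambda>n. ennreal (1 / Suc n)) \<longlonglongrightarrow> ennreal 0"
    by (intro tendsto_ennrealI LIMSEQ_Suc[OF lim_1_over_n])
  then have l1: "(\<lambda>n. ennreal (1 / Suc n)) \<longlonglongrightarrow> 0" by simp
  have l2: "?e \<longlonglongrightarrow> 0" using tendsto_add[OF lim] by simp
  have "(\<lambda>n. trace_defect \<Omega> w d (\<phi> n)) \<longlonglongrightarrow> 0"
    by (rule tendsto_0_ennreal_mono[OF tendsto_0_ennreal_lincomb[OF l1 l2] est])
  then show ?thesis unfolding has_trace_0_iff[OF \<Omega> q] using sm by (intro exI[of _ \<phi>] conjI allI)
qed

text \<open>The inequality for smooth functions is applied to the approximants; their boundary norms
  are part of the defect and vanish in the limit. The factor 4 comes from splitting a square twice,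
  once for the function and once for the gradient, and 2 + 4C dominates every coefficient of the
  defect.\<close>

lemma Poincare_trace_0:
  fixes \<Omega> :: "'a::euclidean_space set"
  assumes \<Omega>: "open \<Omega>" "bounded \<Omega>"
  shows "\<exists>C\<ge>0. \<forall>v g. H1_pair \<Omega> v g \<longrightarrow> has_trace \<Omega> v (\<lambda>x. 0) \<longrightarrow>
    L2_norm_sq (lebesgue_on \<Omega>) v \<le> ennreal C * L2_norm_sq (lebesgue_on \<Omega>) g"
proof -
  obtain C where C: "0 \<le> C" "\<And>\<phi>. smooth \<phi> \<Longrightarrow> L2_norm_sq (lebesgue_on \<Omega>) \<phi> \<le> ennreal C *
    (L2_norm_sq (boundary_measure \<Omega>) \<phi> + L2_norm_sq (lebesgue_on \<Omega>) (smooth_gradient \<phi>))"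
    using smooth_Poincare_boundary[OF \<Omega>] by blast
  have "L2_norm_sq (lebesgue_on \<Omega>) v \<le> ennreal (4 * C) * L2_norm_sq (lebesgue_on \<Omega>) g"
    if p: "H1_pair \<Omega> v g" and tr: "has_trace \<Omega> v (\<lambda>x. 0)" for v g
  proof -
    obtain \<phi> where sm: "\<And>n. smooth (\<phi> n)" and lim: "(\<lambda>n. trace_defect \<Omega> v g (\<phi> n)) \<longlonglongrightarrow> 0"
      using tr has_trace_0_iff[OF \<Omega> p] by auto
    have m: "\<phi> n \<in> borel_measurable (lebesgue_on \<Omega>)" "smooth_gradient (\<phi> n) \<in> borel_measurable (lebesgue_on \<Omega>)"
      "v \<in> borel_measurable (lebesgue_on \<Omega>)" "g \<in> borel_measurable (lebesgue_on \<Omega>)" for n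
      using H1_pair_L2[OF smooth_H1_pair[OF sm \<Omega>, of n]] H1_pair_L2[OF p]
      by (auto intro: L2_measurable)
    let ?c = "ennreal (2 + 4 * C)"
    have est: "L2_norm_sq (lebesgue_on \<Omega>) v \<le> ?c * trace_defect \<Omega> v g (\<phi> n) + ennreal (4 * C) * L2_norm_sq (lebesgue_on \<Omega>) g" for n
    proof -
      let ?a1 = "L2_norm_sq (lebesgue_on \<Omega>) (\<lambda>x. \<phi> n x - v x)"
      let ?a2 = "L2_norm_sq (lebesgue_on \<Omega>) (\<lambda>x. smooth_gradient (\<phi> n) x - g x)"
      let ?a3 = "L2_norm_sq (boundary_measure \<Omega>) (\<phi> n)"
      let ?g = "L2_norm_sq (lebesgue_on \<Omega>) g"
      have "L2_norm_sq (lebesgue_on \<Omega>) v \<le> 2 * L2_norm_sq (lebesgue_on \<Omega>) (\<phi> n) + 2 * ?a1"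
        using L2_norm_sq_diff_le[of "\<phi> n" "lebesgue_on \<Omega>" "\<lambda>x. \<phi> n x - v x"] m by simp
      also have "\<dots> \<le> 2 * (ennreal C * (?a3 + L2_norm_sq (lebesgue_on \<Omega>) (smooth_gradient (\<phi> n)))) + 2 * ?a1"
        by (intro add_right_mono mult_left_mono C sm) auto
      also have "\<dots> \<le> 2 * (ennreal C * (?a3 + (2 * ?a2 + 2 * ?g))) + 2 * ?a1"
        using L2_norm_sq_add_le[of "\<lambda>x. smooth_gradient (\<phi> n) x - g x" "lebesgue_on \<Omega>" g] m
        by (intro add_right_mono mult_left_mono add_left_mono) auto
      also have "\<dots> = ennreal 2 * ?a1 + ennreal (2 * C) * ?a3 + ennreal (4 * C) * ?a2 + ennreal (4 * C) * ?g"
      proof -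
        have "ennreal (2 * C) = 2 * ennreal C" "ennreal (4 * C) = 4 * ennreal C"
          using C(1) by (simp_all add: ennreal_mult)
        then show ?thesis by (simp add: distrib_left mult_ac add_ac)
      qed
      also have "\<dots> \<le> ?c * ?a1 + ?c * ?a3 + ?c * ?a2 + ennreal (4 * C) * ?g"
        using C(1) by (intro add_right_mono add_mono mult_right_mono ennreal_leI) auto
      also have "\<dots> = ?c * trace_defect \<Omega> v g (\<phi> n) + ennreal (4 * C) * ?g"
        by (simp add: trace_defect_def distrib_left add_ac)
      finally show ?thesis .
    qed
    have "(\<lambda>n. ?c * trace_defect \<Omega> v g (\<phi> n) + ennreal (4 * C) * L2_norm_sq (lebesgue_on \<Omega>) g)
        \<longlonglongrightarrow> ?c * 0 + ennreal (4 * C) * L2_norm_sq (lebesgue_on \<Omega>) g"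
      by (intro tendsto_add tendsto_const ennreal_tendsto_cmult lim) simp
    then show ?thesis
      using est by (intro tendsto_lowerbound[where F=sequentially]) auto
  qed
  moreover have "0 \<le> 4 * C" using C(1) by simp
  ultimately show ?thesis by blast
qed

text \<open>Fatou's lemma; the bounds converge, so their limit inferior is their limit.\<close>

lemma L2_norm_sq_lsc:
  fixes f :: "nat \<Rightarrow> 'a \<Rightarrow> 'b::euclidean_space"
  assumes f [measurable]: "\<And>n. f n \<in> borel_measurable M" and ae: "AE x in M. (\<lambda>n. f n x) \<longlonglongrightarrow> l x"
    and le: "\<And>n. L2_norm_sq M (f n) \<le> ennreal (c n)" and lim: "c \<longlonglongrightarrow> C"
  shows "L2_norm_sq M l \<le> ennreal C"
proof -
  have "L2_norm_sq M l \<le> (\<integral>\<^sup>+x. liminf (\<lambda>n. ennreal ((norm (f n x))\<^sup>2)) \<partial>M)"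
    unfolding L2_norm_sq_def
  proof (intro nn_integral_mono_AE, use ae in eventually_elim)
    fix x assume "(\<lambda>n. f n x) \<longlonglongrightarrow> l x"
    then have "(\<lambda>n. ennreal ((norm (f n x))\<^sup>2)) \<longlonglongrightarrow> ennreal ((norm (l x))\<^sup>2)"
      by (intro tendsto_ennrealI tendsto_intros)
    then show "ennreal ((norm (l x))\<^sup>2) \<le> liminf (\<lambda>n. ennreal ((norm (f n x))\<^sup>2))"
      using lim_imp_Liminf[OF sequentially_bot] by (metis order_refl)
  qed
  also have "\<dots> \<le> liminf (\<lambda>n. L2_norm_sq M (f n))"
    unfolding L2_norm_sq_def by (rule nn_integral_liminf) measurable
  also have "\<dots> \<le> liminf (\<lambda>n. ennreal (c n))"
    by (intro Liminf_mono always_eventually allI le)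
  also have "\<dots> = ennreal C"
    by (intro lim_imp_Liminf[OF sequentially_bot] tendsto_ennrealI lim)
  finally show ?thesis .
qed

lemma sqnorm_parallelogram:
  fixes a b :: "'a \<Rightarrow> 'b::euclidean_space"
  assumes "a \<in> L2 M" "b \<in> L2 M"
  shows "sqnorm M (\<lambda>x. a x - b x) = 2 * sqnorm M a + 2 * sqnorm M b - 4 * sqnorm M (\<lambda>x. (1/2) *\<^sub>R a x + (1/2) *\<^sub>R b x)"
proof -
  have pt: "(norm (p - q))\<^sup>2 = 2 * (norm p)\<^sup>2 + 2 * (norm q)\<^sup>2 - 4 * (norm ((1/2) *\<^sub>R p + (1/2) *\<^sub>R q))\<^sup>2" for p q :: 'b
    unfolding power2_norm_eq_inner by (simp add: inner_add_left inner_add_right inner_diff_left inner_diff_right inner_commute)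
  have m: "(\<lambda>x. (1/2) *\<^sub>R a x + (1/2) *\<^sub>R b x) \<in> L2 M" by (intro L2_add L2_scaleR assms)
  note int = L2_integrable_sq[OF assms(1)] L2_integrable_sq[OF assms(2)] L2_integrable_sq[OF m]
  have "sqnorm M (\<lambda>x. a x - b x)
      = (\<integral>x. 2 * (norm (a x))\<^sup>2 + 2 * (norm (b x))\<^sup>2 - 4 * (norm ((1/2) *\<^sub>R a x + (1/2) *\<^sub>R b x))\<^sup>2 \<partial>M)"
    unfolding sqnorm_def pt ..
  also have "\<dots> = (\<integral>x. 2 * (norm (a x))\<^sup>2 + 2 * (norm (b x))\<^sup>2 \<partial>M) - (\<integral>x. 4 * (norm ((1/2) *\<^sub>R a x + (1/2) *\<^sub>R b x))\<^sup>2 \<partial>M)"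
    by (intro Bochner_Integration.integral_diff Bochner_Integration.integrable_add integrable_mult_right int)
  also have "(\<integral>x. 2 * (norm (a x))\<^sup>2 + 2 * (norm (b x))\<^sup>2 \<partial>M) = (\<integral>x. 2 * (norm (a x))\<^sup>2 \<partial>M) + (\<integral>x. 2 * (norm (b x))\<^sup>2 \<partial>M)"
    by (intro Bochner_Integration.integral_add integrable_mult_right int)
  finally show ?thesis by (simp only: sqnorm_def integral_mult_right_zero)
qed

section \<open>Existence of a minimizer\<close>

text \<open>The first term of \<open>J\<close> as an integral over all of \<open>\<Omega>\<close>:
  the dependence of the domain of integration on the competitor becomes a case distinction in the
  integrand, where limits can be taken point by point.\<close>

definition inertia :: "'a::euclidean_space set \<Rightarrow> real \<Rightarrow> ('a \<Rightarrow> real) \<Rightarrow> ('a \<Rightarrow> real) \<Rightarrow> ('a \<Rightarrow> real) \<Rightarrow> ennreal" where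
  "inertia \<Omega> h u1 u2 w = (\<integral>\<^sup>+x. (if 0 < w x \<or> 0 < u1 x \<or> 0 < u2 x
     then ennreal (\<bar>w x - 2 * u1 x + u2 x\<bar>\<^sup>2 / (2 * h\<^sup>2)) else 0) \<partial>lebesgue_on \<Omega>)"

lemma J_eq:
  assumes "\<Omega> \<in> sets lebesgue"
  shows "J \<Omega> h u1 u2 w = inertia \<Omega> h u1 u2 w
    + ennreal (1 / 4) * L2_norm_sq (lebesgue_on \<Omega>) (\<lambda>x. weak_gradient \<Omega> w x + weak_gradient \<Omega> u2 x)"
proof -
  have \<Omega>: "\<Omega> \<inter> space lebesgue \<in> sets lebesgue" using assms by simp
  show ?thesis
    unfolding J_def inertia_def L2_norm_sq_def nn_integral_restrict_space[OF \<Omega>]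
    by (intro arg_cong2[where f="(+)"] nn_integral_cong refl)
       (auto simp: S_set_def positivity_set_def indicator_def)
qed

lemma inertia_cong_AE:
  assumes "AE x in lebesgue_on \<Omega>. w x = w' x"
  shows "inertia \<Omega> h u1 u2 w = inertia \<Omega> h u1 u2 w'"
  unfolding inertia_def by (intro nn_integral_cong_AE) (use assms in \<open>auto elim: eventually_mono\<close>)

text \<open>The integrand is not convex in \<open>w\<close>, but it is lower semicontinuous: it jumps upwards
  on the open set where \<open>w\<close> is positive.\<close>

lemma inertia_lsc:
  assumes m [measurable]: "\<And>n. w n \<in> borel_measurable (lebesgue_on \<Omega>)"
      "u1 \<in> borel_measurable (lebesgue_on \<Omega>)" "u2 \<in> borel_measurable (lebesgue_on \<Omega>)"
    and ae: "AE x in lebesgue_on \<Omega>. (\<lambda>n. w n x) \<longlonglongrightarrow> l x"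
  shows "inertia \<Omega> h u1 u2 l \<le> liminf (\<lambda>n. inertia \<Omega> h u1 u2 (w n))"
proof -
  let ?\<psi> = "\<lambda>v x. (if 0 < v x \<or> 0 < u1 x \<or> 0 < u2 x
     then ennreal (\<bar>v x - 2 * u1 x + u2 x\<bar>\<^sup>2 / (2 * h\<^sup>2)) else 0)"
  have "inertia \<Omega> h u1 u2 l \<le> (\<integral>\<^sup>+x. liminf (\<lambda>n. ?\<psi> (w n) x) \<partial>lebesgue_on \<Omega>)"
    unfolding inertia_def
  proof (intro nn_integral_mono_AE, use ae in eventually_elim)
    fix x assume lim: "(\<lambda>n. w n x) \<longlonglongrightarrow> l x"
    show "?\<psi> l x \<le> liminf (\<lambda>n. ?\<psi> (w n) x)"
    proof (cases "0 < l x \<or> 0 < u1 x \<or> 0 < u2 x")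
      case True
      \<comment> \<open>A positive \<open>l x\<close> forces \<open>w n x\<close> to be eventually
        positive; positivity of \<open>u1 x\<close> or \<open>u2 x\<close> does not depend on
        n.\<close>
      have pos: "\<forall>\<^sub>F n in sequentially. 0 < w n x \<or> 0 < u1 x \<or> 0 < u2 x"
      proof (cases "0 < l x")
        case True
        from order_tendstoD(1)[OF lim this] show ?thesis by eventually_elim simp
      qed (use True in auto)
      have "(\<lambda>n. ennreal (\<bar>w n x - 2 * u1 x + u2 x\<bar>\<^sup>2 / (2 * h\<^sup>2)))
          \<longlonglongrightarrow> ennreal (\<bar>l x - 2 * u1 x + u2 x\<bar>\<^sup>2 / (2 * h\<^sup>2))"
        unfolding divide_inverse by (intro tendsto_ennrealI tendsto_intros lim)
      then have "(\<lambda>n. ?\<psi> (w n) x) \<longlonglongrightarrow> ennreal (\<bar>l x - 2 * u1 x + u2 x\<bar>\<^sup>2 / (2 * h\<^sup>2))"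
        by (rule Lim_transform_eventually) (use pos in eventually_elim, simp)
      then have "liminf (\<lambda>n. ?\<psi> (w n) x) = ennreal (\<bar>l x - 2 * u1 x + u2 x\<bar>\<^sup>2 / (2 * h\<^sup>2))"
        by (rule lim_imp_Liminf[OF sequentially_bot])
      then show ?thesis using True by simp
    qed simp
  qed
  also have "\<dots> \<le> liminf (\<lambda>n. inertia \<Omega> h u1 u2 (w n))"
    unfolding inertia_def by (rule nn_integral_liminf) measurable
  finally show ?thesis .
qed

lemma H1_add: "\<Omega> \<in> sets lebesgue \<Longrightarrow> u \<in> H1 \<Omega> \<Longrightarrow> v \<in> H1 \<Omega> \<Longrightarrow> (\<lambda>x. u x + v x) \<in> H1 \<Omega>"
  unfolding H1_iff using H1_pair_add by blast

lemma H1_cmult: "u \<in> H1 \<Omega> \<Longrightarrow> (\<lambda>x. c * u x) \<in> H1 \<Omega>"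
  unfolding H1_iff using H1_pair_cmult by blast

lemma exists_minimizer:
  fixes \<Omega> :: "'a::euclidean_space set"
  assumes \<Omega>: "open \<Omega>" "bounded \<Omega>"
    and u0: "u0 \<in> H1 \<Omega>" and u1: "u1 \<in> H1 \<Omega>" and u2: "u2 \<in> H1 \<Omega>"
    and J0: "J \<Omega> h u1 u2 u0 < \<infinity>"
  shows "\<exists>w. is_arg_min (J \<Omega> h u1 u2) (\<lambda>w. w \<in> admissible \<Omega> u0) w"
proof -
  have \<Omega>m: "\<Omega> \<in> sets lebesgue" using \<Omega> by auto
  let ?M = "lebesgue_on \<Omega>" and ?adm = "admissible \<Omega> u0" and ?D = "weak_gradient \<Omega>"
  let ?J = "J \<Omega> h u1 u2" and ?F = "inertia \<Omega> h u1 u2"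
  define G where "G = ?D u2"
  define g0 where "g0 = ?D u0"
  have p0: "H1_pair \<Omega> u0 g0" unfolding g0_def by (rule H1_pair_weak_gradient[OF u0])
  have p2: "H1_pair \<Omega> u2 G" unfolding G_def by (rule H1_pair_weak_gradient[OF u2])
  note L0 = H1_pair_L2[OF p0] and GL = H1_pair_L2(2)[OF p2]
  have um: "u1 \<in> borel_measurable ?M" "u2 \<in> borel_measurable ?M"
    using u1 u2 by (auto simp: H1_def L2_def)
  obtain C where C: "0 \<le> C" "\<And>v g. H1_pair \<Omega> v g \<Longrightarrow> has_trace \<Omega> v (\<lambda>x. 0) \<Longrightarrow>
      L2_norm_sq ?M v \<le> ennreal C * L2_norm_sq ?M g"
    using Poincare_trace_0[OF \<Omega>] by blast

  \<comment> \<open>Real-valued, so that infima and differences of gradient energies can be formed.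
    The shift \<open>G\<close> is common to all competitors and cancels in differences.\<close>
  define q where "q w = sqnorm ?M (\<lambda>x. ?D w x + G x)" for w
  have admH: "w \<in> H1 \<Omega>" and admT: "has_trace \<Omega> (\<lambda>x. w x - u0 x) (\<lambda>x. 0)" if "w \<in> ?adm" for w
    using that by (auto simp: admissible_def)
  have admP: "H1_pair \<Omega> w (?D w)" if "w \<in> ?adm" for w
    by (rule H1_pair_weak_gradient[OF admH[OF that]])
  have admL: "w \<in> L2 ?M" "?D w \<in> L2 ?M" if "w \<in> ?adm" for w
    using H1_pair_L2[OF admP[OF that]] by auto
  have qL: "(\<lambda>x. ?D w x + G x) \<in> L2 ?M" if "w \<in> ?adm" for w
    by (intro L2_add admL(2)[OF that] GL)
  have Jq: "?J w = ?F w + ennreal (q w / 4)" if "w \<in> ?adm" for w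
    unfolding J_eq[OF \<Omega>m] G_def[symmetric] L2_norm_sq_eq[OF qL[OF that]] q_def[symmetric]
    by (simp add: ennreal_mult[symmetric] q_def)
  have q_nonneg: "0 \<le> q w" for w by (simp add: q_def)
  \<comment> \<open>The weights add up to 1, so \<open>u0\<close> is subtracted exactly once and the
    trace conditions average. The chosen gradient of the midpoint is the mean of the gradients only
    almost everywhere, hence the passage through \<open>integral_cong_AE\<close>.\<close>
  have mid: "(\<lambda>x. (1/2) * v x + (1/2) * w x) \<in> ?adm"
    "sqnorm ?M (\<lambda>x. ?D v x - ?D w x) = 2 * q v + 2 * q w - 4 * q (\<lambda>x. (1/2) * v x + (1/2) * w x)"
    if vw: "v \<in> ?adm" "w \<in> ?adm" for v w
  proof -
    let ?m = "\<lambda>x. (1/2) * v x + (1/2) * w x"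
    have pm: "H1_pair \<Omega> ?m (\<lambda>x. (1/2) *\<^sub>R ?D v x + (1/2) *\<^sub>R ?D w x)"
      by (intro H1_pair_add H1_pair_cmult admP vw \<Omega>m)
    have "has_trace \<Omega> (\<lambda>x. (1/2) * (v x - u0 x) + (1/2) * (w x - u0 x)) (\<lambda>x. 0)"
      by (rule has_trace_0_lincomb[OF \<Omega> H1_pair_diff[OF \<Omega>m admP[OF vw(1)] p0] H1_pair_diff[OF \<Omega>m admP[OF vw(2)] p0]
            admT[OF vw(1)] admT[OF vw(2)]])
    moreover have "(\<lambda>x. (1/2) * (v x - u0 x) + (1/2) * (w x - u0 x)) = (\<lambda>x. ?m x - u0 x)"
      by (auto simp: field_simps)
    ultimately show madm: "?m \<in> ?adm" using pm by (auto simp: admissible_def H1_iff)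
    have "q ?m = sqnorm ?M (\<lambda>x. (1/2) *\<^sub>R (?D v x + G x) + (1/2) *\<^sub>R (?D w x + G x))"
      unfolding q_def sqnorm_def
    proof (rule integral_cong_AE)
      have "(\<lambda>x. (1/2) *\<^sub>R (?D v x + G x) + (1/2) *\<^sub>R (?D w x + G x)) \<in> L2 ?M"
        by (intro L2_add L2_scaleR admL(2) vw GL)
      from L2_measurable[OF this]
      show "(\<lambda>x. (norm ((1/2) *\<^sub>R (?D v x + G x) + (1/2) *\<^sub>R (?D w x + G x)))\<^sup>2) \<in> borel_measurable ?M" by measurable
      from L2_measurable[OF qL[OF madm]]
      show "(\<lambda>x. (norm (?D ?m x + G x))\<^sup>2) \<in> borel_measurable ?M" by measurable
      show "AE x in ?M. (norm (?D ?m x + G x))\<^sup>2 = (norm ((1/2) *\<^sub>R (?D v x + G x) + (1/2) *\<^sub>R (?D w x + G x)))\<^sup>2"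
        using H1_pair_weak_gradient_AE[OF \<Omega>(1) pm]
      proof eventually_elim
        fix x assume eq: "?D ?m x = (1/2) *\<^sub>R ?D v x + (1/2) *\<^sub>R ?D w x"
        have half: "(1/2) *\<^sub>R G x + (1/2) *\<^sub>R G x = G x"
          using scaleR_add_left[of "1/2" "1/2" "G x"] by simp
        have "(1/2) *\<^sub>R (?D v x + G x) + (1/2) *\<^sub>R (?D w x + G x)
            = ((1/2) *\<^sub>R ?D v x + (1/2) *\<^sub>R ?D w x) + ((1/2) *\<^sub>R G x + (1/2) *\<^sub>R G x)"
          by (simp only: scaleR_add_right add_ac)
        then show "(norm (?D ?m x + G x))\<^sup>2 = (norm ((1/2) *\<^sub>R (?D v x + G x) + (1/2) *\<^sub>R (?D w x + G x)))\<^sup>2"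
          unfolding eq half by simp
      qed
    qed
    then show "sqnorm ?M (\<lambda>x. ?D v x - ?D w x) = 2 * q v + 2 * q w - 4 * q ?m"
      using sqnorm_parallelogram[OF qL[OF vw(1)] qL[OF vw(2)]] by (simp add: q_def)
  qed

  have u0adm: "u0 \<in> ?adm"
    using u0 has_trace_0_zero[OF \<Omega>] by (simp add: admissible_def)
  define I where "I = (INF w\<in>?adm. ?J w)"
  have "I \<le> ?J u0" unfolding I_def using u0adm by (rule INF_lower)
  then have "I < \<infinity>" using J0 by (rule le_less_trans)
  then obtain i where i: "I = ennreal i" "0 \<le> i" by (cases I) auto
  have "\<exists>w\<in>?adm. ?J w < ennreal (i + 1 / Suc n)" for n
  proof -
    have "I < ennreal (i + 1 / Suc n)" using i by (simp add: ennreal_less_iff)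
    then show ?thesis unfolding I_def by (simp only: INF_less_iff)
  qed
  then obtain W where W: "\<And>n. W n \<in> ?adm" "\<And>n. ?J (W n) < ennreal (i + 1 / Suc n)" by metis
  have qW: "q (W n) \<le> 4 * (i + 1)" for n
  proof -
    have "ennreal (q (W n) / 4) \<le> ?J (W n)" unfolding Jq[OF W(1)] by simp
    also have "\<dots> \<le> ennreal (i + 1 / Suc n)" using W(2) by (rule less_imp_le)
    also have "\<dots> \<le> ennreal (i + 1)" by (intro ennreal_leI) simp
    finally have "q (W n) / 4 \<le> i + 1" by (subst (asm) ennreal_le_iff) (use i(2) in auto)
    then show ?thesis by simp
  qed

  obtain B where B: "\<And>n. sqnorm ?M (W n) \<le> B" "\<And>n. sqnorm ?M (?D (W n)) \<le> B"
  proof -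
    \<comment> \<open>\<open>?a\<close> bounds the gradients after removal of \<open>G\<close>;
      \<open>?b\<close> bounds the gradients of \<open>W n - u0\<close>, to which the Poincare
      inequality applies because the trace is zero.\<close>
    let ?a = "2 * (4 * (i + 1)) + 2 * sqnorm ?M G"
    let ?b = "2 * ?a + 2 * sqnorm ?M g0"
    have two: "sqnorm ?M (\<lambda>x. f x - g x) \<le> 2 * sqnorm ?M f + 2 * sqnorm ?M g"
      if fg: "f \<in> L2 ?M" "g \<in> L2 ?M" for f g :: "'a \<Rightarrow> 'b::euclidean_space"
    proof -
      have "ennreal (sqnorm ?M (\<lambda>x. f x - g x)) \<le> 2 * ennreal (sqnorm ?M f) + 2 * ennreal (sqnorm ?M g)"
        using L2_norm_sq_diff_le[of f ?M g] fg
        by (simp add: L2_norm_sq_eq[symmetric] L2_measurable L2_diff)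
      also have "\<dots> = ennreal (2 * sqnorm ?M f + 2 * sqnorm ?M g)" by (simp add: ennreal_mult)
      finally show ?thesis by (subst (asm) ennreal_le_iff) auto
    qed
    have Da: "sqnorm ?M (?D (W n)) \<le> ?a" for n
      using two[OF qL[OF W(1)[of n]] GL] qW[of n] by (simp add: q_def)
    have wb: "sqnorm ?M (W n) \<le> 2 * (C * ?b) + 2 * sqnorm ?M u0" for n
    proof -
      have dif: "(\<lambda>x. W n x - u0 x) \<in> L2 ?M" "(\<lambda>x. ?D (W n) x - g0 x) \<in> L2 ?M"
        by (intro L2_diff admL W L0)+
      have "sqnorm ?M (\<lambda>x. ?D (W n) x - g0 x) \<le> ?b"
        by (rule order_trans[OF two[OF admL(2)[OF W(1)] L0(2)]]) (intro add_right_mono mult_left_mono Da, simp)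
      moreover have "ennreal (sqnorm ?M (\<lambda>x. W n x - u0 x)) \<le> ennreal C * ennreal (sqnorm ?M (\<lambda>x. ?D (W n) x - g0 x))"
        using C(2)[OF H1_pair_diff[OF \<Omega>m admP[OF W(1)] p0] admT[OF W(1)], of n]
        by (simp add: L2_norm_sq_eq[OF dif(1)] L2_norm_sq_eq[OF dif(2)])
      then have "sqnorm ?M (\<lambda>x. W n x - u0 x) \<le> C * sqnorm ?M (\<lambda>x. ?D (W n) x - g0 x)"
        using C(1) by (simp add: ennreal_mult[symmetric] ennreal_le_iff)
      ultimately have d: "sqnorm ?M (\<lambda>x. W n x - u0 x) \<le> C * ?b"
        using C(1) by (meson mult_left_mono order_trans)
      have mL: "(\<lambda>x. - u0 x) \<in> L2 ?M" using L2_cmult[OF L0(1), of "-1"] by simp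
      have "sqnorm ?M (\<lambda>x. (W n x - u0 x) - (- u0 x)) \<le> 2 * sqnorm ?M (\<lambda>x. W n x - u0 x) + 2 * sqnorm ?M (\<lambda>x. - u0 x)"
        by (rule two[OF dif(1) mL])
      then show ?thesis using d by (simp add: sqnorm_def)
    qed
    show ?thesis
      using that[of "max ?a (2 * (C * ?b) + 2 * sqnorm ?M u0)"] Da wb by (auto simp: max.coboundedI1 max.coboundedI2)
  qed

  \<comment> \<open>Compactness is applied to Borel representatives extended by zero; the pointwise
    limit is transferred back to \<open>W\<close> afterwards.\<close>
  have "\<exists>f. f \<in> borel_measurable borel \<and> (\<forall>x. x \<notin> \<Omega> \<longrightarrow> f x = 0) \<and> (AE x in ?M. W n x = f x)" for n
    using ex_borel_representative[OF L2_measurable[OF admL(1)[OF W(1)[of n]]] \<Omega>(1)] by auto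
  then obtain f where f: "\<And>n. f n \<in> borel_measurable borel" "\<And>n x. x \<notin> \<Omega> \<Longrightarrow> f n x = 0"
    "\<And>n. AE x in ?M. W n x = f n x" by metis
  have pf: "H1_pair \<Omega> (f n) (?D (W n))" for n
    by (rule H1_pair_cong_AE[OF admP[OF W(1)] f(3) borel_measurable_lebesgue_on[OF f(1)] \<Omega>m])
  have fB: "sqnorm ?M (f n) \<le> B" for n
  proof -
    have "ennreal (sqnorm ?M (f n)) = ennreal (sqnorm ?M (W n))"
      using L2_norm_sq_cong_AE[OF f(3)[of n]] L2_norm_sq_eq[OF H1_pair_L2(1)[OF pf[of n]]] L2_norm_sq_eq[OF admL(1)[OF W(1)[of n]]]
      by simp
    then show ?thesis using B(1)[of n] by simp
  qed
  have "\<exists>r l. strict_mono r \<and> l \<in> borel_measurable borel \<and>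
    (AE x in lborel. x \<in> \<Omega> \<longrightarrow> (\<lambda>n. f (r n) x) \<longlonglongrightarrow> l x)"
  proof (rule Rellich_AE[OF f(1) _ pf \<Omega> fB B(2)])
    show "f n x = 0" if "x \<notin> \<Omega>" for n x using that by (rule f(2))
  qed
  then obtain r l where r: "strict_mono r" and lm: "l \<in> borel_measurable borel"
    and fl: "AE x in lborel. x \<in> \<Omega> \<longrightarrow> (\<lambda>n. f (r n) x) \<longlonglongrightarrow> l x"
    by (elim exE conjE) (rule that)
  have fl': "AE x in ?M. (\<lambda>n. f (r n) x) \<longlonglongrightarrow> l x"
    using \<Omega>m AE_completion[OF fl] by (subst AE_restrict_space_iff) auto
  define w where "w n = W (r n)" for n
  have wadm: "w n \<in> ?adm" for n by (simp add: w_def W)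
  have wJ: "?J (w n) \<le> ennreal (i + 1 / Suc n)" for n
  proof -
    have "1 / real (Suc (r n)) \<le> 1 / real (Suc n)" using seq_suble[OF r, of n] by (simp add: frac_le)
    then have "ennreal (i + 1 / Suc (r n)) \<le> ennreal (i + 1 / Suc n)" by (intro ennreal_leI) simp
    with W(2)[of "r n"] show ?thesis unfolding w_def by (meson less_imp_le order_trans)
  qed
  have wl: "AE x in ?M. (\<lambda>n. w n x) \<longlonglongrightarrow> l x"
  proof -
    have "AE x in ?M. \<forall>n. W (r n) x = f (r n) x" using f(3) by (subst AE_all_countable) auto
    with fl' show ?thesis unfolding w_def by eventually_elim simp
  qed

  text \<open>Almost minimising \<open>q\<close> over the convex sets \<open>K n\<close> of competitors that are as close to \<open>l\<close>
    as the tail of \<open>w\<close> replaces the passage to a weak limit: the almost minimisers converge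
    strongly, and still to \<open>l\<close>.\<close>

  define K where "K n = {z \<in> ?adm. AE x in ?M. \<forall>c. (\<forall>k\<ge>n. \<bar>w k x - l x\<bar> \<le> c) \<longrightarrow> \<bar>z x - l x\<bar> \<le> c}" for n
  have wK: "w k \<in> K n" if "n \<le> k" for n k
    using wadm that by (auto simp: K_def)
  have Kanti: "K m \<subseteq> K n" if "n \<le> m" for n m
    using that by (auto simp: K_def elim!: eventually_mono)
  have Kmid: "(\<lambda>x. (1/2) * y x + (1/2) * z x) \<in> K n" if yz: "y \<in> K n" "z \<in> K n" for y z n
  proof -
    have "AE x in ?M. \<forall>c. (\<forall>k\<ge>n. \<bar>w k x - l x\<bar> \<le> c) \<longrightarrow> \<bar>y x - l x\<bar> \<le> c"
      "AE x in ?M. \<forall>c. (\<forall>k\<ge>n. \<bar>w k x - l x\<bar> \<le> c) \<longrightarrow> \<bar>z x - l x\<bar> \<le> c"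
      using yz by (auto simp: K_def)
    then have "AE x in ?M. \<forall>c. (\<forall>k\<ge>n. \<bar>w k x - l x\<bar> \<le> c) \<longrightarrow> \<bar>((1/2) * y x + (1/2) * z x) - l x\<bar> \<le> c"
    proof (eventually_elim, intro allI impI)
      fix x c
      assume *: "\<forall>c. (\<forall>k\<ge>n. \<bar>w k x - l x\<bar> \<le> c) \<longrightarrow> \<bar>y x - l x\<bar> \<le> c"
        "\<forall>c. (\<forall>k\<ge>n. \<bar>w k x - l x\<bar> \<le> c) \<longrightarrow> \<bar>z x - l x\<bar> \<le> c" "\<forall>k\<ge>n. \<bar>w k x - l x\<bar> \<le> c"
      then have "\<bar>y x - l x\<bar> \<le> c" "\<bar>z x - l x\<bar> \<le> c" by blast+
      then show "\<bar>((1/2) * y x + (1/2) * z x) - l x\<bar> \<le> c" by (simp add: abs_le_iff)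
    qed
    then show ?thesis using mid(1)[of y z] yz by (auto simp: K_def)
  qed
  \<comment> \<open>Later sets are smaller, so these infima increase; they are bounded above because
    \<open>w n\<close> belongs to \<open>K n\<close>.\<close>
  define d where "d n = Inf (q ` K n)" for n
  have bdd: "bdd_below (q ` S)" for S using q_nonneg by (intro bdd_belowI[of _ 0]) auto
  have d_le: "d n \<le> q z" if "z \<in> K n" for n z
    unfolding d_def using bdd that by (intro cInf_lower) auto
  have "incseq d"
  proof (rule incseq_SucI)
    fix n show "d n \<le> d (Suc n)"
      unfolding d_def using wK[of "Suc n" "Suc n"] Kanti[of n "Suc n"] bdd by (intro cInf_superset_mono) auto
  qed
  moreover have "d n \<le> 4 * (i + 1)" for n
    using d_le[OF wK[of n n]] qW[of "r n"] by (simp add: w_def)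
  ultimately obtain Q where Q: "d \<longlonglongrightarrow> Q" "\<And>n. d n \<le> Q"
    using incseq_convergent[of d "4 * (i + 1)"] by metis
  have "\<exists>z\<in>K n. q z < d n + 1 / Suc n" for n
  proof -
    have "\<exists>y\<in>q ` K n. y < d n + 1 / Suc n"
      unfolding d_def using wK[of n n] by (intro cInf_lessD) auto
    then show ?thesis by auto
  qed
  then obtain z where zK: "\<And>n. z n \<in> K n" and zq: "\<And>n. q (z n) < d n + 1 / Suc n" by metis
  have zadm: "z n \<in> ?adm" for n using zK by (auto simp: K_def)
  \<comment> \<open>The midpoint lies in \<open>K N\<close>, so its energy is at least
    \<open>d N\<close>, while each of the two energies is at most \<open>Q + 1 / Suc N\<close>; the
    parallelogram law converts this into a bound for the difference.\<close>
  have gap: "sqnorm ?M (\<lambda>x. ?D (z m) x - ?D (z n) x) \<le> 4 * (Q - d N) + 4 / Suc N" if "m \<ge> N" "n \<ge> N" for m n N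
  proof -
    have "d N \<le> q (\<lambda>x. (1/2) * z m x + (1/2) * z n x)"
      by (intro d_le Kmid subsetD[OF Kanti zK] that)
    moreover have "q (z k) \<le> Q + 1 / Suc N" if "k \<ge> N" for k
    proof -
      have "1 / real (Suc k) \<le> 1 / real (Suc N)" using that by (simp add: frac_le)
      then show ?thesis using zq[of k] Q(2)[of k] by linarith
    qed
    from this[OF that(1)] this[OF that(2)]
    have "2 * q (z m) + 2 * q (z n) \<le> 4 * Q + 4 * (1 / Suc N)" by linarith
    ultimately show ?thesis using mid(2)[OF zadm zadm, of m n] by (simp add: algebra_simps)
  qed
  have gap0: "\<exists>N. \<forall>m\<ge>N. \<forall>n\<ge>N. sqnorm ?M (\<lambda>x. ?D (z m) x - ?D (z n) x) \<le> e" if "0 < e" for e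
  proof -
    have "(\<lambda>N. 4 * (Q - d N) + 4 * (1 / real (Suc N))) \<longlonglongrightarrow> 4 * (Q - Q) + 4 * 0"
      by (intro tendsto_intros Q LIMSEQ_Suc[OF lim_1_over_n])
    then have "\<forall>\<^sub>F N in sequentially. 4 * (Q - d N) + 4 * (1 / real (Suc N)) < e"
      using that by (intro order_tendstoD(2)) auto
    then obtain N where N: "4 * (Q - d N) + 4 / Suc N < e"
      by (auto simp: eventually_sequentially)
    have "sqnorm ?M (\<lambda>x. ?D (z m) x - ?D (z n) x) \<le> e" if "m \<ge> N" "n \<ge> N" for m n
      using gap[OF that] less_imp_le[OF N] by (rule order_trans)
    then show ?thesis by blast
  qed
  have Dz: "\<exists>N. \<forall>m\<ge>N. \<forall>n\<ge>N. L2_norm_sq ?M (\<lambda>x. ?D (z m) x - ?D (z n) x) \<le> ennreal e" if "0 < e" for e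
    using gap0[OF that] by (simp add: L2_norm_sq_eq L2_diff admL(2) zadm ennreal_leI) (meson ennreal_leI)
  have "\<exists>l\<in>L2 ?M. (\<lambda>n. L2_norm_sq ?M (\<lambda>x. ?D (z n) x - l x)) \<longlonglongrightarrow> 0 \<and>
    (\<exists>s. strict_mono s \<and> (AE x in ?M. (\<lambda>n. ?D (z (s n)) x) \<longlonglongrightarrow> l x))"
    by (rule L2_complete[OF admL(2)[OF zadm]]) (rule Dz)
  then obtain \<gamma> where \<gamma>L: "\<gamma> \<in> L2 ?M" and \<gamma>: "(\<lambda>n. L2_norm_sq ?M (\<lambda>x. ?D (z n) x - \<gamma> x)) \<longlonglongrightarrow> 0"
    and "\<exists>s. strict_mono s \<and> (AE x in ?M. (\<lambda>n. ?D (z (s n)) x) \<longlonglongrightarrow> \<gamma> x)"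
    by (elim bexE conjE) (rule that)
  then obtain s where s: "strict_mono s" "AE x in ?M. (\<lambda>n. ?D (z (s n)) x) \<longlonglongrightarrow> \<gamma> x"
    by (elim exE conjE) (rule that)
  have zz: "\<exists>N. \<forall>m\<ge>N. \<forall>n\<ge>N. L2_norm_sq ?M (\<lambda>x. z m x - z n x) \<le> ennreal e" if "0 < e" for e
  proof -
    \<comment> \<open>The 1 added to \<open>C\<close> avoids division by 0 and still gives
      \<open>C * (e / (C + 1)) \<le> e\<close>.\<close>
    obtain N where N: "\<And>m n. m \<ge> N \<Longrightarrow> n \<ge> N \<Longrightarrow> sqnorm ?M (\<lambda>x. ?D (z m) x - ?D (z n) x) \<le> e / (C + 1)"
      using gap0[of "e / (C + 1)"] \<open>0 < e\<close> C(1) by auto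
    have "L2_norm_sq ?M (\<lambda>x. z m x - z n x) \<le> ennreal e" if mn: "m \<ge> N" "n \<ge> N" for m n
    proof -
      have "has_trace \<Omega> (\<lambda>x. 1 * (z m x - u0 x) + (-1) * (z n x - u0 x)) (\<lambda>x. 0)"
        by (rule has_trace_0_lincomb[OF \<Omega> H1_pair_diff[OF \<Omega>m admP[OF zadm] p0] H1_pair_diff[OF \<Omega>m admP[OF zadm] p0]
              admT[OF zadm] admT[OF zadm]])
      then have "has_trace \<Omega> (\<lambda>x. z m x - z n x) (\<lambda>x. 0)" by simp
      from C(2)[OF H1_pair_diff[OF \<Omega>m admP[OF zadm] admP[OF zadm]] this]
      have "L2_norm_sq ?M (\<lambda>x. z m x - z n x) \<le> ennreal C * L2_norm_sq ?M (\<lambda>x. ?D (z m) x - ?D (z n) x)" .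
      also have "\<dots> = ennreal (C * sqnorm ?M (\<lambda>x. ?D (z m) x - ?D (z n) x))"
        using C(1) by (simp add: L2_norm_sq_eq L2_diff admL(2) zadm ennreal_mult)
      also have "\<dots> \<le> ennreal (C * (e / (C + 1)))"
        using N[OF mn] C(1) by (intro ennreal_leI mult_left_mono)
      also have "\<dots> \<le> ennreal e"
        using C(1) \<open>0 < e\<close> by (intro ennreal_leI) (simp add: field_simps)
      finally show ?thesis .
    qed
    then show ?thesis by blast
  qed
  have "\<exists>l\<in>L2 ?M. (\<lambda>n. L2_norm_sq ?M (\<lambda>x. z n x - l x)) \<longlonglongrightarrow> 0 \<and>
    (\<exists>t. strict_mono t \<and> (AE x in ?M. (\<lambda>n. z (t n) x) \<longlonglongrightarrow> l x))"
    by (rule L2_complete[OF admL(1)[OF zadm]]) (rule zz)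
  then obtain v where vL: "v \<in> L2 ?M" and v: "(\<lambda>n. L2_norm_sq ?M (\<lambda>x. z n x - v x)) \<longlonglongrightarrow> 0"
    and "\<exists>t. strict_mono t \<and> (AE x in ?M. (\<lambda>n. z (t n) x) \<longlonglongrightarrow> v x)"
    by (elim bexE conjE) (rule that)
  then obtain t where t: "strict_mono t" "AE x in ?M. (\<lambda>n. z (t n) x) \<longlonglongrightarrow> v x"
    by (elim exE conjE) (rule that)
  have pv: "H1_pair \<Omega> v \<gamma>" by (rule H1_pair_limit[OF \<Omega>m admP[OF zadm] vL \<gamma>L v \<gamma>])
  have vadm: "v \<in> ?adm"
  proof -
    have "has_trace \<Omega> (\<lambda>x. v x - u0 x) (\<lambda>x. 0)"
    proof (rule has_trace_0_closed[OF \<Omega> H1_pair_diff[OF \<Omega>m admP[OF zadm] p0] H1_pair_diff[OF \<Omega>m pv p0] admT[OF zadm]])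
      show "(\<lambda>n. L2_norm_sq ?M (\<lambda>x. z n x - u0 x - (v x - u0 x))) \<longlonglongrightarrow> 0" using v by simp
      show "(\<lambda>n. L2_norm_sq ?M (\<lambda>x. ?D (z n) x - g0 x - (\<gamma> x - g0 x))) \<longlonglongrightarrow> 0" using \<gamma> by simp
    qed
    then show ?thesis using pv by (auto simp: admissible_def H1_iff)
  qed
  \<comment> \<open>Any common bound for the distances of the later \<open>w k\<close> from
    \<open>l\<close> also bounds that of \<open>z n\<close>, so \<open>z n\<close> inherits the
    pointwise limit; along \<open>t\<close> it tends to \<open>v\<close> as well.\<close>
  have vl: "AE x in ?M. v x = l x"
  proof -
    have "AE x in ?M. \<forall>n. \<forall>c. (\<forall>k\<ge>n. \<bar>w k x - l x\<bar> \<le> c) \<longrightarrow> \<bar>z n x - l x\<bar> \<le> c"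
      using zK by (subst AE_all_countable) (auto simp: K_def)
    then show ?thesis using t(2) wl
    proof eventually_elim
      fix x
      assume *: "\<forall>n. \<forall>c. (\<forall>k\<ge>n. \<bar>w k x - l x\<bar> \<le> c) \<longrightarrow> \<bar>z n x - l x\<bar> \<le> c"
        and tx: "(\<lambda>n. z (t n) x) \<longlonglongrightarrow> v x" and wx: "(\<lambda>n. w n x) \<longlonglongrightarrow> l x"
      have "(\<lambda>n. z n x) \<longlonglongrightarrow> l x"
      proof (rule LIMSEQ_I)
        fix e :: real assume "0 < e"
        then obtain N where "\<And>k. k \<ge> N \<Longrightarrow> \<bar>w k x - l x\<bar> < e / 2"
          using LIMSEQ_D[OF wx, of "e / 2"] by auto
        then have "\<bar>z n x - l x\<bar> \<le> e / 2" if "n \<ge> N" for n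
          using *[rule_format, of n "e / 2"] that by (meson less_imp_le order_trans)
        then show "\<exists>N. \<forall>n\<ge>N. norm (z n x - l x) < e"
          using \<open>0 < e\<close> by (intro exI[of _ N]) (auto intro: le_less_trans[of _ "e / 2"])
      qed
      from LIMSEQ_subseq_LIMSEQ[OF this t(1)] have "(\<lambda>n. z (t n) x) \<longlonglongrightarrow> l x" by (simp add: o_def)
      with tx show "v x = l x" by (rule LIMSEQ_unique)
    qed
  qed
  have qv: "q v \<le> Q"
  proof -
    have "L2_norm_sq ?M (\<lambda>x. \<gamma> x + G x) \<le> ennreal Q"
    proof (rule L2_norm_sq_lsc)
      show "(\<lambda>x. ?D (z (s n)) x + G x) \<in> borel_measurable ?M" for n by (rule L2_measurable[OF qL[OF zadm]])
      show "AE x in ?M. (\<lambda>n. ?D (z (s n)) x + G x) \<longlonglongrightarrow> \<gamma> x + G x"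
        using s(2) by eventually_elim (intro tendsto_intros)
      show "L2_norm_sq ?M (\<lambda>x. ?D (z (s n)) x + G x) \<le> ennreal (Q + 1 / Suc n)" for n
      proof -
        have "1 / real (Suc (s n)) \<le> 1 / real (Suc n)" using seq_suble[OF s(1), of n] by (simp add: frac_le)
        then have "q (z (s n)) \<le> Q + 1 / Suc n" using zq[of "s n"] Q(2)[of "s n"] by linarith
        then show ?thesis unfolding L2_norm_sq_eq[OF qL[OF zadm]] q_def by (rule ennreal_leI)
      qed
      have "(\<lambda>n. Q + 1 / real (Suc n)) \<longlonglongrightarrow> Q + 0"
        by (intro tendsto_intros LIMSEQ_Suc[OF lim_1_over_n])
      then show "(\<lambda>n. Q + 1 / real (Suc n)) \<longlonglongrightarrow> Q" by simp
    qed
    moreover have "L2_norm_sq ?M (\<lambda>x. ?D v x + G x) = L2_norm_sq ?M (\<lambda>x. \<gamma> x + G x)"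
      using H1_pair_weak_gradient_AE[OF \<Omega>(1) pv] by (intro L2_norm_sq_cong_AE) (auto elim: eventually_mono)
    ultimately have "ennreal (q v) \<le> ennreal Q" unfolding q_def using L2_norm_sq_eq[OF qL[OF vadm]] by simp
    moreover have "0 \<le> Q" using Q(2)[of 0] d_def[of 0] cInf_greatest[of "q ` K 0" 0] wK[of 0 0] q_nonneg by fastforce
    ultimately show ?thesis by (simp add: ennreal_le_iff)
  qed
  \<comment> \<open>What is left for the inertia term of \<open>w n\<close> once
    \<open>d n / 4\<close> is reserved for the gradients. The subtraction is done in the reals, so
    finiteness of \<open>?F (w n)\<close> is settled first.\<close>
  define c where "c n = i + 1 / Suc n - d n / 4" for n
  have c: "0 \<le> c n" "?F (w n) \<le> ennreal (c n)" for n
  proof -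
    have le: "?F (w n) + ennreal (q (w n) / 4) \<le> ennreal (i + 1 / Suc n)"
      using wJ[of n] unfolding Jq[OF wadm] .
    have "?F (w n) \<le> ?F (w n) + ennreal (q (w n) / 4)" by simp
    also note le
    also have "ennreal (i + 1 / Suc n) < \<infinity>" by simp
    finally have "?F (w n) < \<infinity>" .
    then obtain F where F: "?F (w n) = ennreal F" "0 \<le> F" by (cases "?F (w n)") auto
    have "F + q (w n) / 4 \<le> i + 1 / Suc n"
      using le F i(2) q_nonneg[of "w n"] by (simp add: ennreal_plus[symmetric] ennreal_le_iff del: ennreal_plus)
    then have "F \<le> c n" using d_le[OF wK[of n n]] by (simp add: c_def)
    then show "0 \<le> c n" "?F (w n) \<le> ennreal (c n)" using F by (auto intro: ennreal_leI)
  qed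
  have clim: "c \<longlonglongrightarrow> i - Q / 4"
  proof -
    have "c \<longlonglongrightarrow> i + 0 - Q / 4"
      unfolding c_def by (intro tendsto_intros Q LIMSEQ_Suc[OF lim_1_over_n]) auto
    then show ?thesis by simp
  qed
  \<comment> \<open>Used when the two bounds are added below: \<open>ennreal\<close> of a negative
    number is 0, and the sum would not recombine to \<open>i\<close>.\<close>
  have iQ: "0 \<le> i - Q / 4" by (rule tendsto_lowerbound[OF clim]) (auto simp: c)
  have "?F v = ?F l" by (rule inertia_cong_AE[OF vl])
  also have "\<dots> \<le> liminf (\<lambda>n. ?F (w n))"
    by (rule inertia_lsc[OF L2_measurable[OF admL(1)[OF wadm]] um wl])
  also have "\<dots> \<le> liminf (\<lambda>n. ennreal (c n))"
    by (intro Liminf_mono always_eventually allI c)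
  also have "\<dots> = ennreal (i - Q / 4)"
    by (intro lim_imp_Liminf[OF sequentially_bot] tendsto_ennrealI clim)
  finally have Fv: "?F v \<le> ennreal (i - Q / 4)" .
  have "?J v \<le> ennreal (i - Q / 4) + ennreal (Q / 4)"
    unfolding Jq[OF vadm] using qv by (intro add_mono Fv ennreal_leI) simp
  also have "\<dots> = ennreal ((i - Q / 4) + Q / 4)"
    using iQ q_nonneg[of v] qv by (intro ennreal_plus[symmetric]) auto
  also have "\<dots> = I" using i by simp
  finally have "?J v \<le> I" .
  then have "is_arg_min ?J (\<lambda>w. w \<in> ?adm) v"
    unfolding is_arg_min_def I_def using vadm by (auto simp: not_less intro: order_trans INF_lower)
  then show ?thesis by blast
qed

theorem theorem3p1:
  fixes \<Omega> :: "'a::euclidean_space set" and h :: real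
    and v0 :: "'a \<Rightarrow> real" and u :: "nat \<Rightarrow> 'a \<Rightarrow> real" and m :: nat
  assumes "bounded_lipschitz_domain \<Omega>"
    and "h > 0"
    and "u 0 \<in> H1 \<Omega>"
    and "v0 \<in> H10 \<Omega>"
    and "u 1 = (\<lambda>x. u 0 x + h * v0 x)"
    and "m \<ge> 2"
    and "\<And>j. 2 \<le> j \<Longrightarrow> j < m \<Longrightarrow>
          \<exists>w. is_arg_min (J \<Omega> h (u (j - 1)) (u (j - 2))) (\<lambda>w. w \<in> admissible \<Omega> (u 0)) w \<and>
              u j = (\<lambda>x. max (w x) 0)"
    and "J \<Omega> h (u (m - 1)) (u (m - 2)) (u 0) < \<infinity>"
  shows "\<exists>w. is_arg_min (J \<Omega> h (u (m - 1)) (u (m - 2))) (\<lambda>w. w \<in> admissible \<Omega> (u 0)) w"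
proof -
  have \<Omega>: "open \<Omega>" "bounded \<Omega>" using assms(1) by (auto simp: bounded_lipschitz_domain_def)
  \<comment> \<open>No induction: each iterate from 2 on is the positive part of a function
    admissible with respect to \<open>u 0\<close>, and admissible functions lie in \<open>H1\<close>
    by definition.\<close>
  have uH: "u j \<in> H1 \<Omega>" if "j < m" for j
  proof -
    consider "j = 0" | "j = 1" | "2 \<le> j" by linarith
    then show ?thesis
    proof cases
      case 1
      then show ?thesis using assms(3) by simp
    next
      case 2
      have "v0 \<in> H1 \<Omega>" using assms(4) by (simp add: H10_def)
      then show ?thesis unfolding 2 assms(5) using assms(3) \<Omega> by (intro H1_add H1_cmult) auto
    next
      case 3
      obtain w where w: "w \<in> admissible \<Omega> (u 0)" "u j = (\<lambda>x. max (w x) 0)"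
        using assms(7)[OF 3 \<open>j < m\<close>] by (auto simp: is_arg_min_def)
      then have "w \<in> H1 \<Omega>" by (simp add: admissible_def)
      then show ?thesis unfolding w(2) by (rule H1_positive_part[OF _ \<Omega>])
    qed
  qed
  show ?thesis
    by (rule exists_minimizer[OF \<Omega> assms(3) uH uH assms(8)]) (use assms(6) in auto)
qed

end
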